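(* For $\alpha>0$ let $\mathbb E[\hat N_{JSQ}]$ and $\mathbb E[\hat N_{CQ}]$ denote the means of the stationary distributions of the limiting diffusions of Join-the-Shortest-Queue and of the Central Queue policy in the Non-Degenerate Slowdown regime with parameter $\alpha$. Then $$\sup_{\alpha>0}\frac{\mathbb E[\hat N_{JSQ}]}{\mathbb E[\hat N_{CQ}]}\le 1.14 .$$
   Context: Fix $\mu>0$. The JSQ diffusion on $(1,\infty)$ is $$d\hat N_{JSQ}(t)=\mu\Big[\frac{(2-\hat N_{JSQ}(t))_+}{\hat N_{JSQ}(t)-1}-\alpha\Big]dt+\sqrt{2\mu}\,dB(t),$$ where $(x)_+=\max(x,0)$ and $B$ is a standard Brownian motion. Its stationary density is proportional to $e^{-\alpha(n-2)}$ for $n\ge 2$ and to $(n-1)e^{-(\alpha+1)(n-2)}$ for $1\le n\le 2$ (same constant of proportionality), and its stationary mean is $$\mathbb E[\hat N_{JSQ}]=1+\Big[\frac{1}{\alpha(1+\alpha)^2}+\frac{e^{1+\alpha}}{(1+\alpha)^2}\Big]^{-1}\Big[\frac{\alpha^2+4\alpha+1}{\alpha^2(1+\alpha)^3}+\frac{2e^{\alpha+1}}{(1+\alpha)^3}\Big].$$ The Central Queue ($M/M/k$) diffusion is the Brownian motion with drift $d\hat N_{CQ}(t)=-\alpha\mu\,dt+\sqrt{2\mu}\,dB(t)+dL(t)$ on $[1,\infty)$ reflected at $1$ ($L$ is the increasing reflection term at $1$); its stationary density is $\alpha e^{-\alpha(n-1)}$, $n\ge 1$, so $\mathbb E[\hat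 N_{CQ}]=1+\frac1\alpha$. *)

theory Defs
  imports "HOL-Probability.Probability"
begin

definition brownian_motion ::
    "'w measure \<Rightarrow> (real \<Rightarrow> 'w measure) \<Rightarrow> (real \<Rightarrow> 'w \<Rightarrow> real) \<Rightarrow> bool" where
  "brownian_motion P F B \<longleftrightarrow>
     prob_space P \<and>
     filtration (space P) F \<and>
     (\<forall>t\<ge>0. subalgebra P (F t)) \<and>
     (\<forall>t\<ge>0. B t \<in> borel_measurable (F t)) \<and>
     (AE \<omega> in P. B 0 \<omega> = 0) \<and>
     (AE \<omega> in P. continuous_on {0..} (\<lambda>t. B t \<omega>)) \<and>
     (\<forall>s t. 0 \<le> s \<and> s < t \<longrightarrow>
        distributed P lborel (\<lambda>\<omega>. B t \<omega> - B s \<omega>) (normal_density 0 (sqrt (t - s))) \<and>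
        prob_space.indep_set P (sets (F s))
          (sets (vimage_algebra (space P) (\<lambda>\<omega>. B t \<omega> - B s \<omega>) borel)))"

text \<open>All noise coefficients below are constant, so the stochastic integral is just
  a multiple of \<open>B t\<close>, and each stochastic differential equation is a pathwise integral equation.
  Solutions are weak solutions: the probability space, the filtration and the Brownian motion
  are part of the solution.\<close>

definition JSQ_drift :: "real \<Rightarrow> real \<Rightarrow> real \<Rightarrow> real" where
  "JSQ_drift \<mu> \<alpha> n = \<mu> * (max (2 - n) 0 / (n - 1) - \<alpha>)"

definition JSQ_diffusion ::
    "real \<Rightarrow> real \<Rightarrow> 'w measure \<Rightarrow> (real \<Rightarrow> 'w measure) \<Rightarrow> (real \<Rightarrow> 'w \<Rightarrow> real) \<Rightarrow>
     (real \<Rightarrow> 'w \<Rightarrow> real) \<Rightarrow> bool" where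
  "JSQ_diffusion \<mu> \<alpha> P F B N \<longleftrightarrow>
     brownian_motion P F B \<and>
     (\<forall>t\<ge>0. N t \<in> borel_measurable (F t)) \<and>
     (AE \<omega> in P. continuous_on {0..} (\<lambda>t. N t \<omega>) \<and>
        (\<forall>t\<ge>0. 1 < N t \<omega> \<and>
           set_integrable lborel {0..t} (\<lambda>s. JSQ_drift \<mu> \<alpha> (N s \<omega>)) \<and>
           N t \<omega> = N 0 \<omega> + (LBINT s:{0..t}. JSQ_drift \<mu> \<alpha> (N s \<omega>)) + sqrt (2 * \<mu>) * B t \<omega>))"

text \<open>The last conjunct below says that the continuous nondecreasing term \<open>L\<close> increases only
  while \<open>N\<close> is at \<open>1\<close>, i.e. that the Stieltjes measure \<open>dL\<close> does not charge the open set of times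
  at which \<open>N > 1\<close>. The term \<open>L\<close> is adapted because the integral equation expresses it through
  \<open>N\<close> and \<open>B\<close>.\<close>

definition CQ_diffusion ::
    "real \<Rightarrow> real \<Rightarrow> 'w measure \<Rightarrow> (real \<Rightarrow> 'w measure) \<Rightarrow> (real \<Rightarrow> 'w \<Rightarrow> real) \<Rightarrow>
     (real \<Rightarrow> 'w \<Rightarrow> real) \<Rightarrow> (real \<Rightarrow> 'w \<Rightarrow> real) \<Rightarrow> bool" where
  "CQ_diffusion \<mu> \<alpha> P F B L N \<longleftrightarrow>
     brownian_motion P F B \<and>
     (\<forall>t\<ge>0. N t \<in> borel_measurable (F t)) \<and>
     (AE \<omega> in P. continuous_on {0..} (\<lambda>t. N t \<omega>) \<and>
        (\<forall>t\<ge>0. 1 \<le> N t \<omega> \<and>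
           N t \<omega> = N 0 \<omega> - \<alpha> * \<mu> * t + sqrt (2 * \<mu>) * B t \<omega> + L t \<omega>) \<and>
        L 0 \<omega> = 0 \<and>
        continuous_on {0..} (\<lambda>t. L t \<omega>) \<and>
        mono_on {0..} (\<lambda>t. L t \<omega>) \<and>
        (\<forall>s t. 0 \<le> s \<and> s \<le> t \<and> (\<forall>u\<in>{s..t}. 1 < N u \<omega>) \<longrightarrow> L t \<omega> = L s \<omega>))"

text \<open>A stationary distribution is an invariant law: the diffusion can be run so that its law at
  every time is \<open>\<pi>\<close>. The argument of type \<open>'w itself\<close> names the type carrying the sample
  space.\<close>

definition JSQ_stationary_distribution ::
    "'w itself \<Rightarrow> real \<Rightarrow> real \<Rightarrow> real measure \<Rightarrow> bool" where
  "JSQ_stationary_distribution W \<mu> \<alpha> \<pi> \<longleftrightarrow>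
     (\<exists>(P :: 'w measure) F B N.
        JSQ_diffusion \<mu> \<alpha> P F B N \<and> (\<forall>t\<ge>0. distr P borel (N t) = \<pi>))"

definition CQ_stationary_distribution ::
    "'w itself \<Rightarrow> real \<Rightarrow> real \<Rightarrow> real measure \<Rightarrow> bool" where
  "CQ_stationary_distribution W \<mu> \<alpha> \<pi> \<longleftrightarrow>
     (\<exists>(P :: 'w measure) F B L N.
        CQ_diffusion \<mu> \<alpha> P F B L N \<and> (\<forall>t\<ge>0. distr P borel (N t) = \<pi>))"

end

(* Both diffusions have the form N(t) = N(0) - alpha mu t + sqrt(2 mu) B(t) + L(t), where L is
   continuous, nondecreasing, and constant while N > 2. No stochastic calculus is needed: on the
   grid i/n, compare f(N) at the end of a step with f evaluated after the Gaussian part of the step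
   only. By stationarity and a Taylor expansion the expected sum of these differences converges to
   -mu * (integral of f'' against the stationary law), while pathwise the sum converges to the
   integral of f'(N) against dL - alpha mu dt. Testing first with a bounded concave increasing f,
   Fatou's lemma gives E L(1) < infinity, which supplies the dominating variable for all other f.

   For the Central Queue, f = exp(-theta (x - 1)) gives the Laplace transform of the stationary law.
   For JSQ, f is chosen so that the generator maps it to an affine function on (1,2] and to a
   multiple of exp(-theta (x - 2)) beyond 2; varying theta determines the mean. The bound on the
   ratio then reduces to a polynomial inequality after replacing exp by a Taylor polynomial. *)
theory Submission
  imports Defs "HOL-Real_Asymp.Real_Asymp"
begin

text \<open>The obstacle is the lack of a priori bounds: an invariant law is only known as the law
  of a weak solution, and neither its mean nor that of the singular drift 1/(x - 1) is assumed
  finite. Polynomials, which would yield moments at once, are therefore not admissible as test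
  functions; the first two derivatives have to be bounded, and moments come out of Laplace
  transforms as \<theta> tends to 0. Splitting off the Gaussian part of a step separates two kinds
  of estimates. The Gaussian increment is independent of the past and needs a second-order expansion
  in mean; the rest of the step has bounded variation and needs a first-order expansion along each
  path. The level 2 is where the JSQ push ends. For JSQ put u = x - 1, k = 1 + \<alpha>, F(z) = (exp
  z - 1)/z. Up to the factor \<mu> the generator on (1,2] is f'' + (1/u - k) f', and f' = u and f' =
  1 - F(k u), both zero at the singular point u = 0, have affine images. A C^2 match at 2 with a
  decaying exponential fixes their combination.\<close>

section \<open>Test functions and their Taylor estimates\<close>

lemma MVT_real:
  fixes f f' :: "real \<Rightarrow> real"
  assumes "\<And>x. (f has_real_derivative f' x) (at x)"
  obtains z where "\<bar>z - x\<bar> \<le> \<bar>y - x\<bar>" "f y - f x = f' z * (y - x)"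
proof (cases x y rule: linorder_cases)
  case less
  obtain z where "z > x" "z < y" "f y - f x = (y - x) * f' z"
    using MVT2[of x y f f'] less assms by blast
  then show ?thesis by (intro that[of z]) (auto simp: algebra_simps)
next
  case equal
  then show ?thesis by (intro that[of x]) auto
next
  case greater
  obtain z where "z > y" "z < x" "f x - f y = (x - y) * f' z"
    using MVT2[of y x f f'] greater assms by blast
  then show ?thesis by (intro that[of z]) (auto simp: algebra_simps)
qed

text \<open>A Lipschitz bound on \<open>f2\<close> takes the place of a third derivative because the
  functions used later are glued at 1 and 2, where a third derivative may jump. Derivatives are
  required on the whole line and only the bounds on \<open>S\<close>, so that pieces come with
  two-sided derivatives at the point where they are joined. No bound on \<open>f\<close> itself is
  included.\<close>

definition test_function_on ::
    "real \<Rightarrow> real set \<Rightarrow> (real \<Rightarrow> real) \<Rightarrow> (real \<Rightarrow> real) \<Rightarrow> (real \<Rightarrow> real) \<Rightarrow> bool" where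
  "test_function_on K S f f1 f2 \<longleftrightarrow>
     (\<forall>x. (f has_real_derivative f1 x) (at x)) \<and> (\<forall>x. (f1 has_real_derivative f2 x) (at x)) \<and>
     (\<forall>x\<in>S. \<bar>f1 x\<bar> \<le> K) \<and> (\<forall>x\<in>S. \<bar>f2 x\<bar> \<le> K) \<and> (\<forall>x\<in>S. \<forall>y\<in>S. \<bar>f2 x - f2 y\<bar> \<le> K * \<bar>x - y\<bar>)"

abbreviation "test_function K \<equiv> test_function_on K UNIV"

lemma test_functionD:
  assumes "test_function K f f1 f2"
  shows "(f has_real_derivative f1 x) (at x)" "(f1 has_real_derivative f2 x) (at x)"
    "\<bar>f1 x\<bar> \<le> K" "\<bar>f2 x\<bar> \<le> K" "\<bar>f2 x - f2 y\<bar> \<le> K * \<bar>x - y\<bar>" "0 \<le> K"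
proof -
  have "\<bar>f1 0\<bar> \<le> K" using assms by (simp add: test_function_on_def)
  then show "0 \<le> K" by linarith
qed (use assms in \<open>auto simp: test_function_on_def\<close>)

lemma test_function_continuous:
  assumes "test_function K f f1 f2"
  shows "continuous_on A f" "continuous_on A f1" "continuous_on A f2"
proof -
  have "isCont f2 x" for x
    unfolding isCont_def
  proof (rule LIM_zero_cancel, rule Lim_null_comparison)
    show "\<forall>\<^sub>F y in at x. norm (f2 y - f2 x) \<le> K * \<bar>y - x\<bar>"
      using test_functionD(5)[OF assms] by auto
    show "((\<lambda>y. K * \<bar>y - x\<bar>) \<longlongrightarrow> 0) (at x)"
      by (auto intro!: tendsto_eq_intros)
  qed
  then show "continuous_on A f2" by (simp add: continuous_at_imp_continuous_on)
  show "continuous_on A f" "continuous_on A f1"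
    by (meson test_functionD(1,2)[OF assms] DERIV_isCont continuous_at_imp_continuous_on)+
qed

lemma test_function_measurable:
  assumes "test_function K f f1 f2"
  shows "f \<in> borel_measurable borel" "f1 \<in> borel_measurable borel" "f2 \<in> borel_measurable borel"
  by (intro borel_measurable_continuous_onI test_function_continuous[OF assms])+

lemma test_function_lipschitz:
  assumes "test_function K f f1 f2"
  shows "\<bar>f y - f x\<bar> \<le> K * \<bar>y - x\<bar>" "\<bar>f1 y - f1 x\<bar> \<le> K * \<bar>y - x\<bar>"
proof -
  note T = test_functionD[OF assms]
  obtain z where "f y - f x = f1 z * (y - x)" by (rule MVT_real[where x = x and y = y, OF T(1)])
  then show "\<bar>f y - f x\<bar> \<le> K * \<bar>y - x\<bar>" using T(3)[of z] by (simp add: abs_mult mult_right_mono)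
  obtain z where "f1 y - f1 x = f2 z * (y - x)" by (rule MVT_real[where x = x and y = y, OF T(2)])
  then show "\<bar>f1 y - f1 x\<bar> \<le> K * \<bar>y - x\<bar>" using T(4)[of z] by (simp add: abs_mult mult_right_mono)
qed

text \<open>The expansion is around the right end \<open>y\<close>: in the grid sums
  \<open>y\<close> is the position at the end of a step and \<open>x\<close> the one that the
  Gaussian part alone would have reached. Lipschitz continuity of \<open>f1\<close> makes the error
  at the mean value point quadratic.\<close>

lemma test_function_taylor1:
  assumes "test_function K f f1 f2"
  shows "\<bar>f y - f x - f1 y * (y - x)\<bar> \<le> K * \<bar>y - x\<bar>\<^sup>2"
proof -
  note T = test_functionD[OF assms]
  obtain z where z: "\<bar>z - x\<bar> \<le> \<bar>y - x\<bar>" "\<bar>z - y\<bar> \<le> \<bar>y - x\<bar>" "f y - f x = f1 z * (y - x)"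
  proof (cases "x \<le> y")
    case True
    show ?thesis
    proof (cases "x = y")
      case False
      then obtain z where "z > x" "z < y" "f y - f x = (y - x) * f1 z"
        using MVT2[of x y f f1] T True by (metis order_le_less)
      then show ?thesis by (intro that[of z]) auto
    qed (use that[of x] in auto)
  next
    case False
    then obtain z where "z > y" "z < x" "f x - f y = (x - y) * f1 z"
      using MVT2[of y x f f1] T by (metis not_le)
    then show ?thesis by (intro that[of z]) (auto simp: algebra_simps)
  qed
  have "\<bar>f y - f x - f1 y * (y - x)\<bar> = \<bar>f1 z - f1 y\<bar> * \<bar>y - x\<bar>"
    by (simp add: z abs_mult[symmetric] algebra_simps)
  also have "\<dots> \<le> (K * \<bar>y - x\<bar>) * \<bar>y - x\<bar>"
    using test_function_lipschitz(2)[OF assms, of z y] mult_left_mono[OF z(2) T(6)]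
    by (intro mult_right_mono) auto
  finally show ?thesis by (simp add: power2_eq_square algebra_simps)
qed

text \<open>The remainder vanishes at \<open>h = 0\<close> and its derivative in \<open>h\<close> is
  at most K h^2 since \<open>f2\<close> is Lipschitz, so a second mean value argument gives the
  cubic bound. Only the order matters: n steps of length 1/n then contribute O(1 / sqrt n) in
  mean.\<close>

lemma test_function_taylor2:
  assumes "test_function K f f1 f2"
  shows "\<bar>f (x + h) - f x - f1 x * h - f2 x * h\<^sup>2 / 2\<bar> \<le> K * \<bar>h\<bar> ^ 3"
proof -
  note T = test_functionD[OF assms]
  define \<phi> where "\<phi> s = f (x + s) - f x - f1 x * s - f2 x * s\<^sup>2 / 2" for s
  have d: "(\<phi> has_real_derivative f1 (x + s) - f1 x - f2 x * s) (at s)" for s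
  proof -
    have "((\<lambda>s. f (x + s)) has_real_derivative f1 (x + s)) (at s)"
      using T(1)[of "s + x"] DERIV_shift[of f "f1 (s + x)" s x] by (simp add: add.commute)
    then show ?thesis
      unfolding \<phi>_def by (auto intro!: derivative_eq_intros)
  qed
  have b: "\<bar>f1 (x + s) - f1 x - f2 x * s\<bar> \<le> K * \<bar>s\<bar>\<^sup>2" for s
  proof -
    obtain z where z: "\<bar>z - x\<bar> \<le> \<bar>x + s - x\<bar>" "f1 (x + s) - f1 x = f2 z * (x + s - x)"
      by (rule MVT_real[where x = x and y = "x + s", OF T(2)])
    have "f1 (x + s) - f1 x - f2 x * s = (f2 z - f2 x) * s"
      using z(2) by (simp add: algebra_simps)
    then have "\<bar>f1 (x + s) - f1 x - f2 x * s\<bar> = \<bar>f2 z - f2 x\<bar> * \<bar>s\<bar>"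
      by (simp add: abs_mult)
    also have "\<dots> \<le> (K * \<bar>s\<bar>) * \<bar>s\<bar>"
      using T(5)[of z x] mult_left_mono[OF z(1) T(6)] by (intro mult_right_mono) auto
    finally show ?thesis by (simp add: power2_eq_square)
  qed
  obtain z where z: "\<bar>z - 0\<bar> \<le> \<bar>h - 0\<bar>" "\<phi> h - \<phi> 0 = (f1 (x + z) - f1 x - f2 x * z) * (h - 0)"
    by (rule MVT_real[where x = 0 and y = h, OF d])
  have zh: "K * \<bar>z\<bar>\<^sup>2 \<le> K * \<bar>h\<bar>\<^sup>2"
    using z(1) T(6) by (intro mult_left_mono power_mono) auto
  have "\<bar>\<phi> h\<bar> = \<bar>f1 (x + z) - f1 x - f2 x * z\<bar> * \<bar>h\<bar>"
    using z(2) by (simp add: \<phi>_def abs_mult)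
  also have "\<dots> \<le> (K * \<bar>h\<bar>\<^sup>2) * \<bar>h\<bar>"
    using order_trans[OF b zh] by (intro mult_right_mono) auto
  finally show ?thesis by (simp add: \<phi>_def power3_eq_cube power2_eq_square)
qed

section \<open>Moments and independence of Brownian increments\<close>

lemma brownian_motionD:
  assumes "brownian_motion P F B"
  shows "prob_space P" "0 \<le> t \<Longrightarrow> subalgebra P (F t)" "0 \<le> t \<Longrightarrow> B t \<in> borel_measurable (F t)"
    "0 \<le> s \<Longrightarrow> s < t \<Longrightarrow> distributed P lborel (\<lambda>\<omega>. B t \<omega> - B s \<omega>) (normal_density 0 (sqrt (t - s)))"
    "0 \<le> s \<Longrightarrow> s < t \<Longrightarrow> prob_space.indep_set P (sets (F s))
          (sets (vimage_algebra (space P) (\<lambda>\<omega>. B t \<omega> - B s \<omega>) borel))"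
    "AE \<omega> in P. continuous_on {0..} (\<lambda>t. B t \<omega>)" "AE \<omega> in P. B 0 \<omega> = 0"
  using assms unfolding brownian_motion_def by blast+

lemma brownian_increment_moments:
  assumes "brownian_motion P F B" "0 \<le> s" "s < t"
  shows "integrable P (\<lambda>\<omega>. B t \<omega> - B s \<omega>)" "(\<integral>\<omega>. B t \<omega> - B s \<omega> \<partial>P) = 0"
    "integrable P (\<lambda>\<omega>. (B t \<omega> - B s \<omega>)\<^sup>2)" "(\<integral>\<omega>. (B t \<omega> - B s \<omega>)\<^sup>2 \<partial>P) = t - s"
    "integrable P (\<lambda>\<omega>. \<bar>B t \<omega> - B s \<omega>\<bar> ^ 3)" "(\<integral>\<omega>. \<bar>B t \<omega> - B s \<omega>\<bar> ^ 3 \<partial>P) \<le> 2 * (t - s) * sqrt (t - s)"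
proof -
  define \<sigma> where "\<sigma> = sqrt (t - s)"
  have \<sigma>: "\<sigma> > 0" "\<sigma>\<^sup>2 = t - s" using assms by (auto simp: \<sigma>_def)
  have D: "distributed P lborel (\<lambda>\<omega>. B t \<omega> - B s \<omega>) (normal_density 0 \<sigma>)"
    unfolding \<sigma>_def by (rule brownian_motionD(4)[OF assms])
  have nn: "\<And>x. x \<in> space lborel \<Longrightarrow> 0 \<le> normal_density 0 \<sigma> x" by simp
  note I = distributed_integrable[OF D _ nn] and E = distributed_integral[OF D _ nn]
  have 1: "has_bochner_integral lborel (\<lambda>x. normal_density 0 \<sigma> x * x) 0"
    using normal_moment_nz_1[OF \<sigma>(1), of 0] by simp
  show "integrable P (\<lambda>\<omega>. B t \<omega> - B s \<omega>)" "(\<integral>\<omega>. B t \<omega> - B s \<omega> \<partial>P) = 0"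
    using 1 I[of "\<lambda>x. x"] E[of "\<lambda>x. x"] by (auto simp: has_bochner_integral_iff)
  have 2: "has_bochner_integral lborel (\<lambda>x. normal_density 0 \<sigma> x * x\<^sup>2) (\<sigma>\<^sup>2)"
    using normal_moment_even[OF \<sigma>(1), of 0 1] by (simp add: fact_2)
  show "integrable P (\<lambda>\<omega>. (B t \<omega> - B s \<omega>)\<^sup>2)" "(\<integral>\<omega>. (B t \<omega> - B s \<omega>)\<^sup>2 \<partial>P) = t - s"
    using 2 I[of "\<lambda>x. x\<^sup>2"] E[of "\<lambda>x. x\<^sup>2"] \<sigma>(2) by (auto simp: has_bochner_integral_iff)
  have 3: "has_bochner_integral lborel (\<lambda>x. normal_density 0 \<sigma> x * \<bar>x\<bar> ^ 3) (2 * \<sigma> ^ 3 * sqrt (2 / pi))"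
    using normal_moment_abs_odd[OF \<sigma>(1), of 0 1] by simp
  have s: "sqrt (2 / pi) \<le> 1" using pi_ge_two by (simp add: field_simps)
  have "2 * \<sigma> ^ 3 * sqrt (2 / pi) \<le> 2 * \<sigma> ^ 3 * 1" using \<sigma>(1) s by (intro mult_left_mono) auto
  also have "\<dots> = 2 * (t - s) * sqrt (t - s)" using \<sigma>(2) by (simp add: \<sigma>_def power3_eq_cube power2_eq_square)
  finally have "2 * \<sigma> ^ 3 * sqrt (2 / pi) \<le> 2 * (t - s) * sqrt (t - s)" .
  then show "integrable P (\<lambda>\<omega>. \<bar>B t \<omega> - B s \<omega>\<bar> ^ 3)"
     "(\<integral>\<omega>. \<bar>B t \<omega> - B s \<omega>\<bar> ^ 3 \<partial>P) \<le> 2 * (t - s) * sqrt (t - s)"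
    using 3 I[of "\<lambda>x. \<bar>x\<bar>^3"] E[of "\<lambda>x. \<bar>x\<bar>^3"] by (auto simp: has_bochner_integral_iff)
qed

lemma brownian_measurable:
  assumes "brownian_motion P F B" "0 \<le> t"
  shows "(X :: _ \<Rightarrow> real) \<in> borel_measurable (F t) \<Longrightarrow> X \<in> borel_measurable P" "B t \<in> borel_measurable P"
proof -
  have sub: "subalgebra P (F t)" and B: "B t \<in> borel_measurable (F t)"
    using brownian_motionD[OF assms(1)] assms(2) by auto
  show "X \<in> borel_measurable (F t) \<Longrightarrow> X \<in> borel_measurable P" "B t \<in> borel_measurable P"
    using measurable_from_subalg[OF sub] B by blast+
qed

text \<open>\<open>brownian_motion\<close> provides independence of sigma algebras. The one
  generated by \<open>X\<close> lies inside that of \<open>F s\<close>, and independence passes to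
  smaller families.\<close>

lemma brownian_increment_indep:
  fixes X :: "'w \<Rightarrow> real"
  assumes bm: "brownian_motion P F B" and st: "0 \<le> s" "s < t" and X: "X \<in> borel_measurable (F s)"
  shows "prob_space.indep_var P borel X borel (\<lambda>\<omega>. B t \<omega> - B s \<omega>)"
proof -
  interpret prob_space P by (rule brownian_motionD(1)[OF bm])
  have [measurable]: "X \<in> borel_measurable P" "B t \<in> borel_measurable P" "B s \<in> borel_measurable P"
    using st by (auto intro: brownian_measurable(1)[OF bm st(1) X] brownian_measurable(2)[OF bm])
  have sp: "space (F s) = space P"
    using brownian_motionD(2)[OF bm st(1)] by (simp add: subalgebra_def)
  have ind: "indep_set (sets (F s)) (sets (vimage_algebra (space P) (\<lambda>\<omega>. B t \<omega> - B s \<omega>) borel))"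
    by (rule brownian_motionD(5)[OF bm st])
  have 1: "sigma_sets (space P) {X -` A \<inter> space P |A. A \<in> sets borel} \<subseteq> sets (F s)"
    unfolding sp[symmetric] using measurable_sets[OF X] by (intro sets.sigma_sets_subset) auto
  have 2: "sigma_sets (space P) {(\<lambda>\<omega>. B t \<omega> - B s \<omega>) -` A \<inter> space P |A. A \<in> sets borel}
      = sets (vimage_algebra (space P) (\<lambda>\<omega>. B t \<omega> - B s \<omega>) borel)"
    by (simp add: sets_vimage_algebra)
  show ?thesis
    unfolding indep_var_eq 2
    using ind indep_sets_mono_sets[of "case_bool (sets (F s))
       (sets (vimage_algebra (space P) (\<lambda>\<omega>. B t \<omega> - B s \<omega>) borel))" UNIV] 1
    by (simp add: indep_set_def split: bool.split)
qed

lemma brownian_increment_integral_mult: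
  fixes X :: "'w \<Rightarrow> real" and g h :: "real \<Rightarrow> real"
  assumes bm: "brownian_motion P F B" and st: "0 \<le> s" "s < t" and X: "X \<in> borel_measurable (F s)"
    and g: "g \<in> borel_measurable borel" and h: "h \<in> borel_measurable borel"
    and iX: "integrable P (\<lambda>\<omega>. h (X \<omega>))" and iB: "integrable P (\<lambda>\<omega>. g (B t \<omega> - B s \<omega>))"
  shows "integrable P (\<lambda>\<omega>. h (X \<omega>) * g (B t \<omega> - B s \<omega>))"
    "(\<integral>\<omega>. h (X \<omega>) * g (B t \<omega> - B s \<omega>) \<partial>P) = (\<integral>\<omega>. h (X \<omega>) \<partial>P) * (\<integral>\<omega>. g (B t \<omega> - B s \<omega>) \<partial>P)"
proof -
  interpret prob_space P by (rule brownian_motionD(1)[OF bm])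
  have "indep_var borel (h \<circ> X) borel (g \<circ> (\<lambda>\<omega>. B t \<omega> - B s \<omega>))"
    by (rule indep_var_compose[OF brownian_increment_indep[OF bm st X] h g])
  then show "integrable P (\<lambda>\<omega>. h (X \<omega>) * g (B t \<omega> - B s \<omega>))"
    "(\<integral>\<omega>. h (X \<omega>) * g (B t \<omega> - B s \<omega>) \<partial>P) = (\<integral>\<omega>. h (X \<omega>) \<partial>P) * (\<integral>\<omega>. g (B t \<omega> - B s \<omega>) \<partial>P)"
    using indep_var_integrable[of "h \<circ> X" "g \<circ> (\<lambda>\<omega>. B t \<omega> - B s \<omega>)"]
      indep_var_lebesgue_integral[of "h \<circ> X" "g \<circ> (\<lambda>\<omega>. B t \<omega> - B s \<omega>)"] iX iB
    by (auto simp: comp_def)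
qed

text \<open>Uniform continuity on the compact interval. The reference point is the right end of a
  cell because the grid sums evaluate their integrand there.\<close>

lemma grid_oscillation:
  fixes \<phi> :: "real \<Rightarrow> real"
  assumes "continuous_on {0..1} \<phi>" "0 < \<epsilon>"
  shows "\<forall>\<^sub>F n in sequentially. \<forall>i<n. \<forall>t\<in>{real i / real n..real (Suc i) / real n}.
           \<bar>\<phi> t - \<phi> (real (Suc i) / real n)\<bar> < \<epsilon>"
proof -
  have "uniformly_continuous_on {0..1} \<phi>"
    using assms(1) by (simp add: compact_uniformly_continuous)
  then obtain d where d: "d > 0" "\<And>s t. s \<in> {0..1} \<Longrightarrow> t \<in> {0..1} \<Longrightarrow> dist t s < d \<Longrightarrow> dist (\<phi> t) (\<phi> s) < \<epsilon>"
    using assms(2) unfolding uniformly_continuous_on_def by metis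
  obtain m where m: "1 / real (Suc m) < d" using d(1) nat_approx_posE by blast
  show ?thesis
    unfolding eventually_sequentially
  proof (intro exI[of _ "Suc m"] allI impI ballI)
    fix n i t
    assume n: "Suc m \<le> n" and i: "i < n" and t: "t \<in> {real i / real n..real (Suc i) / real n}"
    have n0: "0 < real n" using n by simp
    have le: "real (Suc i) / real n \<le> 1" using i n0 by (simp add: field_simps)
    have ge: "0 \<le> real i / real n" by simp
    have mesh: "real (Suc i) / real n - real i / real n = 1 / real n" by (simp add: add_divide_distrib)
    have "1 / real n \<le> 1 / real (Suc m)" using n by (intro divide_left_mono) auto
    then have "dist t (real (Suc i) / real n) < d"
      using t mesh m by (auto simp: dist_real_def)
    moreover have "t \<in> {0..1}" "real (Suc i) / real n \<in> {0..1}" using t le order_trans[OF ge, of t] by auto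
    ultimately show "\<bar>\<phi> t - \<phi> (real (Suc i) / real n)\<bar> < \<epsilon>"
      using d(2) by (simp add: dist_real_def)
  qed
qed

text \<open>This concave increasing function serves to prove that the regulator has finite mean. Its
  slope solves q' = q^2 - q, so further derivatives are polynomials in \<open>q\<close> with 0 < q <
  1 and are bounded on the whole line. A plain - exp (- x) has unbounded slope to the left of 1,
  where a Gaussian step may land.\<close>

lemma logistic_test_function:
  defines "q \<equiv> \<lambda>x::real. 1 / (1 + exp x)"
  shows "test_function 1 (\<lambda>x. - ln (1 + exp (- x))) q (\<lambda>x. (q x)\<^sup>2 - q x)"
proof -
  have pos: "0 < 1 + exp x" for x :: real by (simp add: add_pos_pos)
  have nz: "1 + exp x \<noteq> 0" for x :: real using pos[of x] by simp
  have q: "0 < q x" "q x < 1" for x using pos[of x] by (auto simp: q_def)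
  have 0: "((\<lambda>x. - ln (1 + exp (- x))) has_real_derivative q x) (at x)" for x
    using nz[of x] pos[of "-x"] unfolding q_def
    by (auto intro!: derivative_eq_intros simp: field_simps exp_minus)
  have 1: "(q has_real_derivative (q x)\<^sup>2 - q x) (at x)" for x
    using nz[of x] unfolding q_def
    by (auto intro!: derivative_eq_intros simp: power2_eq_square divide_simps)
  have 2: "((\<lambda>x. (q x)\<^sup>2 - q x) has_real_derivative (2 * q x - 1) * ((q x)\<^sup>2 - q x)) (at x)" for x
    by (auto intro!: derivative_eq_intros 1 simp: algebra_simps)
  have b2: "\<bar>(q x)\<^sup>2 - q x\<bar> \<le> 1" for x
  proof -
    have "(q x)\<^sup>2 \<le> 1" using q[of x] by (simp add: power_le_one)
    then show ?thesis using q[of x] by (simp add: abs_le_iff) (smt (verit) zero_le_power2)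
  qed
  have b3: "\<bar>(2 * q x - 1) * ((q x)\<^sup>2 - q x)\<bar> \<le> 1" for x
  proof -
    have "\<bar>2 * q x - 1\<bar> * \<bar>(q x)\<^sup>2 - q x\<bar> \<le> 1 * 1"
      using b2[of x] q[of x] by (intro mult_mono) auto
    then show ?thesis by (simp add: abs_mult)
  qed
  have b4: "\<bar>((q x)\<^sup>2 - q x) - ((q y)\<^sup>2 - q y)\<bar> \<le> 1 * \<bar>x - y\<bar>" for x y
  proof -
    obtain z where z: "((q x)\<^sup>2 - q x) - ((q y)\<^sup>2 - q y) = (2 * q z - 1) * ((q z)\<^sup>2 - q z) * (x - y)"
      by (rule MVT_real[where x = y and y = x, OF 2])
    show ?thesis unfolding z abs_mult[of _ "x - y"] using b3[of z] by (intro mult_right_mono) auto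
  qed
  have b1: "\<bar>q x\<bar> \<le> 1" for x using q[of x] by simp
  show ?thesis unfolding test_function_on_def using 0 1 b1 b2 b4 by blast
qed

section \<open>Stationary regulated diffusions\<close>

text \<open>The common ground of both models. The regulator is expressed through \<open>N\<close>
  and \<open>B\<close>, so no further process is carried along and measurability is inherited.
  Flatness is asked only above 2, which covers both a push spread over (1,2) and a reflection acting
  at 1.\<close>

locale regulated_diffusion =
  fixes P :: "'w measure" and F :: "real \<Rightarrow> 'w measure" and B N :: "real \<Rightarrow> 'w \<Rightarrow> real"
    and \<mu> \<alpha> :: real and \<pi> :: "real measure"
  assumes bm: "brownian_motion P F B"
    and mu_pos: "0 < \<mu>" and alpha_pos: "0 < \<alpha>"
    and adapted: "0 \<le> t \<Longrightarrow> N t \<in> borel_measurable (F t)"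
    and law: "0 \<le> t \<Longrightarrow> distr P borel (N t) = \<pi>"
    and continuous_paths: "AE \<omega> in P. continuous_on {0..} (\<lambda>t. N t \<omega>)"
    and ge_1: "AE \<omega> in P. \<forall>t\<ge>0. 1 \<le> N t \<omega>"
    and regulator_mono: "AE \<omega> in P. mono_on {0..}
          (\<lambda>t. N t \<omega> - N 0 \<omega> + \<alpha> * \<mu> * t - sqrt (2 * \<mu>) * B t \<omega>)"
    and regulator_flat: "AE \<omega> in P. \<forall>s t. 0 \<le> s \<and> s \<le> t \<and> (\<forall>u\<in>{s..t}. 2 < N u \<omega>) \<longrightarrow>
          N t \<omega> - N s \<omega> = sqrt (2 * \<mu>) * (B t \<omega> - B s \<omega>) - \<alpha> * \<mu> * (t - s)"
begin

sublocale prob_space P by (rule brownian_motionD(1)[OF bm])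

text \<open>Subtracting \<open>B 0\<close> makes the value at time 0 vanish for every \<omega>,
  although \<open>B 0\<close> is zero only almost surely; telescoping sums then end in
  \<open>regulator 1\<close> exactly.\<close>

definition regulator :: "real \<Rightarrow> 'w \<Rightarrow> real" where
  "regulator t \<omega> = N t \<omega> - N 0 \<omega> + \<alpha> * \<mu> * t - sqrt (2 * \<mu>) * (B t \<omega> - B 0 \<omega>)"

lemma N_measurable: "0 \<le> t \<Longrightarrow> N t \<in> borel_measurable P"
  by (rule brownian_measurable(1)[OF bm _ adapted])

lemma B_measurable: "0 \<le> t \<Longrightarrow> B t \<in> borel_measurable P"
  by (rule brownian_measurable(2)[OF bm])

lemma regulator_measurable: "0 \<le> t \<Longrightarrow> regulator t \<in> borel_measurable P"
  unfolding regulator_def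
  by (intro borel_measurable_add borel_measurable_diff borel_measurable_times borel_measurable_const
      N_measurable B_measurable) auto

lemma sets_pi [measurable_cong]: "sets \<pi> = sets borel" and space_pi [simp]: "space \<pi> = UNIV"
  by (simp_all flip: law[of 0])

lemma prob_space_pi: "prob_space \<pi>"
  using prob_space_distr[OF N_measurable[of 0]] by (simp add: law)

lemma integrable_pi_iff:
  fixes h :: "real \<Rightarrow> real"
  shows "0 \<le> t \<Longrightarrow> h \<in> borel_measurable borel \<Longrightarrow> integrable \<pi> h \<longleftrightarrow> integrable P (\<lambda>\<omega>. h (N t \<omega>))"
  using integrable_distr_eq[OF N_measurable, of t h] law[of t] by simp

lemma integral_pi:
  fixes h :: "real \<Rightarrow> real"
  shows "0 \<le> t \<Longrightarrow> h \<in> borel_measurable borel \<Longrightarrow> (\<integral>\<omega>. h (N t \<omega>) \<partial>P) = integral\<^sup>L \<pi> h"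
  using integral_distr[OF N_measurable, of t h] law[of t] by simp

lemma integrable_pi_bounded:
  fixes h :: "real \<Rightarrow> real"
  assumes "h \<in> borel_measurable borel" "\<And>x. \<bar>h x\<bar> \<le> K"
  shows "integrable \<pi> h"
proof -
  interpret pi: prob_space \<pi> by (rule prob_space_pi)
  show ?thesis using assms by (intro pi.integrable_const_bound[where B=K]) auto
qed

text \<open>By stationarity \<open>f (N t)\<close> and \<open>f (N s)\<close> have the same mean, so
  only the Gaussian increment counts. In its second-order expansion the linear term has mean zero by
  independence, the quadratic term has mean (2 \<mu> / 2) (t - s) times the mean of
  \<open>f2\<close>, and the remainder is of order (t - s)^(3/2).\<close>

lemma integral_step:
  assumes T: "test_function K f f1 f2" and If: "integrable \<pi> f" and s: "0 \<le> s" "s < t"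
  defines "G \<equiv> \<lambda>\<omega>. f (N t \<omega>) - f (N s \<omega> + sqrt (2 * \<mu>) * (B t \<omega> - B s \<omega>))"
  shows "integrable P G"
    "\<bar>integral\<^sup>L P G + \<mu> * (t - s) * integral\<^sup>L \<pi> f2\<bar> \<le> 2 * K * sqrt (2 * \<mu>) ^ 3 * ((t - s) * sqrt (t - s))"
proof -
  define c where "c = sqrt (2 * \<mu>)"
  have c: "c > 0" "c\<^sup>2 = 2 * \<mu>" using mu_pos by (auto simp: c_def)
  define X where "X \<omega> = B t \<omega> - B s \<omega>" for \<omega>
  note [measurable] = test_function_measurable[OF T]
  have [measurable]: "N t \<in> borel_measurable P" "N s \<in> borel_measurable P" "B t \<in> borel_measurable P"
      "B s \<in> borel_measurable P"
    using s by (auto intro: N_measurable B_measurable)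
  have [measurable]: "X \<in> borel_measurable P" unfolding X_def by measurable
  note M = brownian_increment_moments[OF bm s, folded X_def]
  note D = test_functionD[OF T]
  have t0: "0 \<le> t" using s by simp
  have I1: "integrable P (\<lambda>\<omega>. f1 (N s \<omega>))" "integrable P (\<lambda>\<omega>. f2 (N s \<omega>))"
    using integrable_pi_iff[OF s(1), THEN iffD1] integrable_pi_bounded[where h = f1, OF _ D(3)]
      integrable_pi_bounded[where h = f2, OF _ D(4)]
    by auto
  have If': "integrable P (\<lambda>\<omega>. f (N s \<omega>))" "integrable P (\<lambda>\<omega>. f (N t \<omega>))"
    using If integrable_pi_iff[OF s(1), of f] integrable_pi_iff[OF t0, of f] by auto
  have E1: "integrable P (\<lambda>\<omega>. f1 (N s \<omega>) * X \<omega>)" "(\<integral>\<omega>. f1 (N s \<omega>) * X \<omega> \<partial>P) = 0"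
    using brownian_increment_integral_mult[OF bm s adapted[OF s(1)], of "\<lambda>x. x" f1] I1(1) M
    unfolding X_def by auto
  have E2: "integrable P (\<lambda>\<omega>. f2 (N s \<omega>) * (X \<omega>)\<^sup>2)"
     "(\<integral>\<omega>. f2 (N s \<omega>) * (X \<omega>)\<^sup>2 \<partial>P) = integral\<^sup>L \<pi> f2 * (t - s)"
    using brownian_increment_integral_mult[OF bm s adapted[OF s(1)], of "\<lambda>x. x\<^sup>2" f2] I1(2) M
      integral_pi[OF s(1), of f2]
    unfolding X_def by auto
  define r where "r \<omega> = f (N s \<omega> + c * X \<omega>) - f (N s \<omega>) - f1 (N s \<omega>) * (c * X \<omega>) - f2 (N s \<omega>) * (c * X \<omega>)\<^sup>2 / 2" for \<omega>
  have [measurable]: "r \<in> borel_measurable P" unfolding r_def by measurable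
  have rb: "\<bar>r \<omega>\<bar> \<le> K * c ^ 3 * \<bar>X \<omega>\<bar> ^ 3" for \<omega>
    using test_function_taylor2[OF T, of "N s \<omega>" "c * X \<omega>"] c
    by (simp add: r_def abs_mult power_mult_distrib)
  have Ib: "integrable P (\<lambda>\<omega>. K * c ^ 3 * \<bar>X \<omega>\<bar> ^ 3)" using M(5) by simp
  have Ir: "integrable P r"
    by (rule Bochner_Integration.integrable_bound[OF Ib]) (use rb in \<open>auto simp: order_trans[OF rb]\<close>)
  have G: "G \<omega> = f (N t \<omega>) - f (N s \<omega>) - c * (f1 (N s \<omega>) * X \<omega>) - \<mu> * (f2 (N s \<omega>) * (X \<omega>)\<^sup>2) - r \<omega>" for \<omega>
    unfolding G_def r_def c_def[symmetric] X_def[symmetric] by (simp add: power_mult_distrib c(2))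
  show "integrable P G"
    unfolding G using If' E1 E2 Ir by (intro Bochner_Integration.integrable_diff integrable_mult_right) auto
  have "integral\<^sup>L P G = (\<integral>\<omega>. f (N t \<omega>) \<partial>P) - (\<integral>\<omega>. f (N s \<omega>) \<partial>P) - c * (\<integral>\<omega>. f1 (N s \<omega>) * X \<omega> \<partial>P)
     - \<mu> * (\<integral>\<omega>. f2 (N s \<omega>) * (X \<omega>)\<^sup>2 \<partial>P) - integral\<^sup>L P r"
    unfolding G using If' E1(1) E2(1) Ir by simp
  then have "integral\<^sup>L P G + \<mu> * (t - s) * integral\<^sup>L \<pi> f2 = - integral\<^sup>L P r"
    by (simp add: E1 E2 integral_pi[OF s(1)] integral_pi[OF t0])
  moreover have "\<bar>integral\<^sup>L P r\<bar> \<le> (\<integral>\<omega>. K * c ^ 3 * \<bar>X \<omega>\<bar> ^ 3 \<partial>P)"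
    using order_trans[OF integral_abs_bound integral_mono[OF integrable_abs[OF Ir] Ib rb]] .
  moreover have "(\<integral>\<omega>. K * c ^ 3 * \<bar>X \<omega>\<bar> ^ 3 \<partial>P) \<le> K * c ^ 3 * (2 * (t - s) * sqrt (t - s))"
    using M(5,6) D(6) c(1) by (simp add: mult_left_mono)
  ultimately show "\<bar>integral\<^sup>L P G + \<mu> * (t - s) * integral\<^sup>L \<pi> f2\<bar> \<le> 2 * K * sqrt (2 * \<mu>) ^ 3 * ((t - s) * sqrt (t - s))"
    unfolding c_def[symmetric] by (simp add: algebra_simps)
qed

section \<open>Grid sums: expectations and pathwise limits\<close>

definition riemann_stieltjes :: "(real \<Rightarrow> real) \<Rightarrow> nat \<Rightarrow> 'w \<Rightarrow> real" where
  "riemann_stieltjes g n \<omega> = (\<Sum>i<n. g (N (real (Suc i) / real n) \<omega>) *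
     (regulator (real (Suc i) / real n) \<omega> - regulator (real i / real n) \<omega>))"

text \<open>The last summand offsets, to first order, the constant drift - \<alpha> \<mu> / n of a
  step. What remains follows the increments of the regulator, as \<open>riemann_stieltjes\<close>
  does.\<close>

definition compensated_sum :: "(real \<Rightarrow> real) \<Rightarrow> (real \<Rightarrow> real) \<Rightarrow> nat \<Rightarrow> 'w \<Rightarrow> real" where
  "compensated_sum f f1 n \<omega> = (\<Sum>i<n. f (N (real (Suc i) / real n) \<omega>) - f (N (real i / real n) \<omega>
        + sqrt (2 * \<mu>) * (B (real (Suc i) / real n) \<omega> - B (real i / real n) \<omega>))
      + \<alpha> * \<mu> / real n * f1 (N (real (Suc i) / real n) \<omega>))"

text \<open>Each of the n steps contributes - \<mu> / n times the mean of \<open>f2\<close>, up to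
  an error of order n^(-3/2); the errors add up to order n^(-1/2). The limit is minus the stationary
  mean of the generator of the unregulated Brownian motion with drift.\<close>

lemma integral_compensated_sum:
  assumes T: "test_function K f f1 f2" and If: "integrable \<pi> f"
  shows "0 < n \<Longrightarrow> integrable P (compensated_sum f f1 n)"
    "(\<lambda>n. integral\<^sup>L P (compensated_sum f f1 n)) \<longlonglongrightarrow> \<alpha> * \<mu> * integral\<^sup>L \<pi> f1 - \<mu> * integral\<^sup>L \<pi> f2"
proof -
  define s where "s n i = real i / real n" for n i :: nat
  define G where "G n i \<omega> = f (N (s n (Suc i)) \<omega>) - f (N (s n i) \<omega> + sqrt (2 * \<mu>) * (B (s n (Suc i)) \<omega> - B (s n i) \<omega>))" for n i \<omega>
  note D = test_functionD[OF T]
  have s: "0 \<le> s n i" "0 < n \<Longrightarrow> s n i < s n (Suc i)" "s n (Suc i) - s n i = 1 / real n" for n i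
    by (auto simp: s_def add_divide_distrib divide_strict_right_mono)
  have IG: "integrable P (G n i)" if "0 < n" for n i
    unfolding G_def by (rule integral_step(1)[OF T If s(1) s(2)[OF that]])
  have BG: "\<bar>integral\<^sup>L P (G n i) + \<mu> * (1 / real n) * integral\<^sup>L \<pi> f2\<bar> \<le> 2 * K * sqrt (2 * \<mu>) ^ 3 * (1 / real n * sqrt (1 / real n))"
    if "0 < n" for n i
    using integral_step(2)[OF T If s(1) s(2)[OF that]] unfolding G_def s(3) by simp
  have I1: "integrable P (\<lambda>\<omega>. f1 (N (s n i) \<omega>))" for n i
    by (rule iffD1[OF integrable_pi_iff[OF s(1) test_function_measurable(2)[OF T]]
          integrable_pi_bounded[OF test_function_measurable(2)[OF T] D(3)]])
  have E1: "(\<integral>\<omega>. f1 (N (s n i) \<omega>) \<partial>P) = integral\<^sup>L \<pi> f1" for n i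
    by (rule integral_pi[OF s(1) test_function_measurable(2)[OF T]])
  have cs: "compensated_sum f f1 n = (\<lambda>\<omega>. \<Sum>i<n. G n i \<omega> + \<alpha> * \<mu> / real n * f1 (N (s n (Suc i)) \<omega>))" for n
    unfolding compensated_sum_def G_def s_def by (rule refl)
  show "integrable P (compensated_sum f f1 n)" if "0 < n" for n
    unfolding cs using IG[OF that] I1 by (intro Bochner_Integration.integrable_sum Bochner_Integration.integrable_add integrable_mult_right) auto
  have E: "integral\<^sup>L P (compensated_sum f f1 n) = (\<Sum>i<n. integral\<^sup>L P (G n i)) + \<alpha> * \<mu> * integral\<^sup>L \<pi> f1" if "0 < n" for n
  proof -
    have "integral\<^sup>L P (compensated_sum f f1 n) = (\<Sum>i<n. integral\<^sup>L P (G n i) + \<alpha> * \<mu> / real n * integral\<^sup>L \<pi> f1)"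
      unfolding cs using IG[OF that] I1 by (subst Bochner_Integration.integral_sum) (auto simp: E1)
    also have "\<dots> = (\<Sum>i<n. integral\<^sup>L P (G n i)) + \<alpha> * \<mu> * integral\<^sup>L \<pi> f1"
      using that by (simp add: sum.distrib)
    finally show ?thesis .
  qed
  define l where "l = \<alpha> * \<mu> * integral\<^sup>L \<pi> f1 - \<mu> * integral\<^sup>L \<pi> f2"
  have "\<bar>integral\<^sup>L P (compensated_sum f f1 n) - l\<bar> \<le> 2 * K * sqrt (2 * \<mu>) ^ 3 * sqrt (1 / real n)" if n: "0 < n" for n
  proof -
    have "integral\<^sup>L P (compensated_sum f f1 n) - l = (\<Sum>i<n. integral\<^sup>L P (G n i) + \<mu> * (1 / real n) * integral\<^sup>L \<pi> f2)"
      using n by (simp add: E[OF n] l_def sum.distrib)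
    also have "\<bar>\<dots>\<bar> \<le> (\<Sum>i<n. 2 * K * sqrt (2 * \<mu>) ^ 3 * (1 / real n * sqrt (1 / real n)))"
      by (rule order_trans[OF sum_abs]) (intro sum_mono BG n)
    also have "\<dots> = 2 * K * sqrt (2 * \<mu>) ^ 3 * sqrt (1 / real n)"
      using n by simp
    finally show ?thesis .
  qed
  then have ev: "\<forall>\<^sub>F n in sequentially. norm (integral\<^sup>L P (compensated_sum f f1 n) - l) \<le> 2 * K * sqrt (2 * \<mu>) ^ 3 * sqrt (1 / real n)"
    unfolding eventually_sequentially by (intro exI[of _ 1]) auto
  have "(\<lambda>n. 2 * K * sqrt (2 * \<mu>) ^ 3 * sqrt (1 / real n)) \<longlonglongrightarrow> 2 * K * sqrt (2 * \<mu>) ^ 3 * sqrt 0"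
    by (intro tendsto_intros lim_1_over_n)
  then have "(\<lambda>n. integral\<^sup>L P (compensated_sum f f1 n) - l) \<longlonglongrightarrow> 0"
    by (intro Lim_null_comparison[OF ev]) simp
  then show "(\<lambda>n. integral\<^sup>L P (compensated_sum f f1 n)) \<longlonglongrightarrow> \<alpha> * \<mu> * integral\<^sup>L \<pi> f1 - \<mu> * integral\<^sup>L \<pi> f2"
    by (simp add: LIM_zero_iff l_def)
qed

text \<open>In one step \<open>N\<close> moves by the Gaussian part, the drift - \<alpha> \<mu> / n
  and the regulator increment. The point reached by the Gaussian part alone is thus the end point
  minus the other two, and the sums differ by first-order Taylor errors.\<close>

lemma compensated_sum_eq:
  assumes "0 < n"
  shows "compensated_sum f f1 n \<omega> = riemann_stieltjes f1 n \<omega> + (\<Sum>i<n.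
     (let y = N (real (Suc i) / real n) \<omega>;
          x = y - (regulator (real (Suc i) / real n) \<omega> - regulator (real i / real n) \<omega> - \<alpha> * \<mu> / real n)
      in f y - f x - f1 y * (y - x)))"
  unfolding compensated_sum_def riemann_stieltjes_def sum.distrib[symmetric]
proof (intro sum.cong refl)
  fix i
  define y x where "y = N (real (Suc i) / real n) \<omega>"
    and "x = N (real i / real n) \<omega> + sqrt (2 * \<mu>) * (B (real (Suc i) / real n) \<omega> - B (real i / real n) \<omega>)"
  define d where "d = regulator (real (Suc i) / real n) \<omega> - regulator (real i / real n) \<omega>"
  have "\<alpha> * \<mu> * (real (Suc i) / real n) = \<alpha> * \<mu> * (real i / real n) + \<alpha> * \<mu> / real n"
    using assms by (simp add: field_simps)
  then have x: "x = y - (d - \<alpha> * \<mu> / real n)"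
    by (simp add: x_def y_def d_def regulator_def algebra_simps)
  have "f y - f x + \<alpha> * \<mu> / real n * f1 y = f1 y * d + (f y - f x - f1 y * (y - x))"
  proof -
    have yx: "y - x = d - \<alpha> * \<mu> / real n" using x by simp
    show ?thesis unfolding yx by (simp add: right_diff_distrib mult.commute)
  qed
  then show "f (N (real (Suc i) / real n) \<omega>) - f (N (real i / real n) \<omega>
        + sqrt (2 * \<mu>) * (B (real (Suc i) / real n) \<omega> - B (real i / real n) \<omega>))
      + \<alpha> * \<mu> / real n * f1 (N (real (Suc i) / real n) \<omega>) =
    f1 (N (real (Suc i) / real n) \<omega>) * (regulator (real (Suc i) / real n) \<omega> - regulator (real i / real n) \<omega>) +
    (let y = N (real (Suc i) / real n) \<omega>;
          x = y - (regulator (real (Suc i) / real n) \<omega> - regulator (real i / real n) \<omega> - \<alpha> * \<mu> / real n)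
      in f y - f x - f1 y * (y - x))"
    unfolding Let_def x_def[symmetric] y_def[symmetric] d_def[symmetric] x[symmetric] .
qed

text \<open>Gathers the almost sure properties of a path, so that the limit lemmas for grid sums
  become deterministic statements about one path.\<close>

definition regular_path :: "'w \<Rightarrow> bool" where
  "regular_path \<omega> \<longleftrightarrow> continuous_on {0..} (\<lambda>t. N t \<omega>) \<and> continuous_on {0..} (\<lambda>t. regulator t \<omega>) \<and>
     (\<forall>t\<ge>0. 1 \<le> N t \<omega>) \<and> mono_on {0..} (\<lambda>t. regulator t \<omega>) \<and>
     (\<forall>s t. 0 \<le> s \<and> s \<le> t \<and> (\<forall>u\<in>{s..t}. 2 < N u \<omega>) \<longrightarrow> regulator t \<omega> = regulator s \<omega>)"

lemma AE_regular_path: "AE \<omega> in P. regular_path \<omega>"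
  using continuous_paths ge_1 regulator_mono regulator_flat brownian_motionD(6)[OF bm]
proof eventually_elim
  case (elim \<omega>)
  have "continuous_on {0..} (\<lambda>t. regulator t \<omega>)"
    unfolding regulator_def using elim(1,5) by (intro continuous_intros)
  moreover have "mono_on {0..} (\<lambda>t. regulator t \<omega>)"
    using elim(3) unfolding regulator_def mono_on_def by (auto simp: algebra_simps)
  ultimately show ?case
    unfolding regular_path_def using elim(1,2,4) by (auto simp: regulator_def algebra_simps)
qed

lemma regular_path_increments:
  assumes "regular_path \<omega>" "0 < n"
  shows "0 \<le> regulator (real (Suc i) / real n) \<omega> - regulator (real i / real n) \<omega>"
    "(\<Sum>i<n. regulator (real (Suc i) / real n) \<omega> - regulator (real i / real n) \<omega>) = regulator 1 \<omega>"
    "0 \<le> regulator 1 \<omega>"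
proof -
  have le: "0 \<le> s \<Longrightarrow> s \<le> t \<Longrightarrow> regulator s \<omega> \<le> regulator t \<omega>" for s t
    using assms(1) by (auto simp: regular_path_def mono_on_def)
  show "0 \<le> regulator (real (Suc i) / real n) \<omega> - regulator (real i / real n) \<omega>"
    using le[of "real i / real n" "real (Suc i) / real n"] by (simp add: divide_right_mono)
  have 0: "regulator 0 \<omega> = 0" by (simp add: regulator_def)
  show "(\<Sum>i<n. regulator (real (Suc i) / real n) \<omega> - regulator (real i / real n) \<omega>) = regulator 1 \<omega>"
    using assms(2) 0 by (subst sum_lessThan_telescope) simp
  show "0 \<le> regulator 1 \<omega>" using le[of 0 1] 0 by simp
qed

text \<open>The Taylor errors are quadratic in \<open>d i - a\<close>, the bounded-variation part of
  a step. One factor is bounded by \<epsilon> + a; the other is summed, and the increments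
  \<open>d i\<close> telescope to \<open>regulator 1\<close>.\<close>

lemma compensated_sum_error:
  assumes T: "test_function K f f1 f2" and \<omega>: "regular_path \<omega>" and n: "0 < n"
    and \<epsilon>: "\<And>i. i < n \<Longrightarrow> \<bar>regulator (real (Suc i) / real n) \<omega> - regulator (real i / real n) \<omega>\<bar> \<le> \<epsilon>"
  shows "\<bar>compensated_sum f f1 n \<omega> - riemann_stieltjes f1 n \<omega>\<bar>
     \<le> K * ((\<epsilon> + \<alpha> * \<mu> / real n) * (regulator 1 \<omega> + \<alpha> * \<mu>))"
proof -
  define d where "d i = regulator (real (Suc i) / real n) \<omega> - regulator (real i / real n) \<omega>" for i
  define y where "y i = N (real (Suc i) / real n) \<omega>" for i
  define a where "a = \<alpha> * \<mu> / real n"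
  have a: "0 \<le> a" "real n * a = \<alpha> * \<mu>" using alpha_pos mu_pos n by (auto simp: a_def)
  have d: "0 \<le> d i" for i using regular_path_increments(1)[OF \<omega> n] by (simp add: d_def)
  have K: "0 \<le> K" using test_functionD(6)[OF T] .
  have "\<bar>compensated_sum f f1 n \<omega> - riemann_stieltjes f1 n \<omega>\<bar>
    = \<bar>\<Sum>i<n. f (y i) - f (y i - (d i - a)) - f1 (y i) * (y i - (y i - (d i - a)))\<bar>"
    unfolding compensated_sum_eq[OF n] Let_def d_def y_def a_def by simp
  also have "\<dots> \<le> (\<Sum>i<n. K * \<bar>y i - (y i - (d i - a))\<bar>\<^sup>2)"
    by (rule order_trans[OF sum_abs]) (intro sum_mono test_function_taylor1[OF T])
  also have "\<dots> \<le> (\<Sum>i<n. K * ((\<epsilon> + a) * (d i + a)))"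
  proof (intro sum_mono mult_left_mono K)
    fix i assume i: "i \<in> {..<n}"
    have "\<bar>d i - a\<bar> * \<bar>d i - a\<bar> \<le> (\<epsilon> + a) * (d i + a)"
      using \<epsilon>[of i, folded d_def] d[of i] a i by (intro mult_mono) auto
    then show "\<bar>y i - (y i - (d i - a))\<bar>\<^sup>2 \<le> (\<epsilon> + a) * (d i + a)" by (simp add: power2_eq_square)
  qed
  also have "\<dots> = K * ((\<epsilon> + a) * (regulator 1 \<omega> + \<alpha> * \<mu>))"
    using regular_path_increments(2)[OF \<omega> n] a(2)
    by (simp add: sum_distrib_left[symmetric] sum.distrib d_def)
  finally show ?thesis unfolding a_def .
qed

text \<open>First-order bounds suffice here and give an estimate that is uniform in \<open>n\<close>
  and linear in \<open>regulator 1\<close>. It is the dominating variable when expectation and limit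
  are exchanged.\<close>

lemma compensated_sum_bound:
  assumes T: "test_function K f f1 f2" and \<omega>: "regular_path \<omega>" and n: "0 < n"
  shows "\<bar>compensated_sum f f1 n \<omega>\<bar> \<le> K * (regulator 1 \<omega> + 2 * (\<alpha> * \<mu>))"
proof -
  define d where "d i = regulator (real (Suc i) / real n) \<omega> - regulator (real i / real n) \<omega>" for i
  define y where "y i = N (real (Suc i) / real n) \<omega>" for i
  define a where "a = \<alpha> * \<mu> / real n"
  have a: "0 \<le> a" "real n * a = \<alpha> * \<mu>" using alpha_pos mu_pos n by (auto simp: a_def)
  have d: "0 \<le> d i" for i using regular_path_increments(1)[OF \<omega> n] by (simp add: d_def)
  have K: "0 \<le> K" using test_functionD(6)[OF T] .
  have "compensated_sum f f1 n \<omega> = (\<Sum>i<n. f (y i) - f (y i - (d i - a)) + a * f1 (y i))"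
    unfolding compensated_sum_eq[OF n] riemann_stieltjes_def sum.distrib[symmetric] Let_def d_def[symmetric]
      y_def[symmetric] a_def[symmetric] by (intro sum.cong) (auto simp: algebra_simps)
  also have "\<bar>\<dots>\<bar> \<le> (\<Sum>i<n. K * (d i + 2 * a))"
  proof (rule order_trans[OF sum_abs], rule sum_mono)
    fix i
    have "\<bar>f (y i) - f (y i - (d i - a))\<bar> \<le> K * \<bar>d i - a\<bar>"
      using test_function_lipschitz(1)[OF T, of "y i" "y i - (d i - a)"] by simp
    moreover have "K * \<bar>d i - a\<bar> \<le> K * (d i + a)" using d[of i] a K by (intro mult_left_mono) auto
    moreover have "\<bar>a * f1 (y i)\<bar> \<le> a * K" using test_functionD(3)[OF T] a by (simp add: abs_mult mult_left_mono)
    ultimately show "\<bar>f (y i) - f (y i - (d i - a)) + a * f1 (y i)\<bar> \<le> K * (d i + 2 * a)"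
      by (simp add: algebra_simps)
  qed
  also have "\<dots> = K * (regulator 1 \<omega> + 2 * (\<alpha> * \<mu>))"
    using regular_path_increments(2)[OF \<omega> n] a(2)
    by (simp add: sum_distrib_left[symmetric] sum.distrib d_def)
  finally show ?thesis .
qed

lemma compensated_sum_tendsto:
  assumes T: "test_function K f f1 f2" and \<omega>: "regular_path \<omega>"
    and R: "(\<lambda>n. riemann_stieltjes f1 n \<omega>) \<longlonglongrightarrow> R"
  shows "(\<lambda>n. compensated_sum f f1 n \<omega>) \<longlonglongrightarrow> R"
proof -
  have K: "0 \<le> K" using test_functionD(6)[OF T] .
  \<comment> \<open>The summand 1 keeps \<open>C\<close> positive even for K = 0 and makes the last
    estimate strict.\<close>
  define C where "C = K * (regulator 1 \<omega> + \<alpha> * \<mu>) + 1"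
  have L: "0 \<le> regulator 1 \<omega>" using regular_path_increments(3)[OF \<omega>, of 1] by simp
  have C: "C > 0" using K L alpha_pos mu_pos by (simp add: C_def add_nonneg_pos)
  have "(\<lambda>n. compensated_sum f f1 n \<omega> - riemann_stieltjes f1 n \<omega>) \<longlonglongrightarrow> 0"
  proof (rule tendstoI)
    fix e :: real assume e: "0 < e"
    define \<epsilon> where "\<epsilon> = e / (2 * C)"
    have \<epsilon>: "\<epsilon> > 0" using e C by (simp add: \<epsilon>_def)
    have "continuous_on {0..1} (\<lambda>t. regulator t \<omega>)"
      using \<omega> by (auto simp: regular_path_def intro: continuous_on_subset)
    note ev1 = grid_oscillation[OF this \<epsilon>]
    have "(\<lambda>n. \<alpha> * \<mu> * (1 / real n)) \<longlonglongrightarrow> \<alpha> * \<mu> * 0" by (intro tendsto_intros lim_1_over_n)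
    then have ev2: "\<forall>\<^sub>F n in sequentially. \<alpha> * \<mu> / real n < \<epsilon>"
      using \<epsilon> by (intro order_tendstoD) auto
    show "\<forall>\<^sub>F n in sequentially. dist (compensated_sum f f1 n \<omega> - riemann_stieltjes f1 n \<omega>) 0 < e"
      using ev1 ev2 eventually_gt_at_top[of 0]
    proof eventually_elim
      case (elim n)
      have inc: "\<bar>regulator (real (Suc i) / real n) \<omega> - regulator (real i / real n) \<omega>\<bar> \<le> \<epsilon>" if "i < n" for i
      proof -
        have "real i / real n \<in> {real i / real n..real (Suc i) / real n}" by (simp add: divide_right_mono)
        then show ?thesis using elim(1) that by fastforce
      qed
      have "\<bar>compensated_sum f f1 n \<omega> - riemann_stieltjes f1 n \<omega>\<bar>
         \<le> K * ((\<epsilon> + \<alpha> * \<mu> / real n) * (regulator 1 \<omega> + \<alpha> * \<mu>))"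
        using compensated_sum_error[OF T \<omega> elim(3) inc] .
      also have "\<dots> = (\<epsilon> + \<alpha> * \<mu> / real n) * (C - 1)" by (simp add: C_def)
      also have "\<dots> \<le> (\<epsilon> + \<epsilon>) * (C - 1)"
        using elim(2) K L alpha_pos mu_pos by (intro mult_right_mono) (auto simp: C_def)
      also have "\<dots> < (\<epsilon> + \<epsilon>) * C" using \<epsilon> by simp
      also have "\<dots> = e" using C by (simp add: \<epsilon>_def)
      finally show ?case by simp
    qed
  qed
  from tendsto_add[OF this R] show ?thesis by simp
qed

text \<open>If the regulator moves within a cell, the path is at or below \<open>b\<close> somewhere
  in that cell, and small oscillation carries this to its end point. Level 2 serves for the
  integrability of the regulator, level 1 for the reflected process.\<close>

lemma regulator_increment_near_boundary:
  assumes \<omega>: "regular_path \<omega>" and "0 < \<epsilon>"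
    and flat: "\<forall>s t. 0 \<le> s \<and> s \<le> t \<and> (\<forall>u\<in>{s..t}. b < N u \<omega>) \<longrightarrow> regulator t \<omega> = regulator s \<omega>"
  shows "\<forall>\<^sub>F n in sequentially. \<forall>i<n. N (real (Suc i) / real n) \<omega> \<le> b + \<epsilon> \<or>
    regulator (real (Suc i) / real n) \<omega> = regulator (real i / real n) \<omega>"
proof -
  have "continuous_on {0..1} (\<lambda>t. N t \<omega>)"
    using \<omega> by (auto simp: regular_path_def intro: continuous_on_subset)
  from grid_oscillation[OF this \<open>0 < \<epsilon>\<close>] show ?thesis
  proof eventually_elim
    case (elim n)
    show ?case
    proof (intro allI impI)
      fix i assume i: "i < n"
      have le: "0 \<le> real i / real n" "real i / real n \<le> real (Suc i) / real n" by (auto simp: divide_right_mono)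
      show "N (real (Suc i) / real n) \<omega> \<le> b + \<epsilon> \<or> regulator (real (Suc i) / real n) \<omega> = regulator (real i / real n) \<omega>"
      proof (cases "\<forall>u\<in>{real i / real n..real (Suc i) / real n}. b < N u \<omega>")
        case True
        then show ?thesis using flat le by blast
      next
        case False
        then obtain u where u: "u \<in> {real i / real n..real (Suc i) / real n}" "N u \<omega> \<le> b" by (auto simp: not_less)
        have "\<bar>N u \<omega> - N (real (Suc i) / real n) \<omega>\<bar> < \<epsilon>" using elim i u(1) by blast
        then show ?thesis using u(2) by linarith
      qed
    qed
  qed
qed

section \<open>Finite mean of the regulator and the stationary identity\<close>

text \<open>Concavity makes every Taylor error nonnegative, so the compensated sum, whose
  expectation converges, dominates the Riemann-Stieltjes sum. The latter is eventually at least
  \<open>q 3\<close> times \<open>regulator 1\<close>, because the regulator moves only when the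
  path is not far above 2. Fatou's lemma concludes without any integrability known
  beforehand.\<close>

lemma integrable_regulator: "integrable P (regulator 1)"
proof -
  define q where "q = (\<lambda>x::real. 1 / (1 + exp x))"
  define f where "f = (\<lambda>x::real. - ln (1 + exp (- x)))"
  have T: "test_function 1 f q (\<lambda>x. (q x)\<^sup>2 - q x)"
    unfolding q_def f_def by (rule logistic_test_function)
  note [measurable] = test_function_measurable[OF T]
  have q0: "0 < q x" for x by (simp add: q_def add_pos_pos)
  have q_anti: "x \<le> y \<Longrightarrow> q y \<le> q x" for x y
    by (simp add: q_def divide_left_mono add_pos_pos)
  have concave: "q y * (y - x) \<le> f y - f x" for x y
  proof (cases x y rule: linorder_cases)
    case less
    obtain z where "x < z" "z < y" "f y - f x = (y - x) * q z"
      using MVT2[OF less, of f q] test_functionD(1)[OF T] by blast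
    then show ?thesis using q_anti[of z y] less by (simp add: mult.commute mult_left_mono)
  next
    case greater
    obtain z where z: "y < z" "z < x" "f x - f y = (x - y) * q z"
      using MVT2[OF greater, of f q] test_functionD(1)[OF T] by blast
    have "(x - y) * q z \<le> (x - y) * q y" using q_anti[of y z] z greater by (intro mult_left_mono) auto
    then show ?thesis using z by (simp add: algebra_simps)
  qed simp
  have If: "integrable \<pi> f"
  proof -
    interpret pi: prob_space \<pi> by (rule prob_space_pi)
    have "AE x in distr P borel (N 0). 1 \<le> x"
      using ge_1 N_measurable[of 0] by (subst AE_distr_iff) (auto elim: eventually_mono)
    then have "AE x in \<pi>. norm (f x) \<le> 2"
      unfolding law[OF order_refl]
    proof eventually_elim
      case (elim x)
      have "0 \<le> ln (1 + exp (- x))" by (simp add: add_increasing2)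
      moreover have "ln (1 + exp (- x)) \<le> ln (1 + 1)" using elim by (subst ln_le_cancel_iff) (auto simp: add_pos_pos)
      moreover have "ln (2::real) \<le> 2" using ln_le_minus_one[of "2::real"] by simp
      ultimately show ?case by (simp add: f_def)
    qed
    then show ?thesis by (intro pi.integrable_const_bound[where B=2]) auto
  qed
  define l where "l = \<alpha> * \<mu> * integral\<^sup>L \<pi> q - \<mu> * (\<integral>x. (q x)\<^sup>2 - q x \<partial>\<pi>)"
  \<comment> \<open>The shift by one avoids the empty grid, for which the mesh 1/n makes no
    sense.\<close>
  define U where "U n = compensated_sum f q (Suc n)" for n
  have IU: "integrable P (U n)" for n
    unfolding U_def by (rule integral_compensated_sum(1)[OF T If]) simp
  have lim: "(\<lambda>n. integral\<^sup>L P (U n)) \<longlonglongrightarrow> l"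
    unfolding U_def l_def
    by (rule filterlim_compose[OF integral_compensated_sum(2)[OF T If] filterlim_Suc])
  have rs: "riemann_stieltjes q (Suc n) \<omega> \<le> U n \<omega>" if "regular_path \<omega>" for n \<omega>
    unfolding U_def compensated_sum_eq[OF zero_less_Suc] Let_def le_add_same_cancel1
    by (intro sum_nonneg) (use concave in \<open>simp only: diff_ge_0_iff_ge\<close>)
  have rs0: "0 \<le> riemann_stieltjes q (Suc n) \<omega>" if "regular_path \<omega>" for n \<omega>
    unfolding riemann_stieltjes_def
    by (intro sum_nonneg mult_nonneg_nonneg regular_path_increments(1)[OF that] less_imp_le[OF q0]) simp
  have U0: "AE \<omega> in P. 0 \<le> U n \<omega>" for n
    using AE_regular_path by eventually_elim (rule order_trans[OF rs0 rs])
  have low: "AE \<omega> in P. ennreal (q 3 * regulator 1 \<omega>) \<le> liminf (\<lambda>n. ennreal (U n \<omega>))"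
    using AE_regular_path
  proof eventually_elim
    case (elim \<omega>)
    \<comment> \<open>Level 2 and tolerance 1: a cell with a regulator increment ends at or below 3,
      where the decreasing slope is at least \<open>q 3\<close>.\<close>
    have flat: "\<forall>s t. 0 \<le> s \<and> s \<le> t \<and> (\<forall>u\<in>{s..t}. 2 < N u \<omega>) \<longrightarrow> regulator t \<omega> = regulator s \<omega>"
      using elim by (simp add: regular_path_def)
    have "\<forall>\<^sub>F n in sequentially. q 3 * regulator 1 \<omega> \<le> riemann_stieltjes q n \<omega>"
      using regulator_increment_near_boundary[OF elim zero_less_one flat] eventually_gt_at_top[of 0]
    proof eventually_elim
      case (elim n)
      have "q 3 * regulator 1 \<omega> = (\<Sum>i<n. q 3 * (regulator (real (Suc i) / real n) \<omega> - regulator (real i / real n) \<omega>))"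
        using regular_path_increments(2)[OF \<open>regular_path \<omega>\<close> elim(2)] by (simp add: sum_distrib_left[symmetric])
      also have "\<dots> \<le> riemann_stieltjes q n \<omega>"
        unfolding riemann_stieltjes_def
      proof (rule sum_mono)
        fix i assume "i \<in> {..<n}"
        then consider "N (real (Suc i) / real n) \<omega> \<le> 3"
          | "regulator (real (Suc i) / real n) \<omega> = regulator (real i / real n) \<omega>" using elim(1) by auto
        then show "q 3 * (regulator (real (Suc i) / real n) \<omega> - regulator (real i / real n) \<omega>) \<le>
          q (N (real (Suc i) / real n) \<omega>) * (regulator (real (Suc i) / real n) \<omega> - regulator (real i / real n) \<omega>)"
        proof cases
          case 1
          show ?thesis
            by (rule mult_right_mono[OF q_anti[OF 1] regular_path_increments(1)[OF \<open>regular_path \<omega>\<close> elim(2)]])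
        qed simp
      qed
      finally show ?case .
    qed
    then have "\<forall>\<^sub>F n in sequentially. q 3 * regulator 1 \<omega> \<le> riemann_stieltjes q (Suc n) \<omega>"
      by (rule eventually_compose_filterlim[OF _ filterlim_Suc])
    then have "\<forall>\<^sub>F n in sequentially. ennreal (q 3 * regulator 1 \<omega>) \<le> ennreal (U n \<omega>)"
      by eventually_elim (intro ennreal_leI, rule order_trans[OF _ rs[OF elim]])
    then show ?case by (rule Liminf_bounded)
  qed
  have UM [measurable]: "U n \<in> borel_measurable P" for n using IU by blast
  have "(\<integral>\<^sup>+\<omega>. ennreal (q 3 * regulator 1 \<omega>) \<partial>P) \<le> (\<integral>\<^sup>+\<omega>. liminf (\<lambda>n. ennreal (U n \<omega>)) \<partial>P)"
    by (rule nn_integral_mono_AE[OF low])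
  also have "\<dots> \<le> liminf (\<lambda>n. \<integral>\<^sup>+\<omega>. ennreal (U n \<omega>) \<partial>P)"
    by (rule nn_integral_liminf) measurable
  also have "(\<lambda>n. \<integral>\<^sup>+\<omega>. ennreal (U n \<omega>) \<partial>P) = (\<lambda>n. ennreal (integral\<^sup>L P (U n)))"
    by (rule ext, rule nn_integral_eq_integral[OF IU U0])
  also have "liminf \<dots> = ennreal l"
    using lim by (intro lim_imp_Liminf tendsto_ennrealI) auto
  finally have fin: "(\<integral>\<^sup>+\<omega>. ennreal (q 3 * regulator 1 \<omega>) \<partial>P) < \<infinity>"
    using ennreal_less_top[of l] by (simp add: order_le_less_trans)
  have "integrable P (\<lambda>\<omega>. q 3 * regulator 1 \<omega>)"
  proof (rule integrableI_nonneg)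
    show "AE \<omega> in P. 0 \<le> q 3 * regulator 1 \<omega>"
      using AE_regular_path by eventually_elim (use regular_path_increments(3)[of _ 1] q0[of 3] in simp)
  qed (use fin regulator_measurable[of 1] in auto)
  then show ?thesis using q0[of 3] by simp
qed

text \<open>The weak form of the stationary forward equation; \<open>R\<close> plays the role of the Stieltjes
  integral of \<open>f1 (N t)\<close> against the regulator over \<open>[0, 1]\<close>.\<close>

lemma stationary_identity:
  assumes T: "test_function K f f1 f2" and If: "integrable \<pi> f"
    and R: "AE \<omega> in P. regular_path \<omega> \<longrightarrow> (\<lambda>n. riemann_stieltjes f1 n \<omega>) \<longlonglongrightarrow> R \<omega>"
    and [measurable]: "R \<in> borel_measurable P"
  shows "integrable P R" "integral\<^sup>L P R = \<alpha> * \<mu> * integral\<^sup>L \<pi> f1 - \<mu> * integral\<^sup>L \<pi> f2"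
proof -
  define U where "U n = compensated_sum f f1 (Suc n)" for n
  have IU: "integrable P (U n)" for n
    unfolding U_def by (rule integral_compensated_sum(1)[OF T If]) simp
  have lim: "(\<lambda>n. integral\<^sup>L P (U n)) \<longlonglongrightarrow> \<alpha> * \<mu> * integral\<^sup>L \<pi> f1 - \<mu> * integral\<^sup>L \<pi> f2"
    unfolding U_def by (rule filterlim_compose[OF integral_compensated_sum(2)[OF T If] filterlim_Suc])
  have UM: "U n \<in> borel_measurable P" for n using IU by blast
  have ptw: "AE \<omega> in P. (\<lambda>n. U n \<omega>) \<longlonglongrightarrow> R \<omega>"
    using AE_regular_path R unfolding U_def
    by eventually_elim (rule filterlim_compose[OF compensated_sum_tendsto[OF T] filterlim_Suc]; blast)
  have dom: "AE \<omega> in P. norm (U n \<omega>) \<le> K * (regulator 1 \<omega> + 2 * (\<alpha> * \<mu>))" for n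
    using AE_regular_path unfolding U_def
    by eventually_elim (use compensated_sum_bound[OF T] in simp)
  have Iw: "integrable P (\<lambda>\<omega>. K * (regulator 1 \<omega> + 2 * (\<alpha> * \<mu>)))"
    using integrable_regulator by simp
  note dc = Bochner_Integration.integrable_dominated_convergence[OF assms(4) UM Iw ptw dom]
    Bochner_Integration.integral_dominated_convergence[OF assms(4) UM Iw ptw dom]
  show "integrable P R" by (rule dc(1))
  show "integral\<^sup>L P R = \<alpha> * \<mu> * integral\<^sup>L \<pi> f1 - \<mu> * integral\<^sup>L \<pi> f2"
    by (rule LIMSEQ_unique[OF dc(2) lim])
qed

end

section \<open>Mass and mean from a Laplace transform\<close>

text \<open>The transform a / (\<alpha> + \<theta>) belongs to an exponential density of rate
  \<alpha> with total mass a / \<alpha>. Rather than inverting it, the proof lets \<theta> tend to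
  0: the values give the mass, the difference quotients at 0 the first moment. Fatou's lemma
  supplies integrability of \<open>Y\<close>, which then dominates the quotients.\<close>

lemma Laplace_transform_moments:
  assumes "finite_measure M" and A [measurable]: "A \<in> sets M" and Y [measurable]: "Y \<in> borel_measurable M"
    and Y0: "\<And>x. x \<in> A \<Longrightarrow> 0 \<le> Y x" and \<alpha>: "0 < \<alpha>"
    and L: "\<And>\<theta>. 0 < \<theta> \<Longrightarrow> (\<integral>x. indicator A x * exp (- \<theta> * Y x) \<partial>M) = a / (\<alpha> + \<theta>)"
  shows "measure M A = a / \<alpha>" "integrable M (\<lambda>x. indicator A x * Y x)"
    "(\<integral>x. indicator A x * Y x \<partial>M) = a / \<alpha>\<^sup>2"
proof -
  interpret finite_measure M by fact
  define \<theta> where "\<theta> n = 1 / real (Suc n)" for n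
  have \<theta>: "0 < \<theta> n" for n by (simp add: \<theta>_def)
  have \<theta>0: "\<theta> \<longlonglongrightarrow> 0" unfolding \<theta>_def by (rule LIMSEQ_Suc[OF lim_1_over_n])
  have le1: "norm (indicator A x * exp (- \<theta> n * Y x)) \<le> 1" for n x
    using Y0[of x] less_imp_le[OF \<theta>[of n]] by (auto simp: indicator_def)
  have int: "integrable M (\<lambda>x. indicator A x * exp (- \<theta> n * Y x))" for n
    by (rule integrable_const_bound[where B = 1]) (use le1 in auto)
  have "(\<lambda>n. \<integral>x. indicator A x * exp (- \<theta> n * Y x) \<partial>M) \<longlonglongrightarrow> (\<integral>x. indicator A x * exp (- 0 * Y x) \<partial>M)"
  proof (rule Bochner_Integration.integral_dominated_convergence[where w = "\<lambda>_. 1"])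
    show "AE x in M. (\<lambda>n. indicator A x * exp (- \<theta> n * Y x)) \<longlonglongrightarrow> indicator A x * exp (- 0 * Y x)"
      by (intro AE_I2 tendsto_intros \<theta>0)
  qed (use le1 in auto)
  moreover have "(\<lambda>n. \<integral>x. indicator A x * exp (- \<theta> n * Y x) \<partial>M) \<longlonglongrightarrow> a / (\<alpha> + 0)"
    unfolding L[OF \<theta>] using \<alpha> by (intro tendsto_intros \<theta>0) auto
  ultimately have "(\<integral>x. indicator A x * exp (- 0 * Y x) \<partial>M) = a / (\<alpha> + 0)" by (rule LIMSEQ_unique)
  then show mA: "measure M A = a / \<alpha>" by (simp add: sets.Int_space_eq2 A)
  have iA: "integrable M (\<lambda>x. indicator A x :: real)"
    by (rule integrable_const_bound[where B = 1]) auto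
  \<comment> \<open>The difference quotient of the transform at 0, taken under the integral. On
    \<open>A\<close> the quotient (1 - exp (- \<theta> Y)) / \<theta> lies between 0 and Y and tends
    to Y.\<close>
  define Z where "Z n x = (indicator A x - indicator A x * exp (- \<theta> n * Y x)) / \<theta> n" for n x
  have [measurable]: "Z n \<in> borel_measurable M" for n unfolding Z_def by measurable
  have iZ: "integrable M (Z n)" for n
    unfolding Z_def by (intro integrable_divide Bochner_Integration.integrable_diff int iA)
  have EZ: "integral\<^sup>L M (Z n) = a / (\<alpha> * (\<alpha> + \<theta> n))" for n
  proof -
    have "integral\<^sup>L M (Z n) = (measure M A - a / (\<alpha> + \<theta> n)) / \<theta> n"
      unfolding Z_def using int[of n] iA L[OF \<theta>, of n] by (simp add: sets.Int_space_eq2 A)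
    also have "\<dots> = a / (\<alpha> * (\<alpha> + \<theta> n))"
      using \<theta>[of n] \<alpha> unfolding mA by (simp add: divide_simps) (simp add: algebra_simps)
    finally show ?thesis .
  qed
  have limZ: "(\<lambda>n. integral\<^sup>L M (Z n)) \<longlonglongrightarrow> a / \<alpha>\<^sup>2"
  proof -
    have "(\<lambda>n. a / (\<alpha> * (\<alpha> + \<theta> n))) \<longlonglongrightarrow> a / (\<alpha> * (\<alpha> + 0))"
      using \<alpha> by (intro tendsto_intros \<theta>0) auto
    then show ?thesis by (simp add: EZ power2_eq_square)
  qed
  have Z0: "0 \<le> Z n x" for n x
    using Y0[of x] \<theta>[of n] by (auto simp: Z_def indicator_def)
  have ZY: "Z n x \<le> indicator A x * Y x" for n x
    using exp_ge_add_one_self[of "- \<theta> n * Y x"] \<theta>[of n] by (auto simp: Z_def indicator_def divide_le_eq mult.commute)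
  have ptw: "(\<lambda>n. Z n x) \<longlonglongrightarrow> indicator A x * Y x" for x
  proof -
    have "((\<lambda>t. - exp (- t * Y x)) has_real_derivative Y x) (at 0)"
      by (auto intro!: derivative_eq_intros)
    then have "((\<lambda>h. (- exp (- h * Y x) + 1) / h) \<longlongrightarrow> Y x) (at 0)"
      by (simp add: DERIV_def)
    moreover have "filterlim \<theta> (at 0) sequentially"
      using \<theta>0 \<theta> by (auto simp: filterlim_at less_imp_neq[symmetric])
    ultimately have "(\<lambda>n. (- exp (- \<theta> n * Y x) + 1) / \<theta> n) \<longlonglongrightarrow> Y x"
      by (rule filterlim_compose)
    then have "(\<lambda>n. indicator A x * ((- exp (- \<theta> n * Y x) + 1) / \<theta> n)) \<longlonglongrightarrow> indicator A x * Y x"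
      by (intro tendsto_mult tendsto_const)
    moreover have "(\<lambda>n. indicator A x * ((- exp (- \<theta> n * Y x) + 1) / \<theta> n)) = (\<lambda>n. Z n x)"
      by (auto simp: Z_def algebra_simps)
    ultimately show ?thesis by simp
  qed
  have "(\<integral>\<^sup>+x. ennreal (indicator A x * Y x) \<partial>M) = (\<integral>\<^sup>+x. liminf (\<lambda>n. ennreal (Z n x)) \<partial>M)"
    by (intro nn_integral_cong lim_imp_Liminf[symmetric] tendsto_ennrealI ptw) simp
  also have "\<dots> \<le> liminf (\<lambda>n. \<integral>\<^sup>+x. ennreal (Z n x) \<partial>M)"
    by (rule nn_integral_liminf) measurable
  also have "(\<lambda>n. \<integral>\<^sup>+x. ennreal (Z n x) \<partial>M) = (\<lambda>n. ennreal (integral\<^sup>L M (Z n)))"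
    using iZ Z0 by (intro ext nn_integral_eq_integral) auto
  also have "liminf \<dots> = ennreal (a / \<alpha>\<^sup>2)"
    using limZ by (intro lim_imp_Liminf tendsto_ennrealI) auto
  finally have fin: "(\<integral>\<^sup>+x. ennreal (indicator A x * Y x) \<partial>M) < \<infinity>"
    by (rule order_le_less_trans) simp
  show iY: "integrable M (\<lambda>x. indicator A x * Y x)"
    by (rule integrableI_nonneg) (use fin Y0 in \<open>auto simp: indicator_def\<close>)
  have "(\<lambda>n. integral\<^sup>L M (Z n)) \<longlonglongrightarrow> (\<integral>x. indicator A x * Y x \<partial>M)"
  proof (rule Bochner_Integration.integral_dominated_convergence[where w = "\<lambda>x. indicator A x * Y x"])
    show "AE x in M. norm (Z n x) \<le> indicator A x * Y x" for n using Z0 ZY by auto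
  qed (use ptw iY in auto)
  then show "(\<integral>x. indicator A x * Y x \<partial>M) = a / \<alpha>\<^sup>2" using limZ by (rule LIMSEQ_unique)
qed

section \<open>Boundary limits, joint measurability and time averages\<close>

context regulated_diffusion
begin

text \<open>Regulator increments occur only in cells ending within \<epsilon> of 1, so replacing
  \<open>f1\<close> by its value at 1 costs at most K \<epsilon> per unit of regulator.\<close>

lemma riemann_stieltjes_boundary:
  assumes T: "test_function K f f1 f2" and \<omega>: "regular_path \<omega>"
    and flat: "\<forall>s t. 0 \<le> s \<and> s \<le> t \<and> (\<forall>u\<in>{s..t}. 1 < N u \<omega>) \<longrightarrow> regulator t \<omega> = regulator s \<omega>"
  shows "(\<lambda>n. riemann_stieltjes f1 n \<omega>) \<longlonglongrightarrow> f1 1 * regulator 1 \<omega>"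
proof (rule tendstoI)
  fix e :: real assume e: "0 < e"
  have K: "0 \<le> K" using test_functionD(6)[OF T] .
  have L: "0 \<le> regulator 1 \<omega>" using regular_path_increments(3)[OF \<omega>, of 1] by simp
  define C where "C = K * regulator 1 \<omega> + 1"
  have C: "0 < C" using K L by (simp add: C_def add_nonneg_pos)
  define \<epsilon> where "\<epsilon> = e / C"
  have \<epsilon>: "0 < \<epsilon>" using e C by (simp add: \<epsilon>_def)
  show "\<forall>\<^sub>F n in sequentially. dist (riemann_stieltjes f1 n \<omega>) (f1 1 * regulator 1 \<omega>) < e"
    using regulator_increment_near_boundary[OF \<omega> \<epsilon> flat] eventually_gt_at_top[of 0]
  proof eventually_elim
    case (elim n)
    define d where "d i = regulator (real (Suc i) / real n) \<omega> - regulator (real i / real n) \<omega>" for i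
    define y where "y i = N (real (Suc i) / real n) \<omega>" for i
    note inc = regular_path_increments[OF \<omega> elim(2), folded d_def]
    have y1: "1 \<le> y i" for i using \<omega> by (simp add: y_def regular_path_def)
    have "\<bar>riemann_stieltjes f1 n \<omega> - f1 1 * regulator 1 \<omega>\<bar> = \<bar>\<Sum>i<n. (f1 (y i) - f1 1) * d i\<bar>"
      unfolding inc(2)[symmetric] riemann_stieltjes_def d_def[symmetric] y_def[symmetric]
      by (simp add: sum_distrib_left sum_subtractf left_diff_distrib)
    also have "\<dots> \<le> (\<Sum>i<n. K * \<epsilon> * d i)"
    proof (rule order_trans[OF sum_abs], rule sum_mono)
      fix i assume "i \<in> {..<n}"
      then consider "y i \<le> 1 + \<epsilon>" | "d i = 0" using elim(1) unfolding y_def d_def by auto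
      then show "\<bar>(f1 (y i) - f1 1) * d i\<bar> \<le> K * \<epsilon> * d i"
      proof cases
        case 1
        have "\<bar>f1 (y i) - f1 1\<bar> \<le> K * \<bar>y i - 1\<bar>" by (rule test_function_lipschitz(2)[OF T])
        also have "\<dots> \<le> K * \<epsilon>" using 1 y1[of i] K by (intro mult_left_mono) auto
        finally show ?thesis using inc(1)[of i] by (simp add: abs_mult mult_right_mono)
      qed simp
    qed
    also have "\<dots> = \<epsilon> * (C - 1)" by (simp add: sum_distrib_left[symmetric] inc(2) C_def)
    also have "\<dots> < \<epsilon> * C" using \<epsilon> by simp
    also have "\<dots> = e" using C by (simp add: \<epsilon>_def)
    finally show ?case by (simp add: dist_real_def)
  qed
qed

lemma AE_pi_iff:
  assumes "Measurable.pred borel Q"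
  shows "(AE x in \<pi>. Q x) \<longleftrightarrow> (AE \<omega> in P. Q (N 0 \<omega>))"
proof -
  have "{x \<in> space borel. Q x} \<in> sets borel" using assms by measurable
  from AE_distr_iff[OF N_measurable[OF order_refl] this] show ?thesis
    unfolding law[OF order_refl] .
qed

lemma AE_pi_ge_1: "AE x in \<pi>. 1 \<le> x"
  using ge_1 by (subst AE_pi_iff) (auto elim: eventually_mono)

lemma integrable_pi_bounded_ge_1:
  fixes h :: "real \<Rightarrow> real"
  assumes "h \<in> borel_measurable borel" "\<And>x. 1 \<le> x \<Longrightarrow> \<bar>h x\<bar> \<le> K"
  shows "integrable \<pi> h"
proof -
  interpret pi: prob_space \<pi> by (rule prob_space_pi)
  have "AE x in \<pi>. norm (h x) \<le> K" using AE_pi_ge_1 by eventually_elim (use assms(2) in simp)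
  then show ?thesis using assms(1) by (intro pi.integrable_const_bound[where B=K]) auto
qed

text \<open>Adaptedness makes each \<open>N s\<close> measurable separately, whereas Fubini needs
  joint measurability in time and \<omega>. Sampling at the countably many multiples of 1/(n+1) is
  jointly measurable, and continuity of almost every path identifies the limit.\<close>

lemma continuous_version:
  obtains X :: "real \<times> 'w \<Rightarrow> real" where "X \<in> borel_measurable (lborel \<Otimes>\<^sub>M P)"
    "AE \<omega> in P. \<forall>s\<ge>0. X (s, \<omega>) = N s \<omega>"
proof -
  \<comment> \<open>Rounding up to the grid; \<open>nat\<close> sends negative times to 0, so only
    times at which \<open>N\<close> is controlled are sampled.\<close>
  define g where "g n s = real (nat \<lceil>real (Suc n) * s\<rceil>) / real (Suc n)" for n and s :: real
  define X where "X z = lim (\<lambda>n. N (g n (fst z)) (snd z))" for z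
  have m: "(\<lambda>z. N (g n (fst z)) (snd z)) \<in> borel_measurable (lborel \<Otimes>\<^sub>M P)" for n
    unfolding g_def
  proof (rule measurable_compose_countable[where f = "\<lambda>i z. N (real i / real (Suc n)) (snd z)"])
    show "(\<lambda>z. N (real i / real (Suc n)) (snd z)) \<in> borel_measurable (lborel \<Otimes>\<^sub>M P)" for i
      by (rule measurable_compose[OF measurable_snd N_measurable]) simp
    show "(\<lambda>z. nat \<lceil>real (Suc n) * fst z\<rceil>) \<in> lborel \<Otimes>\<^sub>M P \<rightarrow>\<^sub>M count_space UNIV"
      by measurable
  qed
  have gs: "(\<lambda>n. g n s) \<longlonglongrightarrow> s" if "0 \<le> s" for s
  proof (rule tendsto_sandwich[of "\<lambda>_. s" _ _ "\<lambda>n. s + 1 / real (Suc n)"])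
    have bnd: "real (Suc n) * s \<le> real (nat \<lceil>real (Suc n) * s\<rceil>)" "real (nat \<lceil>real (Suc n) * s\<rceil>) \<le> real (Suc n) * s + 1" for n
      using that by (simp_all add: of_nat_nat del: of_nat_Suc)
    show "\<forall>\<^sub>F n in sequentially. s \<le> g n s"
      using bnd(1) by (simp add: g_def le_divide_eq mult.commute del: of_nat_Suc)
    show "\<forall>\<^sub>F n in sequentially. g n s \<le> s + 1 / real (Suc n)"
    proof (intro always_eventually allI)
      fix n
      have "g n s \<le> (real (Suc n) * s + 1) / real (Suc n)"
        unfolding g_def by (rule divide_right_mono[OF bnd(2)]) simp
      then show "g n s \<le> s + 1 / real (Suc n)" by (simp add: add_divide_distrib del: of_nat_Suc)
    qed
    have "(\<lambda>n. s + 1 / real (Suc n)) \<longlonglongrightarrow> s + 0" by (intro tendsto_intros LIMSEQ_Suc[OF lim_1_over_n])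
    then show "(\<lambda>n. s + 1 / real (Suc n)) \<longlonglongrightarrow> s" by simp
  qed simp
  show ?thesis
  proof (rule that[of X])
    show "X \<in> borel_measurable (lborel \<Otimes>\<^sub>M P)"
      unfolding X_def by (rule borel_measurable_lim_metric[OF m])
    show "AE \<omega> in P. \<forall>s\<ge>0. X (s, \<omega>) = N s \<omega>"
      using continuous_paths
    proof eventually_elim
      case (elim \<omega>)
      have "(\<lambda>n. N (g n s) \<omega>) \<longlonglongrightarrow> N s \<omega>" if "0 \<le> s" for s
      proof (rule continuous_on_tendsto_compose[OF elim gs[OF that]])
        show "\<forall>\<^sub>F n in sequentially. g n s \<in> {0..}"
          unfolding g_def by (intro always_eventually allI) (simp del: of_nat_Suc)
      qed (use that in simp)
      then show ?case by (auto simp: X_def limI)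
    qed
  qed
qed

text \<open>Fubini together with stationarity: at every time in [0,1] the law is
  \<open>\<pi>\<close>. The version for nonnegative integrals does not presuppose integrability,
  because it is what establishes integrability of the singular JSQ drift.\<close>

lemma time_average:
  fixes X :: "real \<times> 'w \<Rightarrow> real" and h :: "real \<Rightarrow> real"
  assumes X [measurable]: "X \<in> borel_measurable (lborel \<Otimes>\<^sub>M P)"
    and XN: "AE \<omega> in P. \<forall>s\<ge>0. X (s, \<omega>) = N s \<omega>"
    and h [measurable]: "h \<in> borel_measurable borel"
  shows "(\<integral>\<^sup>+\<omega>. \<integral>\<^sup>+s. ennreal (indicator {0..1} s * h (X (s, \<omega>))) \<partial>lborel \<partial>P) = (\<integral>\<^sup>+x. ennreal (h x) \<partial>\<pi>)"
    and "integrable \<pi> h \<Longrightarrow> (\<integral>\<omega>. \<integral>s. indicator {0..1} s * h (X (s, \<omega>)) \<partial>lborel \<partial>P) = (\<integral>x. h x \<partial>\<pi>)"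
proof -
  interpret L: pair_sigma_finite lborel P ..
  have XNs: "AE \<omega> in P. X (s, \<omega>) = N s \<omega>" if "0 \<le> s" for s
    using XN by eventually_elim (use that in blast)
  have Xs: "(\<lambda>\<omega>. X (s, \<omega>)) \<in> borel_measurable P" for s by measurable
  have nn: "(\<integral>\<^sup>+\<omega>. \<integral>\<^sup>+s. ennreal (indicator {0..1} s * g (X (s, \<omega>))) \<partial>lborel \<partial>P) = (\<integral>\<^sup>+x. ennreal (g x) \<partial>\<pi>)"
    if [measurable]: "g \<in> borel_measurable borel" for g :: "real \<Rightarrow> real"
  proof -
    have "(\<integral>\<^sup>+\<omega>. \<integral>\<^sup>+s. ennreal (indicator {0..1} s * g (X (s, \<omega>))) \<partial>lborel \<partial>P)
       = (\<integral>\<^sup>+s. \<integral>\<^sup>+\<omega>. ennreal (indicator {0..1} s * g (X (s, \<omega>))) \<partial>P \<partial>lborel)"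
      by (rule L.Fubini') measurable
    also have "\<dots> = (\<integral>\<^sup>+s. indicator {0..1::real} s * (\<integral>\<^sup>+x. ennreal (g x) \<partial>\<pi>) \<partial>lborel)"
    proof (rule nn_integral_cong)
      fix s :: real
      show "(\<integral>\<^sup>+\<omega>. ennreal (indicator {0..1} s * g (X (s, \<omega>))) \<partial>P) = indicator {0..1} s * (\<integral>\<^sup>+x. ennreal (g x) \<partial>\<pi>)"
      proof (cases "s \<in> {0..1}")
        case True
        then have s: "0 \<le> s" by simp
        have "(\<integral>\<^sup>+\<omega>. ennreal (g (X (s, \<omega>))) \<partial>P) = (\<integral>\<^sup>+\<omega>. ennreal (g (N s \<omega>)) \<partial>P)"
          using XNs[OF s] by (intro nn_integral_cong_AE) (auto elim: eventually_mono)
        also have "\<dots> = (\<integral>\<^sup>+x. ennreal (g x) \<partial>distr P borel (N s))"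
          by (rule nn_integral_distr[symmetric]) (use N_measurable[OF s] in measurable)
        finally show ?thesis using True law[OF s] by simp
      qed simp
    qed
    also have "\<dots> = (\<integral>\<^sup>+x. ennreal (g x) \<partial>\<pi>)" by (simp add: nn_integral_multc)
    finally show ?thesis .
  qed
  show "(\<integral>\<^sup>+\<omega>. \<integral>\<^sup>+s. ennreal (indicator {0..1} s * h (X (s, \<omega>))) \<partial>lborel \<partial>P) = (\<integral>\<^sup>+x. ennreal (h x) \<partial>\<pi>)"
    by (rule nn[OF h])
  assume Ih: "integrable \<pi> h"
  have prod: "integrable (lborel \<Otimes>\<^sub>M P) (\<lambda>(s, \<omega>). indicator {0..1} s * h (X (s, \<omega>)))"
  proof (rule integrableI_bounded)
    have "(\<integral>\<^sup>+z. ennreal (norm (case z of (s, \<omega>) \<Rightarrow> indicator {0..1} s * h (X (s, \<omega>)))) \<partial>(lborel \<Otimes>\<^sub>M P))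
      = (\<integral>\<^sup>+\<omega>. \<integral>\<^sup>+s. ennreal (norm (indicator {0..1} s * h (X (s, \<omega>)))) \<partial>lborel \<partial>P)"
      by (subst L.nn_integral_snd[symmetric]) auto
    also have "\<dots> = (\<integral>\<^sup>+\<omega>. \<integral>\<^sup>+s. ennreal (indicator {0..1} s * \<bar>h (X (s, \<omega>))\<bar>) \<partial>lborel \<partial>P)"
      by (simp add: abs_mult)
    also have "\<dots> = (\<integral>\<^sup>+x. ennreal \<bar>h x\<bar> \<partial>\<pi>)" by (rule nn) measurable
    also have "\<dots> < \<infinity>" using Ih by (simp add: integrable_iff_bounded)
    finally show "(\<integral>\<^sup>+z. ennreal (norm (case z of (s, \<omega>) \<Rightarrow> indicator {0..1} s * h (X (s, \<omega>)))) \<partial>(lborel \<Otimes>\<^sub>M P)) < \<infinity>" .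
  qed measurable
  have "(\<integral>\<omega>. \<integral>s. indicator {0..1} s * h (X (s, \<omega>)) \<partial>lborel \<partial>P) = (\<integral>s. \<integral>\<omega>. indicator {0..1} s * h (X (s, \<omega>)) \<partial>P \<partial>lborel)"
    by (rule L.Fubini_integral[OF prod])
  also have "\<dots> = (\<integral>s. indicator {0..1::real} s * integral\<^sup>L \<pi> h \<partial>lborel)"
  proof (rule Bochner_Integration.integral_cong[OF refl])
    fix s :: real
    show "(\<integral>\<omega>. indicator {0..1} s * h (X (s, \<omega>)) \<partial>P) = indicator {0..1} s * integral\<^sup>L \<pi> h"
    proof (cases "s \<in> {0..1}")
      case True
      then have s: "0 \<le> s" by simp
      have [measurable]: "N s \<in> borel_measurable P" by (rule N_measurable[OF s])
      have "(\<integral>\<omega>. h (X (s, \<omega>)) \<partial>P) = (\<integral>\<omega>. h (N s \<omega>) \<partial>P)"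
        using XNs[OF s] by (intro integral_cong_AE) (auto elim: eventually_mono)
      then show ?thesis using True integral_pi[OF s h] by simp
    qed simp
  qed
  also have "\<dots> = integral\<^sup>L \<pi> h" by simp
  finally show "(\<integral>\<omega>. \<integral>s. indicator {0..1} s * h (X (s, \<omega>)) \<partial>lborel \<partial>P) = (\<integral>x. h x \<partial>\<pi>)" .
qed

end

section \<open>The real inequality behind the constant 1.14\<close>

lemma exp_ge_quartic:
  fixes x :: real
  assumes "0 \<le> x"
  shows "1 + x + x\<^sup>2 / 2 + x ^ 3 / 6 + x ^ 4 / 24 \<le> exp x"
proof -
  obtain t where "exp x = (\<Sum>m<6. x ^ m / fact m) + exp t / fact 6 * x ^ 6"
    using Maclaurin_exp_le[of x 6] by blast
  moreover have "0 \<le> exp t / fact 6 * x ^ 6" using assms by simp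
  moreover have "0 \<le> x ^ 5" using assms by simp
  ultimately show ?thesis by (simp add: eval_nat_numeral fact_numeral)
qed

text \<open>Clearing denominators in the wanted bound on the JSQ mean, with k = 1 + a and E = exp k,
  gives a k (1 + a E) + a^2 + 4 a + 1 + 2 a^2 E <= 1.14 k^2 (1 + a E). Collecting the terms with and
  without E produces the two quadratics seen here.\<close>

lemma ratio_inequality:
  fixes a :: real
  assumes "0 < a"
  shows "0.86 * a\<^sup>2 + 2.72 * a - 0.14 \<le> a * exp (1 + a) * (0.14 * a\<^sup>2 - 0.72 * a + 1.14)"
proof -
  define T where "T = 1 + a + a\<^sup>2 / 2 + a ^ 3 / 6 + a ^ 4 / 24"
  define w where "w = 0.14 * a\<^sup>2 - 0.72 * a + 1.14"
  have w: "0 \<le> w"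
  proof -
    \<comment> \<open>Completing the square; the vertex is 0.72 / 0.28 = 18 / 7 and the remaining
      constant is positive.\<close>
    have "w = 0.14 * (a - 18 / 7)\<^sup>2 + (1.14 - 0.14 * (18 / 7)\<^sup>2)"
      by (simp add: w_def power2_eq_square field_simps)
    then show ?thesis by (simp add: power2_eq_square)
  qed
  have T: "2.7 * T \<le> exp (1 + a)"
  proof -
    have "2.7 \<le> exp (1::real)" using exp_ge_quartic[of 1] by simp
    moreover have "T \<le> exp a" unfolding T_def using exp_ge_quartic assms by simp
    moreover have "0 \<le> T" unfolding T_def using assms by simp
    ultimately show ?thesis unfolding exp_add by (intro mult_mono) auto
  qed
  \<comment> \<open>Below 3/2 the negative terms in a^3 to a^6 are absorbed into a^2, and what is
    then negative into a. Above 3/2 the expansion in a - 3/2 has a single negative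
    coefficient.\<close>
  have "0.86 * a\<^sup>2 + 2.72 * a - 0.14 \<le> a * (2.7 * T) * w"
  proof (cases "a \<le> 3 / 2")
    case True
    have p3: "a ^ 3 \<le> 3 / 2 * a\<^sup>2" and p4: "a ^ 4 \<le> 9 / 4 * a\<^sup>2" and p5: "a ^ 5 \<le> 27 / 8 * a\<^sup>2"
      and p6: "a ^ 6 \<le> 81 / 16 * a\<^sup>2" and p2: "a\<^sup>2 \<le> 3 / 2 * a"
    proof -
      have le: "a ^ n \<le> (3 / 2) ^ n" for n using True assms by (intro power_mono) auto
      have "a ^ (n + 2) \<le> (3 / 2) ^ n * a\<^sup>2" for n
        unfolding power_add using le[of n] by (intro mult_right_mono) auto
      from this[of 1] this[of 2] this[of 3] this[of 4]
      show "a ^ 3 \<le> 3 / 2 * a\<^sup>2" "a ^ 4 \<le> 9 / 4 * a\<^sup>2" "a ^ 5 \<le> 27 / 8 * a\<^sup>2" "a ^ 6 \<le> 81 / 16 * a\<^sup>2"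
        by (simp_all add: power_divide eval_nat_numeral)
      show "a\<^sup>2 \<le> 3 / 2 * a" using True assms by (simp add: power2_eq_square)
    qed
    have "a * (2.7 * T) * w = (1539 / 500) * a + (567 / 500) * a\<^sup>2
        + (- 27 / 1000) * a ^ 3
        + (- 81 / 1000) * a ^ 4
        + (- 27 / 4000) * a ^ 5
        + (- 9 / 500) * a ^ 6 + (63 / 4000) * a ^ 7"
      by (simp add: T_def w_def field_simps eval_nat_numeral)
    moreover have "0 \<le> a ^ 7" using assms by simp
    ultimately have "43 / 50 * a\<^sup>2 + 68 / 25 * a - 7 / 50 \<le> a * (2.7 * T) * w"
      using p2 p3 p4 p5 p6 assms by linarith
    then show ?thesis by simp
  next
    case False
    define t where "t = a - 3 / 2"
    have t: "0 < t" "a = 3 / 2 + t" using False by (auto simp: t_def)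
    \<comment> \<open>The negative coefficient is that of t^2; this absorbs it into the constant and
      the cubic term.\<close>
    have "t\<^sup>2 \<le> 1 + t ^ 3"
    proof (cases "t \<le> 1")
      case True
      then show ?thesis using t power_le_one[of t 2] zero_le_power[of t 3] by linarith
    next
      case False
      then have "t\<^sup>2 \<le> t ^ 3" by (intro power_increasing) auto
      then show ?thesis by linarith
    qed
    moreover have "0 \<le> t ^ 3" "0 \<le> t ^ 4" "0 \<le> t ^ 5" "0 \<le> t ^ 6" "0 \<le> t ^ 7" using t by simp_all
    moreover have "a * (2.7 * T) * w - (43 / 50 * a\<^sup>2 + 68 / 25 * a - 7 / 50) =
        (16489 / 20480)
        + (8657 / 51200) * t
        + (- 3079 / 128000) * t\<^sup>2
        + (58293 / 64000) * t ^ 3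
        + (35883 / 32000) * t ^ 4
        + (9207 / 16000) * t ^ 5
        + (1179 / 8000) * t ^ 6
        + (63 / 4000) * t ^ 7"
      unfolding T_def w_def t(2) by (simp add: field_simps eval_nat_numeral)
    ultimately have "0 \<le> a * (2.7 * T) * w - (43 / 50 * a\<^sup>2 + 68 / 25 * a - 7 / 50)"
      using t(1) by linarith
    then show ?thesis by simp
  qed
  also have "\<dots> \<le> a * exp (1 + a) * w"
    using T w assms by (intro mult_right_mono mult_left_mono) auto
  finally show ?thesis unfolding w_def .
qed

section \<open>Construction of test functions\<close>

text \<open>At the joint the derivatives within the two closed half-lines agree, and together these
  half-lines cover the line. Elsewhere one of the pieces is the function locally.\<close>

lemma glued_derivative:
  fixes a :: real
  assumes p: "\<And>x. (p has_real_derivative p1 x) (at x)" and q: "\<And>x. (q has_real_derivative q1 x) (at x)"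
    and eq: "p a = q a" "p1 a = q1 a"
  shows "((\<lambda>x. if x \<le> a then p x else q x) has_real_derivative (if x \<le> a then p1 x else q1 x)) (at x)"
proof (cases x a rule: linorder_cases)
  case less
  have "((\<lambda>x. if x \<le> a then p x else q x) has_real_derivative p1 x) (at x)"
    by (rule has_field_derivative_transform_within_open[where S = "{..<a}", OF p]) (use less in auto)
  then show ?thesis using less by simp
next
  case greater
  have "((\<lambda>x. if x \<le> a then p x else q x) has_real_derivative q1 x) (at x)"
    by (rule has_field_derivative_transform_within_open[where S = "{a<..}", OF q]) (use greater in auto)
  then show ?thesis using greater by simp
next
  case equal
  have "((\<lambda>x. if x \<le> a then p x else q x) has_real_derivative p1 a) (at a within {..a})"
    by (rule has_field_derivative_transform_within[OF has_field_derivative_at_within[OF p] zero_less_one]) auto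
  moreover have "((\<lambda>x. if x \<le> a then p x else q x) has_real_derivative p1 a) (at a within {a..})"
    unfolding eq(2)
    by (rule has_field_derivative_transform_within[OF has_field_derivative_at_within[OF q] zero_less_one])
      (use eq(1) in auto)
  ultimately have "((\<lambda>x. if x \<le> a then p x else q x) has_real_derivative p1 a) (at a within {..a} \<union> {a..})"
    unfolding has_field_derivative_iff by (simp add: at_within_union filterlim_sup)
  moreover have "{..a} \<union> {a..} = UNIV" by auto
  ultimately show ?thesis using equal by simp
qed

text \<open>Points on opposite sides of \<open>a\<close> are compared through \<open>a\<close>,
  where the second derivatives agree; distances through \<open>a\<close> add up exactly, so the
  Lipschitz constant does not grow.\<close>

lemma test_function_on_glue:
  assumes p: "test_function_on K (S \<inter> {..a}) p p1 p2" and q: "test_function_on K (S \<inter> {a..}) q q1 q2"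
    and eq: "p a = q a" "p1 a = q1 a" "p2 a = q2 a" and a: "a \<in> S"
  shows "test_function_on K S (\<lambda>x. if x \<le> a then p x else q x) (\<lambda>x. if x \<le> a then p1 x else q1 x)
     (\<lambda>x. if x \<le> a then p2 x else q2 x)"
proof -
  have lp: "\<bar>p2 x - p2 y\<bar> \<le> K * \<bar>x - y\<bar>" if "x \<in> S \<inter> {..a}" "y \<in> S \<inter> {..a}" for x y
    using p that unfolding test_function_on_def by blast
  have lq: "\<bar>q2 x - q2 y\<bar> \<le> K * \<bar>x - y\<bar>" if "x \<in> S \<inter> {a..}" "y \<in> S \<inter> {a..}" for x y
    using q that unfolding test_function_on_def by blast
  have across: "\<bar>p2 x - q2 y\<bar> \<le> K * \<bar>x - y\<bar>" if "x \<in> S" "y \<in> S" "x \<le> a" "a \<le> y" for x y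
  proof -
    have "\<bar>p2 x - p2 a\<bar> \<le> K * \<bar>x - a\<bar>" "\<bar>q2 a - q2 y\<bar> \<le> K * \<bar>a - y\<bar>"
      using lp[of x a] lq[of a y] that a by simp_all
    moreover have "K * \<bar>x - y\<bar> = K * \<bar>x - a\<bar> + K * \<bar>a - y\<bar>"
      using that by (simp add: algebra_simps)
    ultimately show ?thesis using eq(3) by linarith
  qed
  have lip: "\<bar>(if x \<le> a then p2 x else q2 x) - (if y \<le> a then p2 y else q2 y)\<bar> \<le> K * \<bar>x - y\<bar>"
    if "x \<in> S" "y \<in> S" for x y
    using lp[of x y] lq[of x y] that across[of x y] across[of y x]
    by (cases "x \<le> a"; cases "y \<le> a") (simp_all add: abs_minus_commute)
  have d: "\<And>x. (p has_real_derivative p1 x) (at x)" "\<And>x. (q has_real_derivative q1 x) (at x)"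
    "\<And>x. (p1 has_real_derivative p2 x) (at x)" "\<And>x. (q1 has_real_derivative q2 x) (at x)"
    using p q by (simp_all add: test_function_on_def)
  show ?thesis
    unfolding test_function_on_def
  proof (intro conjI allI ballI)
    fix x assume "x \<in> S"
    then show "\<bar>if x \<le> a then p1 x else q1 x\<bar> \<le> K" "\<bar>if x \<le> a then p2 x else q2 x\<bar> \<le> K"
      using p q by (simp_all add: test_function_on_def)
  qed (use glued_derivative[OF d(1,2) eq(1,2)] glued_derivative[OF d(3,4) eq(2,3)] lip in blast)+
qed

lemma test_function_on_mono:
  assumes "test_function_on K S f f1 f2" "K \<le> K'"
  shows "test_function_on K' S f f1 f2"
proof -
  have "K * \<bar>x - y\<bar> \<le> K' * \<bar>x - y\<bar>" for x y using assms(2) by (intro mult_right_mono) auto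
  then show ?thesis using assms unfolding test_function_on_def by (meson order_trans)
qed

lemma test_function_onI:
  assumes "\<And>x. (f has_real_derivative f1 x) (at x)" "\<And>x. (f1 has_real_derivative f2 x) (at x)"
    "\<And>x. (f2 has_real_derivative f3 x) (at x)" and S: "convex S"
    and b: "\<And>x. x \<in> S \<Longrightarrow> \<bar>f1 x\<bar> \<le> K" "\<And>x. x \<in> S \<Longrightarrow> \<bar>f2 x\<bar> \<le> K" "\<And>x. x \<in> S \<Longrightarrow> \<bar>f3 x\<bar> \<le> K"
  shows "test_function_on K S f f1 f2"
proof -
  have "\<bar>f2 x - f2 y\<bar> \<le> K * \<bar>x - y\<bar>" if "x \<in> S" "y \<in> S" for x y
    using field_differentiable_bound[OF S has_field_derivative_at_within[OF assms(3)], of K x y] b(3) that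
    by (simp add: abs_minus_commute)
  then show ?thesis using assms by (simp add: test_function_on_def)
qed

text \<open>The diffusions live on \<open>[1, \<infinity>)\<close>, but a Gaussian step may leave that half line.\<close>

lemma test_function_extend:
  assumes f: "test_function_on K {1..} f f1 f2"
  obtains K' g g1 g2 where "test_function K' g g1 g2"
    "\<And>x. 1 \<le> x \<Longrightarrow> g x = f x" "\<And>x. 1 \<le> x \<Longrightarrow> g1 x = f1 x" "\<And>x. 1 \<le> x \<Longrightarrow> g2 x = f2 x"
proof -
  define b where "b = f1 1"
  define c where "c = f2 1"
  \<comment> \<open>A trigonometric polynomial can match value, slope and curvature at 1 while all
    its derivatives stay bounded; the slope of a quadratic Taylor polynomial would be
    unbounded.\<close>
  define p where "p x = f 1 + b * sin (x - 1) + c * (1 - cos (x - 1))" for x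
  define p1 where "p1 x = b * cos (x - 1) + c * sin (x - 1)" for x
  define p2 where "p2 x = - b * sin (x - 1) + c * cos (x - 1)" for x
  have d: "(p has_real_derivative p1 x) (at x)" "(p1 has_real_derivative p2 x) (at x)"
    "(p2 has_real_derivative - p1 x) (at x)" for x
    unfolding p_def p1_def p2_def by (auto intro!: derivative_eq_intros simp: algebra_simps)
  have le: "\<bar>u * cos y + v * sin y\<bar> \<le> \<bar>u\<bar> + \<bar>v\<bar>" for u v y :: real
  proof -
    have "\<bar>u * cos y\<bar> \<le> \<bar>u\<bar> * 1" "\<bar>v * sin y\<bar> \<le> \<bar>v\<bar> * 1"
      unfolding abs_mult by (intro mult_left_mono; simp)+
    then show ?thesis by linarith
  qed
  have b1: "\<bar>p1 x\<bar> \<le> \<bar>b\<bar> + \<bar>c\<bar>" for x unfolding p1_def by (rule le)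
  have b2: "\<bar>p2 x\<bar> \<le> \<bar>b\<bar> + \<bar>c\<bar>" for x using le[of c "x - 1" "-b"] by (simp add: p2_def add.commute)
  have "test_function_on (\<bar>b\<bar> + \<bar>c\<bar>) (UNIV \<inter> {..1}) p p1 p2"
    by (rule test_function_onI[OF d]) (use b1 b2 in auto)
  then have "test_function_on (max K (\<bar>b\<bar> + \<bar>c\<bar>)) (UNIV \<inter> {..1}) p p1 p2"
    by (rule test_function_on_mono) simp
  moreover have "test_function_on (max K (\<bar>b\<bar> + \<bar>c\<bar>)) (UNIV \<inter> {1..}) f f1 f2"
    using test_function_on_mono[OF f] by simp
  ultimately have T: "test_function (max K (\<bar>b\<bar> + \<bar>c\<bar>)) (\<lambda>x. if x \<le> 1 then p x else f x) (\<lambda>x. if x \<le> 1 then p1 x else f1 x)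
     (\<lambda>x. if x \<le> 1 then p2 x else f2 x)"
    by (rule test_function_on_glue) (auto simp: p_def p1_def p2_def b_def c_def)
  show ?thesis
    by (rule that[OF T]) (auto simp: p_def p1_def p2_def b_def c_def)
qed

text \<open>Parametrized by the slope \<open>c\<close> at \<open>a\<close>, since slope and
  curvature are what has to match at a joint; the additive constant \<open>d\<close> adjusts the
  value.\<close>

lemma exp_decay_test_function_on:
  fixes a \<theta> c :: real
  assumes "0 < \<theta>"
  shows "\<exists>K. test_function_on K {a..} (\<lambda>x. - (c / \<theta>) * exp (- \<theta> * (x - a)) + d) (\<lambda>x. c * exp (- \<theta> * (x - a)))
           (\<lambda>x. - \<theta> * (c * exp (- \<theta> * (x - a))))"
proof -
  define K where "K = \<bar>c\<bar> * (1 + \<theta> + \<theta>\<^sup>2)"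
  have e: "exp (- \<theta> * (x - a)) \<le> 1" if "a \<le> x" for x using that assms by simp
  have b: "\<bar>t * (c * exp (- \<theta> * (x - a)))\<bar> \<le> K" if "a \<le> x" "\<bar>t\<bar> \<le> 1 + \<theta> + \<theta>\<^sup>2" for t x
  proof -
    have "\<bar>t\<bar> * (\<bar>c\<bar> * exp (- \<theta> * (x - a))) \<le> (1 + \<theta> + \<theta>\<^sup>2) * (\<bar>c\<bar> * 1)"
      using that e[OF that(1)] assms by (intro mult_mono mult_left_mono) auto
    then show ?thesis by (simp add: K_def abs_mult mult.commute)
  qed
  have "test_function_on K {a..} (\<lambda>x. - (c / \<theta>) * exp (- \<theta> * (x - a)) + d) (\<lambda>x. c * exp (- \<theta> * (x - a)))
           (\<lambda>x. - \<theta> * (c * exp (- \<theta> * (x - a))))"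
  proof (rule test_function_onI[where ?f3.0 = "\<lambda>x. \<theta>\<^sup>2 * (c * exp (- \<theta> * (x - a)))"])
    fix x :: real
    show "((\<lambda>x. - (c / \<theta>) * exp (- \<theta> * (x - a)) + d) has_real_derivative c * exp (- \<theta> * (x - a))) (at x)"
      "((\<lambda>x. c * exp (- \<theta> * (x - a))) has_real_derivative - \<theta> * (c * exp (- \<theta> * (x - a)))) (at x)"
      "((\<lambda>x. - \<theta> * (c * exp (- \<theta> * (x - a)))) has_real_derivative \<theta>\<^sup>2 * (c * exp (- \<theta> * (x - a)))) (at x)"
      using assms by (auto intro!: derivative_eq_intros simp: power2_eq_square)
    assume "x \<in> {a..}"
    then show "\<bar>c * exp (- \<theta> * (x - a))\<bar> \<le> K" "\<bar>- \<theta> * (c * exp (- \<theta> * (x - a)))\<bar> \<le> K"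
      "\<bar>\<theta>\<^sup>2 * (c * exp (- \<theta> * (x - a)))\<bar> \<le> K"
      using b[of x 1] b[of x "-\<theta>"] b[of x "\<theta>\<^sup>2"] assms by auto
  qed simp
  then show ?thesis ..
qed

section \<open>The entire function (exp x - 1) / x and the JSQ test function\<close>

text \<open>\<open>F\<close> is (exp x - 1) / x continued through 0, the point that corresponds to
  the singular boundary of the JSQ drift; the quotient formula itself says nothing about derivatives
  there, hence the power series.\<close>

lemma expm1_quotient:
  obtains G F F1 F2 F3 :: "real \<Rightarrow> real"
  where "\<And>x. (G has_real_derivative F x) (at x)" "\<And>x. (F has_real_derivative F1 x) (at x)"
    "\<And>x. (F1 has_real_derivative F2 x) (at x)" "\<And>x. (F2 has_real_derivative F3 x) (at x)"
    "continuous_on UNIV F2" "\<And>x. x * F x = exp x - 1"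
proof -
  \<comment> \<open>Coefficients of \<open>G\<close>, the sum of x^n / (n * n!) over n >= 1;
    repeated \<open>diffs\<close> gives all its derivatives as everywhere convergent series.\<close>
  define c :: "nat \<Rightarrow> real" where "c n = (if n = 0 then 0 else 1 / (real n * fact n))" for n
  define C where "C j = (diffs ^^ j) c" for j
  define S where "S j x = (\<Sum>n. C j n * x ^ n)" for j and x :: real
  have CS: "C (Suc j) = diffs (C j)" for j by (simp add: C_def)
  have sm: "summable (\<lambda>n. C j n * x ^ n)" for j x
  proof (induction j arbitrary: x)
    case 0
    have "summable (\<lambda>n. c n * x ^ n)"
    proof (rule summable_comparison_test'[OF summable_norm_exp[of x]])
      fix n :: nat
      have "\<bar>c n\<bar> \<le> inverse (fact n)"
        unfolding c_def by (auto intro!: le_imp_inverse_le simp: divide_inverse simp del: inverse_mult_distrib)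
      then show "norm (c n * x ^ n) \<le> norm (x ^ n /\<^sub>R fact n)"
        by (simp add: abs_mult mult_right_mono)
    qed
    then show ?case by (simp add: C_def)
  next
    case (Suc j)
    show ?case unfolding CS by (rule termdiff_converges_all[OF Suc])
  qed
  have d: "(S j has_real_derivative S (Suc j) x) (at x)" for j x
    unfolding S_def CS by (rule termdiffs_strong_converges_everywhere[OF sm])
  have "x * S 1 x = exp x - 1" for x
  proof -
    have C1: "C 1 n = 1 / fact (Suc n)" for n
      unfolding C_def by (simp add: diffs_def c_def del: of_nat_Suc)
    have "(\<lambda>n. x ^ n /\<^sub>R fact n) sums exp x" by (rule exp_converges)
    then have "(\<lambda>n. x ^ Suc n /\<^sub>R fact (Suc n)) sums (exp x - 1)"
      by (subst sums_Suc_iff) simp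
    moreover have "(\<lambda>n. x * (C 1 n * x ^ n)) sums (x * S 1 x)"
      unfolding S_def by (intro sums_mult summable_sums sm)
    moreover have "(\<lambda>n. x * (C 1 n * x ^ n)) = (\<lambda>n. x ^ Suc n /\<^sub>R fact (Suc n))"
      unfolding C1 by (simp add: field_simps del: fact_Suc)
    ultimately show ?thesis by (metis sums_unique2)
  qed
  moreover have "continuous_on UNIV (S 3)"
    using DERIV_isCont[OF d] by (simp add: continuous_at_imp_continuous_on)
  ultimately show ?thesis
    using that[of "S 0" "S 1" "S 2" "S 3" "S 4"] d[of 0] d[of 1] d[of 2] d[of 3]
    by (simp add: eval_nat_numeral)
qed

lemma compact_test_function_on:
  assumes d: "\<And>x. (f has_real_derivative f1 x) (at x)" "\<And>x. (f1 has_real_derivative f2 x) (at x)"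
    "\<And>x. (f2 has_real_derivative f3 x) (at x)" and c: "continuous_on UNIV f3"
  shows "\<exists>K. test_function_on K {a..b} f f1 f2"
proof -
  have c12: "continuous_on {a..b} f1" "continuous_on {a..b} f2" "continuous_on {a..b} f3"
    using DERIV_isCont[OF d(2)] DERIV_isCont[OF d(3)] continuous_on_subset[OF c]
    by (simp_all add: continuous_at_imp_continuous_on)
  have bd: "\<exists>K. \<forall>x\<in>{a..b}. \<bar>h x\<bar> \<le> K" if "continuous_on {a..b} h" for h :: "real \<Rightarrow> real"
    using compact_imp_bounded[OF compact_continuous_image[OF that compact_Icc]]
    by (auto simp: bounded_iff)
  obtain K1 K2 K3 where K: "\<forall>x\<in>{a..b}. \<bar>f1 x\<bar> \<le> K1" "\<forall>x\<in>{a..b}. \<bar>f2 x\<bar> \<le> K2" "\<forall>x\<in>{a..b}. \<bar>f3 x\<bar> \<le> K3"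
    using bd[OF c12(1)] bd[OF c12(2)] bd[OF c12(3)] by blast
  have "test_function_on (max K1 (max K2 K3)) {a..b} f f1 f2"
    by (rule test_function_onI[OF d]) (use K in \<open>auto simp: le_max_iff_disj\<close>)
  then show ?thesis ..
qed

text \<open>On \<open>(1, 2]\<close> the generator maps \<open>f\<close> to an affine function, and beyond \<open>2\<close> to a multiple of
  an exponential: integrating it against a stationary law yields a linear relation between the
  mass and first moment of \<open>(1, 2]\<close> and the Laplace transform beyond \<open>2\<close>.\<close>

lemma JSQ_test_function:
  fixes \<alpha> \<theta> :: real
  assumes \<alpha>: "0 < \<alpha>" and \<theta>: "0 < \<theta>"
  defines "H \<equiv> 1 - (exp (1 + \<alpha>) - 1) / (1 + \<alpha>)"
  defines "D \<equiv> (1 + \<alpha>) - (\<alpha> + \<theta>) * H" and "c \<equiv> (1 + \<alpha>) + (1 - \<alpha>) * H"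
  obtains K M f f1 f2 where "test_function K f f1 f2" "\<And>x. 1 \<le> x \<Longrightarrow> \<bar>f x\<bar> \<le> M"
    "\<And>x. 1 < x \<Longrightarrow> x \<le> 2 \<Longrightarrow> f2 x + ((2 - x) / (x - 1) - \<alpha>) * f1 x
       = D * (2 - (1 + \<alpha>) * (x - 1)) - (1 + \<alpha>) * (1 + \<theta>)"
    "\<And>x. 2 < x \<Longrightarrow> f2 x - \<alpha> * f1 x = - (\<alpha> + \<theta>) * c * exp (- \<theta> * (x - 2))"
proof -
  define k where "k = 1 + \<alpha>"
  \<comment> \<open>Matching slope c and curvature - \<theta> c at 2 gives two linear equations for
    the two coefficients and c. With the normalization 1 + \<theta> their solution has c free of
    \<theta> and D = c - A H.\<close>
  define A where "A = 1 + \<theta>"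
  have k: "0 < k" using \<alpha> by (simp add: k_def)
  obtain G F F1 F2 F3 where d: "\<And>x. (G has_real_derivative F x) (at x)" "\<And>x. (F has_real_derivative F1 x) (at x)"
    "\<And>x. (F1 has_real_derivative F2 x) (at x)" "\<And>x. (F2 has_real_derivative F3 x) (at x)"
    and cF2: "continuous_on UNIV F2" and F: "\<And>x. x * F x = exp x - 1"
    using expm1_quotient by blast
  have F1: "x * F1 x = 1 + x * F x - F x" for x
  proof -
    have "((\<lambda>x. x * F x) has_real_derivative F x + x * F1 x) (at x)"
      by (auto intro!: derivative_eq_intros d(2))
    moreover have "((\<lambda>x. x * F x) has_real_derivative exp x) (at x)"
      unfolding F by (auto intro!: derivative_eq_intros)
    ultimately have "F x + x * F1 x = exp x" by (rule DERIV_unique)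
    then show ?thesis using F[of x] by simp
  qed
  have HF: "H = 1 - F k" using F[of k] k by (simp add: H_def k_def field_simps)
  \<comment> \<open>With u = x - 1 and up to the factor \<mu>, the generator maps a function with
    slope u to 2 - k u and, by the identity for \<open>F1\<close>, one with slope 1 - F (k u) to -
    k. Both slopes vanish at u = 0, which cancels the singularity of the drift.\<close>
  define p0 where "p0 x = D * (x - 1)\<^sup>2 / 2 + A * ((x - 1) - G (k * (x - 1)) / k)" for x
  define p1 where "p1 x = D * (x - 1) + A * (1 - F (k * (x - 1)))" for x
  define p2 where "p2 x = D - A * k * F1 (k * (x - 1))" for x
  define p3 where "p3 x = - A * k\<^sup>2 * F2 (k * (x - 1))" for x
  have chain: "((\<lambda>x. h (k * (x - 1))) has_real_derivative k * h' (k * (x - 1))) (at x)"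
    if "\<And>x. (h has_real_derivative h' x) (at x)" for h h' x
  proof -
    have "((\<lambda>x. k * (x - 1)) has_real_derivative k) (at x)"
      by (auto intro!: derivative_eq_intros)
    from DERIV_chain2[OF that this] show ?thesis by (simp add: mult.commute)
  qed
  have dp0: "(p0 has_real_derivative p1 x) (at x)" for x
  proof -
    have G': "((\<lambda>x. G (k * (x - 1)) / k) has_real_derivative F (k * (x - 1))) (at x)"
      using DERIV_cdivide[OF chain[OF d(1)], of k x] k by simp
    show ?thesis
      unfolding p0_def p1_def by (rule derivative_eq_intros G' refl | simp)+
  qed
  have dp1: "(p1 has_real_derivative p2 x) (at x)" for x
    unfolding p1_def p2_def by (auto intro!: derivative_eq_intros chain[OF d(2)])
  have dp2: "(p2 has_real_derivative p3 x) (at x)" for x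
    unfolding p2_def p3_def by (auto intro!: derivative_eq_intros chain[OF d(3)] simp: power2_eq_square)
  have cp3: "continuous_on UNIV p3"
    unfolding p3_def by (intro continuous_intros continuous_on_compose2[OF cF2]) auto
  \<comment> \<open>Shifts the left piece so that the values agree at 2; the generator does not see
    the constant.\<close>
  define e where "e = - (c / \<theta>) - p0 2"
  have dp: "((\<lambda>x. p0 x + e) has_real_derivative p1 x) (at x)" for x
    by (auto intro!: derivative_eq_intros dp0)
  obtain K1 where K1: "test_function_on K1 {1..2} (\<lambda>x. p0 x + e) p1 p2"
    using compact_test_function_on[OF dp dp1 dp2 cp3] by blast
  define q where "q x = - (c / \<theta>) * exp (- \<theta> * (x - 2)) + 0" for x
  define q1 where "q1 x = c * exp (- \<theta> * (x - 2))" for x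
  define q2 where "q2 x = - \<theta> * (c * exp (- \<theta> * (x - 2)))" for x
  obtain K2 where K2: "test_function_on K2 {2..} q q1 q2"
    using exp_decay_test_function_on[OF \<theta>, of 2 c 0] unfolding q_def q1_def q2_def by blast
  have kF1: "k * F1 k = k - \<alpha> * H"
    using F1[of k] by (simp add: HF k_def algebra_simps)
  have m1: "p1 2 = q1 2"
  proof -
    have "p1 2 = D + A * H" by (simp add: p1_def HF)
    also have "\<dots> = c" by (simp add: A_def D_def c_def k_def algebra_simps)
    finally show ?thesis by (simp add: q1_def)
  qed
  have "p2 2 = D - A * (k * F1 k)" by (simp add: p2_def)
  also have "\<dots> = - \<theta> * c" unfolding kF1 by (simp add: A_def D_def c_def k_def algebra_simps)
  finally have m2: "p2 2 = q2 2" by (simp add: q2_def)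
  have m0: "p0 2 + e = q 2" by (simp add: e_def q_def)
  define h where "h x = (if x \<le> 2 then p0 x + e else q x)" for x
  define h1 where "h1 x = (if x \<le> 2 then p1 x else q1 x)" for x
  define h2 where "h2 x = (if x \<le> 2 then p2 x else q2 x)" for x
  have "test_function_on (max K1 K2) {1..} h h1 h2"
    unfolding h_def h1_def h2_def
  proof (rule test_function_on_glue)
    have "{1..} \<inter> {..2} = {1..2::real}" "{1..} \<inter> {2..} = {2::real..}" by auto
    then show "test_function_on (max K1 K2) ({1..} \<inter> {..2}) (\<lambda>x. p0 x + e) p1 p2"
      "test_function_on (max K1 K2) ({1..} \<inter> {2..}) q q1 q2"
      using test_function_on_mono[OF K1] test_function_on_mono[OF K2] by simp_all
  qed (use m0 m1 m2 in auto)
  then obtain K f f1 f2 where T: "test_function K f f1 f2" and f: "\<And>x. 1 \<le> x \<Longrightarrow> f x = h x"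
    "\<And>x. 1 \<le> x \<Longrightarrow> f1 x = h1 x" "\<And>x. 1 \<le> x \<Longrightarrow> f2 x = h2 x"
    using test_function_extend by blast
  have "continuous_on {1..2} (\<lambda>x. p0 x + e)"
    using DERIV_isCont[OF dp] by (simp add: continuous_at_imp_continuous_on)
  then obtain M where M: "\<And>x. 1 \<le> x \<Longrightarrow> x \<le> 2 \<Longrightarrow> \<bar>p0 x + e\<bar> \<le> M"
    using compact_imp_bounded[OF compact_continuous_image[OF _ compact_Icc]]
    by (force simp: bounded_iff)
  have hb: "\<bar>h x\<bar> \<le> max M (\<bar>c / \<theta>\<bar>)" if "1 \<le> x" for x
  proof (cases "x \<le> 2")
    case True
    then show ?thesis using M[OF that True] by (simp add: h_def le_max_iff_disj)
  next
    case False
    have "\<bar>c / \<theta>\<bar> * exp (- \<theta> * (x - 2)) \<le> \<bar>c / \<theta>\<bar> * 1"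
      using False \<theta> by (intro mult_left_mono) auto
    then show ?thesis using False by (simp add: h_def q_def abs_mult)
  qed
  show ?thesis
  proof (rule that[OF T])
    show "\<bar>f x\<bar> \<le> max M (\<bar>c / \<theta>\<bar>)" if "1 \<le> x" for x using hb[OF that] f(1)[OF that] by simp
  next
    fix x :: real
    assume x: "1 < x" "x \<le> 2"
    define u where "u = x - 1"
    have u: "0 < u" "x = u + 1" using x by (auto simp: u_def)
    have z: "k * u * F1 (k * u) = 1 + k * u * F (k * u) - F (k * u)" using F1[of "k * u"] .
    have "u * (f2 x + ((2 - x) / (x - 1) - \<alpha>) * f1 x) = u * p2 x + (1 - k * u) * p1 x"
      using x u by (simp add: f h1_def h2_def k_def field_simps)
    also have "\<dots> = u * D - A * (k * u * F1 (k * u)) + (1 - k * u) * (D * u + A * (1 - F (k * u)))"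
      by (simp add: p1_def p2_def u_def algebra_simps)
    also have "\<dots> = u * (D * (2 - k * u) - k * A)"
      unfolding z by (simp add: algebra_simps)
    finally show "f2 x + ((2 - x) / (x - 1) - \<alpha>) * f1 x
       = D * (2 - (1 + \<alpha>) * (x - 1)) - (1 + \<alpha>) * (1 + \<theta>)"
      using u by (simp add: k_def A_def)
  next
    fix x :: real
    assume "2 < x"
    then show "f2 x - \<alpha> * f1 x = - (\<alpha> + \<theta>) * c * exp (- \<theta> * (x - 2))"
      by (simp add: f h1_def h2_def q1_def q2_def algebra_simps)
  qed
qed

text \<open>For k < 2 this is the Pade bound exp k < (2 + k) / (2 - k). With k = 1 + \<alpha> the
  expression equals (1 + \<alpha>) c, where c multiplies the exponential part of the JSQ test
  function; it is needed to solve for the transform.\<close>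

lemma exp_Pade_lower:
  fixes k :: real
  assumes "0 < k"
  shows "0 < k + 2 + (k - 2) * exp k"
proof -
  define \<phi> where "\<phi> x = x + 2 + (x - 2) * exp x" for x :: real
  have "\<phi> 0 < \<phi> k"
  proof (rule DERIV_pos_imp_increasing_open[OF assms])
    fix x :: real assume "0 < x" "x < k"
    have "(\<phi> has_real_derivative 1 + (x - 1) * exp x) (at x)"
      unfolding \<phi>_def by (auto intro!: derivative_eq_intros simp: algebra_simps)
    moreover have "0 < 1 + (x - 1) * exp x"
    proof -
      have "1 - x < exp (- x)" using exp_minus_greater[of x] \<open>0 < x\<close> by simp
      then have "(1 - x) * exp x < exp (- x) * exp x" by simp
      then show ?thesis by (simp add: exp_minus algebra_simps)
    qed
    ultimately show "\<exists>y. (\<phi> has_real_derivative y) (at x) \<and> 0 < y" by blast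
  next
    show "continuous_on {0..k} \<phi>" unfolding \<phi>_def by (intro continuous_intros)
  qed
  then show ?thesis by (simp add: \<phi>_def)
qed

section \<open>The two stationary means\<close>

locale CQ_reflected = regulated_diffusion +
  assumes flat_above_1: "AE \<omega> in P. \<forall>s t. 0 \<le> s \<and> s \<le> t \<and> (\<forall>u\<in>{s..t}. 1 < N u \<omega>) \<longrightarrow>
    regulator t \<omega> = regulator s \<omega>"
begin

text \<open>Since the regulator acts at 1 only, it enters the stationary identity through the single
  number \<open>l\<close>, and the transform is (l / \<mu>) / (\<alpha> + \<theta>). Total mass 1
  forces l = \<alpha> \<mu>, and then the first moment is determined.\<close>

lemma CQ_mean: "integrable \<pi> (\<lambda>x. x)" "(\<integral>x. x \<partial>\<pi>) = 1 + 1 / \<alpha>"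
proof -
  interpret pi: prob_space \<pi> by (rule prob_space_pi)
  define l where "l = expectation (regulator 1)"
  define A :: "real set" where "A = {1..}"
  have A: "A \<in> sets \<pi>" by (simp add: A_def sets_pi)
  have L: "(\<integral>x. indicator A x * exp (- \<theta> * (x - 1)) \<partial>\<pi>) = (l / \<mu>) / (\<alpha> + \<theta>)" if \<theta>: "0 < \<theta>" for \<theta>
  proof -
    define h where "h = (\<lambda>x::real. indicator A x * exp (- \<theta> * (x - 1)))"
    \<comment> \<open>Slope - \<theta> at 1 selects exp (- \<theta> (x - 1)) with coefficient
      1.\<close>
    obtain K where "test_function_on K {1..} (\<lambda>x. - (- \<theta> / \<theta>) * exp (- \<theta> * (x - 1)) + 0)
       (\<lambda>x. - \<theta> * exp (- \<theta> * (x - 1))) (\<lambda>x. - \<theta> * (- \<theta> * exp (- \<theta> * (x - 1))))"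
      using exp_decay_test_function_on[OF \<theta>, of 1 "- \<theta>" 0] by blast
    then obtain K' f f1 f2 where T: "test_function K' f f1 f2"
      and f: "\<And>x. 1 \<le> x \<Longrightarrow> f x = - (- \<theta> / \<theta>) * exp (- \<theta> * (x - 1)) + 0"
        "\<And>x. 1 \<le> x \<Longrightarrow> f1 x = - \<theta> * exp (- \<theta> * (x - 1))"
        "\<And>x. 1 \<le> x \<Longrightarrow> f2 x = - \<theta> * (- \<theta> * exp (- \<theta> * (x - 1)))"
      using test_function_extend by blast
    note [measurable] = test_function_measurable[OF T]
    have If: "integrable \<pi> f"
      by (rule integrable_pi_bounded_ge_1[where K = 1]) (use f(1) \<theta> in auto)
    have hm [measurable]: "h \<in> borel_measurable borel" unfolding h_def A_def by measurable
    have "integral\<^sup>L P (\<lambda>\<omega>. f1 1 * regulator 1 \<omega>) = \<alpha> * \<mu> * integral\<^sup>L \<pi> f1 - \<mu> * integral\<^sup>L \<pi> f2"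
    proof (rule stationary_identity(2)[OF T If])
      show "AE \<omega> in P. regular_path \<omega> \<longrightarrow> (\<lambda>n. riemann_stieltjes f1 n \<omega>) \<longlonglongrightarrow> f1 1 * regulator 1 \<omega>"
        using flat_above_1 by eventually_elim (use riemann_stieltjes_boundary[OF T] in blast)
      show "(\<lambda>\<omega>. f1 1 * regulator 1 \<omega>) \<in> borel_measurable P"
        using regulator_measurable[of 1] by simp
    qed
    moreover have "integral\<^sup>L \<pi> f1 = (\<integral>x. - \<theta> * h x \<partial>\<pi>)"
      using AE_pi_ge_1 by (intro integral_cong_AE) (auto elim!: eventually_mono simp: f h_def A_def)
    moreover have "integral\<^sup>L \<pi> f2 = (\<integral>x. \<theta>\<^sup>2 * h x \<partial>\<pi>)"
      using AE_pi_ge_1 by (intro integral_cong_AE) (auto elim!: eventually_mono simp: f h_def A_def power2_eq_square)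
    moreover have "f1 1 = - \<theta>" by (simp add: f)
    ultimately have "\<theta> * l = \<theta> * (\<mu> * (\<alpha> + \<theta>) * integral\<^sup>L \<pi> h)"
      by (simp add: l_def algebra_simps power2_eq_square)
    then have "l = \<mu> * (\<alpha> + \<theta>) * integral\<^sup>L \<pi> h" using \<theta> by simp
    then have "integral\<^sup>L \<pi> h = (l / \<mu>) / (\<alpha> + \<theta>)"
      using mu_pos alpha_pos \<theta> by simp
    then show ?thesis unfolding h_def .
  qed
  have Y: "(\<lambda>x. x - 1) \<in> borel_measurable \<pi>" by measurable
  note M = Laplace_transform_moments[OF pi.finite_measure_axioms A Y _ alpha_pos L, unfolded A_def, simplified]
  have AE1: "AE x in \<pi>. x \<in> {1..}" using AE_pi_ge_1 by simp
  have "measure \<pi> {1..} = 1" using AE1 by (subst pi.prob_eq_1) (auto simp: sets_pi)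
  then have l: "l / \<mu> = \<alpha>" using M(1) alpha_pos mu_pos by (simp add: field_simps)
  have eq: "AE x in \<pi>. indicator {1..} x * (x - 1) = x - 1"
    using AE1 by eventually_elim simp
  have I: "integrable \<pi> (\<lambda>x. x - 1)"
    using M(2) eq by (subst integrable_cong_AE[symmetric]) auto
  have E: "(\<integral>x. x - 1 \<partial>\<pi>) = 1 / \<alpha>"
  proof -
    have "(\<integral>x. x - 1 \<partial>\<pi>) = (\<integral>x. indicator {1..} x * (x - 1) \<partial>\<pi>)"
      using eq by (intro integral_cong_AE) (auto elim: eventually_mono)
    also have "\<dots> = (l / \<mu>) / \<alpha>\<^sup>2" using M(3) by simp
    also have "\<dots> = 1 / \<alpha>" unfolding l using alpha_pos by (simp add: power2_eq_square)
    finally show ?thesis .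
  qed
  have I1: "integrable \<pi> (\<lambda>x. (x - 1) + 1)" using I by (rule Bochner_Integration.integrable_add) simp
  then show "integrable \<pi> (\<lambda>x. x)" by simp
  have "(\<integral>x. (x - 1) + 1 \<partial>\<pi>) = (\<integral>x. x - 1 \<partial>\<pi>) + (\<integral>x. 1 \<partial>\<pi>)"
    using I by (rule Bochner_Integration.integral_add) simp
  then show "(\<integral>x. x \<partial>\<pi>) = 1 + 1 / \<alpha>" using E pi.prob_space by simp
qed

end

text \<open>The part of the JSQ drift that keeps the process above \<open>1\<close>.\<close>

definition JSQ_push :: "real \<Rightarrow> real \<Rightarrow> real" where
  "JSQ_push \<mu> x = \<mu> * (max (2 - x) 0 / (x - 1))"

lemma JSQ_push_measurable [measurable]: "JSQ_push \<mu> \<in> borel_measurable borel"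
  unfolding JSQ_push_def by measurable

lemma JSQ_push_nonneg: "0 < \<mu> \<Longrightarrow> 1 < x \<Longrightarrow> 0 \<le> JSQ_push \<mu> x"
  by (simp add: JSQ_push_def)

section \<open>The stationary identity for Join-the-Shortest-Queue\<close>

text \<open>Here the regulator has the push as its density in time. Staying strictly above 1 makes
  this density continuous along each path, although no bound holds uniformly over paths.\<close>

locale JSQ_regulated = regulated_diffusion +
  assumes gt_1: "AE \<omega> in P. \<forall>t\<ge>0. 1 < N t \<omega>"
    and regulator_integral: "AE \<omega> in P. \<forall>t\<ge>0. regulator t \<omega> = integral {0..t} (\<lambda>s. JSQ_push \<mu> (N s \<omega>))"
begin

lemma push_continuous:
  assumes "regular_path \<omega>" "\<forall>t\<ge>0. 1 < N t \<omega>"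
  shows "continuous_on {0..1} (\<lambda>s. JSQ_push \<mu> (N s \<omega>))"
proof -
  have N: "continuous_on {0..1} (\<lambda>s. N s \<omega>)"
    using assms(1) by (auto simp: regular_path_def intro: continuous_on_subset)
  show ?thesis
    unfolding JSQ_push_def using assms(2) by (intro continuous_intros N) force
qed

text \<open>Within a cell \<open>f1\<close> along the path varies by at most K \<epsilon>, so the
  error of a cell is at most K \<epsilon> times its regulator increment, and these increments sum to
  \<open>regulator 1\<close>. The size of the density itself never enters.\<close>

lemma riemann_stieltjes_density:
  assumes T: "test_function K f f1 f2" and \<omega>: "regular_path \<omega>" and gt: "\<forall>t\<ge>0. 1 < N t \<omega>"
    and reg: "\<forall>t\<ge>0. regulator t \<omega> = integral {0..t} (\<lambda>s. JSQ_push \<mu> (N s \<omega>))"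
  shows "(\<lambda>n. riemann_stieltjes f1 n \<omega>) \<longlonglongrightarrow> integral {0..1} (\<lambda>s. f1 (N s \<omega>) * JSQ_push \<mu> (N s \<omega>))"
proof (rule tendstoI)
  fix e :: real assume e: "0 < e"
  have K: "0 \<le> K" using test_functionD(6)[OF T] .
  have L: "0 \<le> regulator 1 \<omega>" using regular_path_increments(3)[OF \<omega>, of 1] by simp
  define C where "C = K * regulator 1 \<omega> + 1"
  have C: "0 < C" using K L by (simp add: C_def add_nonneg_pos)
  define \<epsilon> where "\<epsilon> = e / C"
  have \<epsilon>: "0 < \<epsilon>" using e C by (simp add: \<epsilon>_def)
  define b where "b = (\<lambda>s. JSQ_push \<mu> (N s \<omega>))"
  define g where "g = (\<lambda>s. f1 (N s \<omega>) * b s)"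
  have Nc: "continuous_on {0..1} (\<lambda>s. N s \<omega>)"
    using \<omega> by (auto simp: regular_path_def intro: continuous_on_subset)
  have bc: "continuous_on {0..1} b" unfolding b_def by (rule push_continuous[OF \<omega> gt])
  have gc: "continuous_on {0..1} g"
    unfolding g_def
    by (intro continuous_intros bc continuous_on_compose2[OF test_function_continuous(2)[OF T] Nc]) auto
  have b0: "0 \<le> b s" if "0 \<le> s" for s
    unfolding b_def using gt that by (intro JSQ_push_nonneg mu_pos) auto
  have split: "integral {0..t} h - integral {0..s} h = integral {s..t} h"
    if "continuous_on {0..1} h" "0 \<le> s" "s \<le> t" "t \<le> 1" for h :: "real \<Rightarrow> real" and s t
  proof -
    have "h integrable_on {0..t}"
      using that by (intro integrable_continuous_interval continuous_on_subset[OF that(1)]) auto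
    from Henstock_Kurzweil_Integration.integral_combine[OF that(2,3) this] show ?thesis by simp
  qed
  show "\<forall>\<^sub>F n in sequentially. dist (riemann_stieltjes f1 n \<omega>) (integral {0..1} (\<lambda>s. f1 (N s \<omega>) * JSQ_push \<mu> (N s \<omega>))) < e"
    using grid_oscillation[OF Nc \<epsilon>] eventually_gt_at_top[of 0]
  proof eventually_elim
    case (elim n)
    define t where "t i = real i / real n" for i
    have t: "0 \<le> t i" "t i \<le> t (Suc i)" for i by (simp_all add: t_def divide_right_mono)
    have t1: "t (Suc i) \<le> 1" if "i < n" for i using that by (simp add: t_def)
    have t0n: "t 0 = 0" "t n = 1" using elim(2) by (simp_all add: t_def)
    note inc = regular_path_increments[OF \<omega> elim(2), folded t_def]
    have step: "\<bar>f1 (N (t (Suc i)) \<omega>) * (regulator (t (Suc i)) \<omega> - regulator (t i) \<omega>)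
        - (integral {0..t (Suc i)} g - integral {0..t i} g)\<bar>
        \<le> K * \<epsilon> * (regulator (t (Suc i)) \<omega> - regulator (t i) \<omega>)" if i: "i < n" for i
    proof -
      define y where "y = N (t (Suc i)) \<omega>"
      define J where "J = {t i..t (Suc i)}"
      have J: "J \<subseteq> {0..1}" using t(1)[of i] t1[OF i] by (auto simp: J_def)
      have ib: "b integrable_on J" and ig: "g integrable_on J"
        unfolding J_def
        using continuous_on_subset[OF bc J] continuous_on_subset[OF gc J]
        by (auto simp: J_def intro: integrable_continuous_interval)
      have ic: "(\<lambda>s. C * b s) integrable_on J" for C
        using integrable_cmul[OF ib, of C] by simp
      have r: "regulator (t (Suc i)) \<omega> - regulator (t i) \<omega> = integral J b"
        using reg t(1) split[OF bc t(1) t(2) t1[OF i]] by (simp add: b_def J_def)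
      have "f1 y * integral J b - integral J g = integral J (\<lambda>s. f1 y * b s - g s)"
        using ic ig by (subst Henstock_Kurzweil_Integration.integral_diff) auto
      also have "\<bar>\<dots>\<bar> \<le> integral J (\<lambda>s. K * \<epsilon> * b s)"
        unfolding real_norm_def[symmetric]
      proof (rule Henstock_Kurzweil_Integration.integral_norm_bound_integral)
        fix s assume s: "s \<in> J"
        have "\<bar>N s \<omega> - y\<bar> < \<epsilon>" using elim(1) i s by (simp add: y_def J_def t_def)
        then have "K * \<bar>y - N s \<omega>\<bar> \<le> K * \<epsilon>" using K by (intro mult_left_mono) auto
        then have "\<bar>f1 y - f1 (N s \<omega>)\<bar> \<le> K * \<epsilon>"
          using test_function_lipschitz(2)[OF T, of y "N s \<omega>"] by linarith
        then have "\<bar>f1 y - f1 (N s \<omega>)\<bar> * b s \<le> K * \<epsilon> * b s"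
          using b0[of s] s J by (intro mult_right_mono) auto
        moreover have "f1 y * b s - g s = (f1 y - f1 (N s \<omega>)) * b s" by (simp add: g_def left_diff_distrib)
        ultimately show "norm (f1 y * b s - g s) \<le> K * \<epsilon> * b s"
          using b0[of s] s J by (auto simp: abs_mult)
      qed (intro ic ig Henstock_Kurzweil_Integration.integrable_diff)+
      also have "\<dots> = K * \<epsilon> * integral J b" by simp
      finally show ?thesis
        unfolding r split[OF gc t(1) t(2) t1[OF i]] y_def[symmetric] J_def[symmetric] .
    qed
    have tel: "(\<Sum>i<n. integral {0..t (Suc i)} g - integral {0..t i} g) = integral {0..1} g"
      by (subst sum_lessThan_telescope) (simp add: t0n)
    have "\<bar>riemann_stieltjes f1 n \<omega> - integral {0..1} g\<bar>
      = \<bar>\<Sum>i<n. f1 (N (t (Suc i)) \<omega>) * (regulator (t (Suc i)) \<omega> - regulator (t i) \<omega>)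
        - (integral {0..t (Suc i)} g - integral {0..t i} g)\<bar>"
      unfolding tel[symmetric] sum_subtractf riemann_stieltjes_def t_def by simp
    also have "\<dots> \<le> (\<Sum>i<n. K * \<epsilon> * (regulator (t (Suc i)) \<omega> - regulator (t i) \<omega>))"
      by (rule order_trans[OF sum_abs]) (intro sum_mono step, simp)
    also have "\<dots> = \<epsilon> * (C - 1)" by (simp add: sum_distrib_left[symmetric] inc(2) C_def)
    also have "\<dots> < \<epsilon> * C" using \<epsilon> by simp
    also have "\<dots> = e" using C by (simp add: \<epsilon>_def)
    finally show ?case by (simp add: dist_real_def g_def b_def)
  qed
qed

text \<open>\<open>regulator 1\<close> is the time integral of the push, and in mean a time integral
  over [0,1] is an integral against the stationary law. Finiteness of the mean regulator thus
  controls the singularity at 1.\<close>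

lemma integrable_push: "integrable \<pi> (JSQ_push \<mu>)"
proof -
  obtain X where X [measurable]: "X \<in> borel_measurable (lborel \<Otimes>\<^sub>M P)"
    and XN: "AE \<omega> in P. \<forall>s\<ge>0. X (s, \<omega>) = N s \<omega>"
    by (rule continuous_version)
  have "(\<integral>\<^sup>+x. ennreal (JSQ_push \<mu> x) \<partial>\<pi>)
     = (\<integral>\<^sup>+\<omega>. \<integral>\<^sup>+s. ennreal (indicator {0..1} s * JSQ_push \<mu> (X (s, \<omega>))) \<partial>lborel \<partial>P)"
    by (rule time_average(1)[OF X XN JSQ_push_measurable, symmetric])
  also have "\<dots> = (\<integral>\<^sup>+\<omega>. ennreal (regulator 1 \<omega>) \<partial>P)"
  proof (rule nn_integral_cong_AE)
    show "AE \<omega> in P. (\<integral>\<^sup>+s. ennreal (indicator {0..1} s * JSQ_push \<mu> (X (s, \<omega>))) \<partial>lborel) = ennreal (regulator 1 \<omega>)"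
      using XN AE_regular_path gt_1 regulator_integral
    proof eventually_elim
      case (elim \<omega>)
      have si: "set_integrable lborel {0..1} (\<lambda>s. JSQ_push \<mu> (N s \<omega>))"
        by (rule borel_integrable_atLeastAtMost'[OF push_continuous[OF elim(2,3)]])
      have "(\<integral>\<^sup>+s. ennreal (indicator {0..1} s * JSQ_push \<mu> (X (s, \<omega>))) \<partial>lborel)
        = (\<integral>\<^sup>+s. ennreal (indicator {0..1} s *\<^sub>R JSQ_push \<mu> (N s \<omega>)) \<partial>lborel)"
        using elim(1) by (intro nn_integral_cong) (auto simp: indicator_def)
      also have "\<dots> = ennreal (LBINT s:{0..1}. JSQ_push \<mu> (N s \<omega>))"
        unfolding set_lebesgue_integral_def using elim(3) JSQ_push_nonneg[OF mu_pos]
        by (intro nn_integral_eq_integral si[unfolded set_integrable_def]) (auto simp: indicator_def)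
      also have "\<dots> = ennreal (regulator 1 \<omega>)"
        using elim(4) set_borel_integral_eq_integral(2)[OF si] by simp
      finally show ?case .
    qed
  qed
  also have "\<dots> < \<infinity>"
    using integrable_regulator unfolding real_integrable_def by (simp add: less_top)
  finally have fin: "(\<integral>\<^sup>+x. ennreal (JSQ_push \<mu> x) \<partial>\<pi>) < \<infinity>" .
  have "AE x in \<pi>. 1 < x" using gt_1 by (subst AE_pi_iff) (auto elim: eventually_mono)
  then have "AE x in \<pi>. 0 \<le> JSQ_push \<mu> x" by eventually_elim (rule JSQ_push_nonneg[OF mu_pos])
  then show ?thesis using fin by (intro integrableI_nonneg) auto
qed

text \<open>The path integral in the general identity turns into a time average, so the identity
  closes in the stationary law: the generator \<mu> f2 - \<alpha> \<mu> f1 + f1 push integrates to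
  zero.\<close>

lemma JSQ_stationary_identity:
  assumes T: "test_function K f f1 f2" and If: "integrable \<pi> f"
  shows "integrable \<pi> (\<lambda>x. f1 x * JSQ_push \<mu> x)"
    "(\<integral>x. f1 x * JSQ_push \<mu> x \<partial>\<pi>) = \<alpha> * \<mu> * integral\<^sup>L \<pi> f1 - \<mu> * integral\<^sup>L \<pi> f2"
proof -
  note [measurable] = test_function_measurable[OF T]
  show int: "integrable \<pi> (\<lambda>x. f1 x * JSQ_push \<mu> x)"
  proof (rule Bochner_Integration.integrable_bound)
    show "integrable \<pi> (\<lambda>x. K * JSQ_push \<mu> x)" using integrable_push by simp
    show "AE x in \<pi>. norm (f1 x * JSQ_push \<mu> x) \<le> norm (K * JSQ_push \<mu> x)"
      using test_functionD(3,6)[OF T] by (auto simp: abs_mult intro!: mult_right_mono)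
  qed measurable
  obtain X where X [measurable]: "X \<in> borel_measurable (lborel \<Otimes>\<^sub>M P)"
    and XN: "AE \<omega> in P. \<forall>s\<ge>0. X (s, \<omega>) = N s \<omega>"
    by (rule continuous_version)
  \<comment> \<open>Using the jointly measurable \<open>X\<close> in place of \<open>N\<close> makes
    \<open>R\<close> measurable; almost surely the two give the same integral.\<close>
  define R where "R \<omega> = (\<integral>s. indicator {0..1} s * (f1 (X (s, \<omega>)) * JSQ_push \<mu> (X (s, \<omega>))) \<partial>lborel)" for \<omega>
  have "expectation R = \<alpha> * \<mu> * integral\<^sup>L \<pi> f1 - \<mu> * integral\<^sup>L \<pi> f2"
  proof (rule stationary_identity(2)[OF T If])
    show "R \<in> borel_measurable P" unfolding R_def by measurable
    show "AE \<omega> in P. regular_path \<omega> \<longrightarrow> (\<lambda>n. riemann_stieltjes f1 n \<omega>) \<longlonglongrightarrow> R \<omega>"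
      using XN gt_1 regulator_integral AE_regular_path
    proof eventually_elim
      case (elim \<omega>)
      have Nc: "continuous_on {0..1} (\<lambda>s. N s \<omega>)"
        using elim(4) by (auto simp: regular_path_def intro: continuous_on_subset)
      have "continuous_on {0..1} (\<lambda>s. f1 (N s \<omega>) * JSQ_push \<mu> (N s \<omega>))"
        by (intro continuous_intros push_continuous[OF elim(4,2)]
            continuous_on_compose2[OF test_function_continuous(2)[OF T] Nc]) auto
      then have si: "set_integrable lborel {0..1} (\<lambda>s. f1 (N s \<omega>) * JSQ_push \<mu> (N s \<omega>))"
        by (rule borel_integrable_atLeastAtMost')
      have "R \<omega> = (LBINT s:{0..1}. f1 (N s \<omega>) * JSQ_push \<mu> (N s \<omega>))"
        unfolding R_def set_lebesgue_integral_def
        using elim(1) by (intro Bochner_Integration.integral_cong) (auto simp: indicator_def)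
      then show "regular_path \<omega> \<longrightarrow> (\<lambda>n. riemann_stieltjes f1 n \<omega>) \<longlonglongrightarrow> R \<omega>"
        using riemann_stieltjes_density[OF T elim(4,2,3)] set_borel_integral_eq_integral(2)[OF si] by simp
    qed
  qed
  moreover have "expectation R = (\<integral>x. f1 x * JSQ_push \<mu> x \<partial>\<pi>)"
    unfolding R_def by (rule time_average(2)[OF X XN _ int]) measurable
  ultimately show "(\<integral>x. f1 x * JSQ_push \<mu> x \<partial>\<pi>) = \<alpha> * \<mu> * integral\<^sup>L \<pi> f1 - \<mu> * integral\<^sup>L \<pi> f2" by simp
qed

section \<open>Linear relations for the stationary law and the JSQ mean\<close>

text \<open>The point 2 is counted as near and the far half-line is open, so
  \<open>far_transform\<close> tends to 0 as \<theta> grows even if an atom at 2 is not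
  excluded.\<close>

definition "near_mass = measure \<pi> {1<..2}"
definition "near_moment = (\<integral>x. indicator {1<..2} x * (x - 1) \<partial>\<pi>)"
definition "far_transform \<theta> = (\<integral>x. indicator {2<..} x * exp (- \<theta> * (x - 2)) \<partial>\<pi>)"

lemma AE_pi_gt_1: "AE x in \<pi>. 1 < x"
  using gt_1 by (subst AE_pi_iff) (auto elim: eventually_mono)

lemma near_integrable:
  "integrable \<pi> (\<lambda>x. indicator {1<..2} x :: real)" "integrable \<pi> (\<lambda>x. indicator {1<..2} x * (x - 1))"
proof -
  interpret pi: prob_space \<pi> by (rule prob_space_pi)
  show "integrable \<pi> (\<lambda>x. indicator {1<..2} x :: real)" "integrable \<pi> (\<lambda>x. indicator {1<..2} x * (x - 1))"
    by (rule pi.integrable_const_bound[where B = 1]; auto simp: indicator_def)+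
qed

lemma far_integrable:
  assumes "0 \<le> \<theta>"
  shows "integrable \<pi> (\<lambda>x. indicator {2<..} x * exp (- \<theta> * (x - 2)))"
proof -
  interpret pi: prob_space \<pi> by (rule prob_space_pi)
  show ?thesis
    by (rule pi.integrable_const_bound[where B = 1]) (use assms in \<open>auto simp: indicator_def\<close>)
qed

text \<open>One equation for each \<theta>; the two near quantities are the same in all of them, so
  \<theta> enters only through explicit coefficients and
  \<open>far_transform \<theta>\<close>.\<close>

lemma JSQ_linear_relation:
  assumes \<theta>: "0 < \<theta>"
  defines "H \<equiv> 1 - (exp (1 + \<alpha>) - 1) / (1 + \<alpha>)"
  shows "((1 + \<alpha>) - (\<alpha> + \<theta>) * H) * (2 * near_mass - (1 + \<alpha>) * near_moment) - (1 + \<alpha>) * (1 + \<theta>) * near_mass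
     = (\<alpha> + \<theta>) * ((1 + \<alpha>) + (1 - \<alpha>) * H) * far_transform \<theta>"
proof -
  define D where "D = (1 + \<alpha>) - (\<alpha> + \<theta>) * H"
  define c where "c = (1 + \<alpha>) + (1 - \<alpha>) * H"
  define k where "k = 1 + \<alpha>"
  obtain K M f f1 f2 where T: "test_function K f f1 f2" and M: "\<And>x. 1 \<le> x \<Longrightarrow> \<bar>f x\<bar> \<le> M"
    and near: "\<And>x. 1 < x \<Longrightarrow> x \<le> 2 \<Longrightarrow> f2 x + ((2 - x) / (x - 1) - \<alpha>) * f1 x
       = D * (2 - k * (x - 1)) - k * (1 + \<theta>)"
    and far: "\<And>x. 2 < x \<Longrightarrow> f2 x - \<alpha> * f1 x = - (\<alpha> + \<theta>) * c * exp (- \<theta> * (x - 2))"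
    unfolding D_def c_def k_def H_def using JSQ_test_function[OF alpha_pos \<theta>] by metis
  note [measurable] = test_function_measurable[OF T]
  have If: "integrable \<pi> f" by (rule integrable_pi_bounded_ge_1[OF _ M]) measurable
  note I = JSQ_stationary_identity[OF T If]
  have I12: "integrable \<pi> f1" "integrable \<pi> f2"
    using integrable_pi_bounded[OF test_function_measurable(2)[OF T] test_functionD(3)[OF T]]
      integrable_pi_bounded[OF test_function_measurable(3)[OF T] test_functionD(4)[OF T]] by auto
  define g where "g x = (2 * D - k * (1 + \<theta>)) * indicator {1<..2} x - D * k * (indicator {1<..2} x * (x - 1))
     - (\<alpha> + \<theta>) * c * (indicator {2<..} x * exp (- \<theta> * (x - 2)))" for x
  have "0 = (\<integral>x. \<mu> * f2 x - \<alpha> * \<mu> * f1 x + f1 x * JSQ_push \<mu> x \<partial>\<pi>)"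
    using I I12 by simp
  also have "\<dots> = (\<integral>x. \<mu> * g x \<partial>\<pi>)"
  proof (rule integral_cong_AE)
    show "AE x in \<pi>. \<mu> * f2 x - \<alpha> * \<mu> * f1 x + f1 x * JSQ_push \<mu> x = \<mu> * g x"
      using AE_pi_gt_1
    proof eventually_elim
      case (elim x)
      show ?case
      proof (cases "x \<le> 2")
        case True
        have "\<mu> * f2 x - \<alpha> * \<mu> * f1 x + f1 x * JSQ_push \<mu> x = \<mu> * (f2 x + ((2 - x) / (x - 1) - \<alpha>) * f1 x)"
          using True by (simp add: JSQ_push_def algebra_simps)
        also have "\<dots> = \<mu> * g x"
          unfolding near[OF elim True] using elim True by (simp add: g_def algebra_simps)
        finally show ?thesis .
      next
        case False
        have "\<mu> * f2 x - \<alpha> * \<mu> * f1 x + f1 x * JSQ_push \<mu> x = \<mu> * (f2 x - \<alpha> * f1 x)"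
          using False by (simp add: JSQ_push_def algebra_simps)
        also have "\<dots> = \<mu> * g x"
          using False by (subst far) (simp_all add: g_def algebra_simps)
        finally show ?thesis .
      qed
    qed
  qed (unfold g_def, measurable)
  also have "\<dots> = \<mu> * ((2 * D - k * (1 + \<theta>)) * near_mass - D * k * near_moment - (\<alpha> + \<theta>) * c * far_transform \<theta>)"
    unfolding g_def near_mass_def near_moment_def far_transform_def
    using near_integrable far_integrable[of \<theta>] \<theta> by simp
  finally have "(2 * D - k * (1 + \<theta>)) * near_mass - D * k * near_moment = (\<alpha> + \<theta>) * c * far_transform \<theta>"
    using mu_pos by simp
  then show ?thesis
    unfolding D_def[symmetric] c_def[symmetric] by (simp add: k_def algebra_simps)
qed

lemma far_transform_tendsto_0: "(\<lambda>n. far_transform (real n)) \<longlonglongrightarrow> 0"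
proof -
  interpret pi: prob_space \<pi> by (rule prob_space_pi)
  have "(\<lambda>n. \<integral>x. indicator {2<..} x * exp (- real n * (x - 2)) \<partial>\<pi>) \<longlonglongrightarrow> (\<integral>x. 0 \<partial>\<pi>)"
  proof (rule Bochner_Integration.integral_dominated_convergence[where w = "\<lambda>_. 1"])
    show "AE x in \<pi>. (\<lambda>n. indicator {2<..} x * exp (- real n * (x - 2))) \<longlonglongrightarrow> 0"
    proof (intro AE_I2)
      fix x :: real
      show "(\<lambda>n. indicator {2<..} x * exp (- real n * (x - 2))) \<longlonglongrightarrow> 0"
      proof (cases "2 < x")
        case True
        have "exp (- real n * (x - 2)) = exp (- (x - 2)) ^ n" for n
          using exp_of_nat_mult[of n "- (x - 2)"] by (simp add: algebra_simps)
        moreover have "(\<lambda>n. exp (- (x - 2)) ^ n) \<longlonglongrightarrow> 0"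
          using True by (intro LIMSEQ_realpow_zero) auto
        ultimately show ?thesis using True by simp
      qed simp
    qed
    show "AE x in \<pi>. norm (indicator {2<..} x * exp (- real n * (x - 2))) \<le> 1" for n
      by (auto simp: indicator_def)
  qed auto
  then show ?thesis by (simp add: far_transform_def)
qed

text \<open>The relations read a + b \<theta> = (\<alpha> + \<theta>) c
  \<open>far_transform \<theta>\<close>. Large \<theta> gives b = 0, a balance between the near
  quantities; then a = c R with c > 0, so the transform is R / (\<alpha> + \<theta>), that of an
  exponential tail with density \<open>R\<close> just above 2. \<open>Q\<close> is the near mass,
  and the last equation is normalization.\<close>

lemma JSQ_mean:
  obtains R Q where "integrable \<pi> (\<lambda>x. x)" "(\<integral>x. x \<partial>\<pi>) = 1 + (2 * Q - R) / (1 + \<alpha>) + R / \<alpha> + R / \<alpha>\<^sup>2"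
    "(1 + \<alpha>)\<^sup>2 * Q = R * (exp (1 + \<alpha>) - (1 + \<alpha>) - 1)" "Q + R / \<alpha> = 1"
proof -
  interpret pi: prob_space \<pi> by (rule prob_space_pi)
  define H where "H = 1 - (exp (1 + \<alpha>) - 1) / (1 + \<alpha>)"
  define c where "c = (1 + \<alpha>) + (1 - \<alpha>) * H"
  define R where "R = 2 * near_mass - (1 + \<alpha>) * near_moment"
  define a where "a = ((1 + \<alpha>) - \<alpha> * H) * R - (1 + \<alpha>) * near_mass"
  define b where "b = - H * R - (1 + \<alpha>) * near_mass"
  have kH: "(1 + \<alpha>) * H = (1 + \<alpha>) + 1 - exp (1 + \<alpha>)" using alpha_pos by (simp add: H_def field_simps)
  have c: "0 < c"
  proof -
    have "(1 + \<alpha>) * c = (1 + \<alpha>)\<^sup>2 + (1 - \<alpha>) * ((1 + \<alpha>) * H)"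
      by (simp add: c_def algebra_simps power2_eq_square)
    also have "\<dots> = 1 + \<alpha> + 2 + (1 + \<alpha> - 2) * exp (1 + \<alpha>)"
      unfolding kH by (simp add: algebra_simps power2_eq_square)
    finally have "0 < (1 + \<alpha>) * c"
      using exp_Pade_lower[of "1 + \<alpha>"] alpha_pos by simp
    then show ?thesis using alpha_pos by (simp add: zero_less_mult_iff)
  qed
  have rel: "a + b * \<theta> = (\<alpha> + \<theta>) * c * far_transform \<theta>" if "0 < \<theta>" for \<theta>
    using JSQ_linear_relation[OF that] unfolding H_def[symmetric] c_def[symmetric] R_def[symmetric]
    by (simp add: a_def b_def algebra_simps)
  have b: "b = 0"
  proof -
    have lim: "(\<lambda>n. c * far_transform (real n)) \<longlonglongrightarrow> c * 0"
      by (intro tendsto_intros far_transform_tendsto_0)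
    have "(\<lambda>n. (a + b * real n) / (\<alpha> + real n)) \<longlonglongrightarrow> b"
      by real_asymp
    moreover have "\<forall>\<^sub>F n in sequentially. (a + b * real n) / (\<alpha> + real n) = c * far_transform (real n)"
      using eventually_gt_at_top[of 0]
    proof eventually_elim
      case (elim n)
      then show ?case using rel[of "real n"] alpha_pos by (simp add: field_simps)
    qed
    ultimately have "(\<lambda>n. c * far_transform (real n)) \<longlonglongrightarrow> b"
      using tendsto_cong by force
    then show ?thesis using LIMSEQ_unique[OF lim] by simp
  qed
  have L: "(\<integral>x. indicator {2<..} x * exp (- \<theta> * (x - 2)) \<partial>\<pi>) = R / (\<alpha> + \<theta>)" if "0 < \<theta>" for \<theta>
  proof -
    have "a = c * R" using b by (simp add: a_def b_def c_def algebra_simps)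
    then have "R = far_transform \<theta> * (\<alpha> + \<theta>)" using rel[OF that] c by (simp add: b)
    then show ?thesis unfolding far_transform_def[symmetric] using that alpha_pos by simp
  qed
  have A: "{2<..} \<in> sets \<pi>" by (simp add: sets_pi)
  have Y: "(\<lambda>x. x - 2) \<in> borel_measurable \<pi>" by measurable
  note M = Laplace_transform_moments[OF pi.finite_measure_axioms A Y _ alpha_pos L, simplified]
  have iF: "integrable \<pi> (\<lambda>x. indicator {2<..} x :: real)" using far_integrable[of 0] by simp
  \<comment> \<open>On the tail x is split as 1 + 1 + (x - 2), so that tail mass and tail moment
    both appear.\<close>
  have eq: "AE x in \<pi>. x = 1 + indicator {1<..2} x * (x - 1) + indicator {2<..} x + indicator {2<..} x * (x - 2)"
    using AE_pi_gt_1 by eventually_elim (auto simp: indicator_def)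
  have I: "integrable \<pi> (\<lambda>x. 1 + indicator {1<..2} x * (x - 1) + indicator {2<..} x + indicator {2<..} x * (x - 2))"
    using near_integrable(2) iF M(2) by (intro Bochner_Integration.integrable_add) auto
  have int: "integrable \<pi> (\<lambda>x. x)"
    using I eq by (subst integrable_cong_AE[where g = "\<lambda>x. 1 + indicator {1<..2} x * (x - 1) + indicator {2<..} x + indicator {2<..} x * (x - 2)"]) auto
  have "(\<integral>x. x \<partial>\<pi>) = (\<integral>x. 1 + indicator {1<..2} x * (x - 1) + indicator {2<..} x + indicator {2<..} x * (x - 2) \<partial>\<pi>)"
    using eq by (intro integral_cong_AE) auto
  also have "\<dots> = 1 + near_moment + measure \<pi> {2<..} + (\<integral>x. indicator {2<..} x * (x - 2) \<partial>\<pi>)"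
    using near_integrable(2) iF M(2) pi.prob_space by (simp add: near_moment_def)
  also have "\<dots> = 1 + (2 * near_mass - R) / (1 + \<alpha>) + R / \<alpha> + R / \<alpha>\<^sup>2"
    using M(1,3) alpha_pos by (simp add: R_def)
  finally have mean: "(\<integral>x. x \<partial>\<pi>) = 1 + (2 * near_mass - R) / (1 + \<alpha>) + R / \<alpha> + R / \<alpha>\<^sup>2" .
  have mass: "near_mass + R / \<alpha> = 1"
  proof -
    have "measure \<pi> ({1<..2} \<union> {2<..}) = 1"
      using AE_pi_gt_1 by (subst pi.prob_eq_1) (auto simp: sets_pi elim: eventually_mono)
    moreover have "measure \<pi> ({1<..2} \<union> {2<..}) = near_mass + measure \<pi> {2<..}"
      unfolding near_mass_def by (rule pi.finite_measure_Union) (auto simp: sets_pi)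
    ultimately show ?thesis using M(1) by simp
  qed
  have bal: "(1 + \<alpha>) * near_mass = - H * R" using b by (simp add: b_def)
  have "(1 + \<alpha>)\<^sup>2 * near_mass = (1 + \<alpha>) * ((1 + \<alpha>) * near_mass)" by (simp add: power2_eq_square)
  also have "\<dots> = - ((1 + \<alpha>) * H) * R" unfolding bal by simp
  also note kH
  finally have "(1 + \<alpha>)\<^sup>2 * near_mass = R * (exp (1 + \<alpha>) - (1 + \<alpha>) - 1)" by (simp add: algebra_simps)
  then show ?thesis using that[OF int mean _ mass] by blast
qed

text \<open>Balance and normalization determine \<open>Q\<close> and \<open>R\<close>; eliminating
  them gives the closed form of the mean, and the bound becomes \<open>ratio_inequality\<close> up
  to positive factors.\<close>

lemma JSQ_mean_le: "(\<integral>x. x \<partial>\<pi>) \<le> 1.14 * (1 + 1 / \<alpha>)"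
proof -
  obtain R Q where m: "(\<integral>x. x \<partial>\<pi>) = 1 + (2 * Q - R) / (1 + \<alpha>) + R / \<alpha> + R / \<alpha>\<^sup>2"
    and 1: "(1 + \<alpha>)\<^sup>2 * Q = R * (exp (1 + \<alpha>) - (1 + \<alpha>) - 1)" and 2: "Q + R / \<alpha> = 1"
    using JSQ_mean by metis
  define k where "k = 1 + \<alpha>"
  define E where "E = exp k"
  have k: "0 < k" "\<alpha> = k - 1" and E: "0 < E" using alpha_pos by (auto simp: k_def E_def)
  have aE: "0 < 1 + \<alpha> * E" using alpha_pos E by (simp add: add_pos_pos)
  \<comment> \<open>Normalization times \<alpha> k^2 with the balance inserted; the factor of
    \<open>R\<close> collapses because \<alpha> (k + 1) = k^2 - 1.\<close>
  have R: "R * (1 + \<alpha> * E) = \<alpha> * k\<^sup>2"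
  proof -
    have "\<alpha> * Q + R = \<alpha>" using 2 alpha_pos by (simp add: field_simps)
    then have "k\<^sup>2 * (\<alpha> * Q + R) = k\<^sup>2 * \<alpha>" by simp
    then have "\<alpha> * (k\<^sup>2 * Q) + k\<^sup>2 * R = \<alpha> * k\<^sup>2" by (simp add: algebra_simps)
    then have "\<alpha> * (R * (E - k - 1)) + k\<^sup>2 * R = \<alpha> * k\<^sup>2"
      using 1 unfolding k_def[symmetric] E_def[symmetric] by simp
    moreover have "\<alpha> * (R * (E - k - 1)) + k\<^sup>2 * R = R * (1 + \<alpha> * E)"
      unfolding k(2) by (simp add: algebra_simps power2_eq_square)
    ultimately show ?thesis by simp
  qed
  have "k\<^sup>2 * (\<alpha>\<^sup>2 * k * (\<integral>x. x \<partial>\<pi>)) = \<alpha>\<^sup>2 * k ^ 3 + \<alpha>\<^sup>2 * (2 * (k\<^sup>2 * Q) - k\<^sup>2 * R) + \<alpha> * k ^ 3 * R + k ^ 3 * R"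
    unfolding m k_def[symmetric] using k(1) alpha_pos
    by (simp add: field_simps power2_eq_square power3_eq_cube)
  also have "\<dots> = \<alpha>\<^sup>2 * k ^ 3 + R * (\<alpha>\<^sup>2 + 4 * \<alpha> + 1 + 2 * \<alpha>\<^sup>2 * E)"
    unfolding 1[folded k_def, folded E_def] unfolding k(2)
    by (simp add: algebra_simps power2_eq_square power3_eq_cube)
  finally have "k\<^sup>2 * (\<alpha>\<^sup>2 * k * (\<integral>x. x \<partial>\<pi>)) * (1 + \<alpha> * E)
    = \<alpha>\<^sup>2 * k ^ 3 * (1 + \<alpha> * E) + R * (1 + \<alpha> * E) * (\<alpha>\<^sup>2 + 4 * \<alpha> + 1 + 2 * \<alpha>\<^sup>2 * E)"
    by (simp add: algebra_simps)
  also have "\<dots> = k\<^sup>2 * (\<alpha> * (\<alpha> * k * (1 + \<alpha> * E) + (\<alpha>\<^sup>2 + 4 * \<alpha> + 1 + 2 * \<alpha>\<^sup>2 * E)))"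
    unfolding R by (simp add: algebra_simps power2_eq_square power3_eq_cube)
  \<comment> \<open>The closed form of the stationary JSQ mean with its denominators
    cleared.\<close>
  finally have main: "\<alpha> * k * (\<integral>x. x \<partial>\<pi>) * (1 + \<alpha> * E) = \<alpha> * k * (1 + \<alpha> * E) + (\<alpha>\<^sup>2 + 4 * \<alpha> + 1 + 2 * \<alpha>\<^sup>2 * E)"
    using k(1) alpha_pos by (simp add: power2_eq_square)
  also have "\<dots> \<le> 1.14 * k\<^sup>2 * (1 + \<alpha> * E)"
    using ratio_inequality[OF alpha_pos] unfolding k_def[symmetric] E_def[symmetric]
    unfolding k_def by (simp add: field_simps power2_eq_square)
  finally have "\<alpha> * k * (\<integral>x. x \<partial>\<pi>) * (1 + \<alpha> * E) \<le> 1.14 * k\<^sup>2 * (1 + \<alpha> * E)" .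
  then have "\<alpha> * k * (\<integral>x. x \<partial>\<pi>) \<le> 1.14 * k\<^sup>2" using aE by (simp only: mult_le_cancel_right_pos)
  then have "k * (\<alpha> * (\<integral>x. x \<partial>\<pi>)) \<le> k * (1.14 * k)" by (simp only: power2_eq_square mult_ac)
  then have "\<alpha> * (\<integral>x. x \<partial>\<pi>) \<le> 1.14 * k" using k(1) by (simp only: mult_le_cancel_left_pos)
  then show ?thesis using alpha_pos by (simp add: k_def field_simps)
qed

end

section \<open>From the stochastic equations to the abstract setting\<close>

text \<open>Removing the constant part - \<alpha> \<mu> of the drift leaves the push, which is
  nonnegative and vanishes above 2. Its time integral is therefore monotone, and flat while the path
  exceeds 2.\<close>

lemma JSQ_diffusion_regulated:
  assumes "0 < \<mu>" "0 < \<alpha>" and d: "JSQ_diffusion \<mu> \<alpha> P F B N"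
    and law: "\<forall>t\<ge>0. distr P borel (N t) = \<pi>"
  shows "JSQ_regulated P F B N \<mu> \<alpha> \<pi>"
proof -
  have bm: "brownian_motion P F B" and ad: "\<forall>t\<ge>0. N t \<in> borel_measurable (F t)"
    and sde: "AE \<omega> in P. continuous_on {0..} (\<lambda>t. N t \<omega>) \<and>
        (\<forall>t\<ge>0. 1 < N t \<omega> \<and>
           set_integrable lborel {0..t} (\<lambda>s. JSQ_drift \<mu> \<alpha> (N s \<omega>)) \<and>
           N t \<omega> = N 0 \<omega> + (LBINT s:{0..t}. JSQ_drift \<mu> \<alpha> (N s \<omega>)) + sqrt (2 * \<mu>) * B t \<omega>)"
    using d unfolding JSQ_diffusion_def by blast+
  \<comment> \<open>Differs from \<open>regulator\<close> by a multiple of \<open>B 0\<close>, hence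
    agrees with it almost surely.\<close>
  define Z where "Z t \<omega> = N t \<omega> - N 0 \<omega> + \<alpha> * \<mu> * t - sqrt (2 * \<mu>) * B t \<omega>" for t \<omega>
  have drift: "JSQ_drift \<mu> \<alpha> x + \<alpha> * \<mu> = JSQ_push \<mu> x" for x
    by (simp add: JSQ_drift_def JSQ_push_def algebra_simps)
  have Z: "AE \<omega> in P. \<forall>t\<ge>0. (\<lambda>s. JSQ_push \<mu> (N s \<omega>)) integrable_on {0..t} \<and>
      Z t \<omega> = integral {0..t} (\<lambda>s. JSQ_push \<mu> (N s \<omega>))"
    using sde
  proof (eventually_elim, intro allI impI)
    fix \<omega> and t :: real
    assume \<omega>: "continuous_on {0..} (\<lambda>t. N t \<omega>) \<and>
        (\<forall>t\<ge>0. 1 < N t \<omega> \<and>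
           set_integrable lborel {0..t} (\<lambda>s. JSQ_drift \<mu> \<alpha> (N s \<omega>)) \<and>
           N t \<omega> = N 0 \<omega> + (LBINT s:{0..t}. JSQ_drift \<mu> \<alpha> (N s \<omega>)) + sqrt (2 * \<mu>) * B t \<omega>)" and t: "0 \<le> t"
    have si: "set_integrable lborel {0..t} (\<lambda>s. JSQ_drift \<mu> \<alpha> (N s \<omega>))" using \<omega> t by blast
    note I = set_borel_integral_eq_integral[OF si]
    have "(\<lambda>s. JSQ_drift \<mu> \<alpha> (N s \<omega>) + \<alpha> * \<mu>) integrable_on {0..t}"
      by (intro Henstock_Kurzweil_Integration.integrable_add I(1)) auto
    moreover have "integral {0..t} (\<lambda>s. JSQ_drift \<mu> \<alpha> (N s \<omega>) + \<alpha> * \<mu>) = integral {0..t} (\<lambda>s. JSQ_drift \<mu> \<alpha> (N s \<omega>)) + \<alpha> * \<mu> * t"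
      using t I(1) by (subst Henstock_Kurzweil_Integration.integral_add) auto
    moreover have "N t \<omega> = N 0 \<omega> + integral {0..t} (\<lambda>s. JSQ_drift \<mu> \<alpha> (N s \<omega>)) + sqrt (2 * \<mu>) * B t \<omega>"
    proof -
      have "N t \<omega> = N 0 \<omega> + (LBINT s:{0..t}. JSQ_drift \<mu> \<alpha> (N s \<omega>)) + sqrt (2 * \<mu>) * B t \<omega>"
        using \<omega> t by blast
      then show ?thesis unfolding I(2) .
    qed
    ultimately show "(\<lambda>s. JSQ_push \<mu> (N s \<omega>)) integrable_on {0..t} \<and>
      Z t \<omega> = integral {0..t} (\<lambda>s. JSQ_push \<mu> (N s \<omega>))"
      unfolding drift Z_def by simp
  qed
  have Zd: "Z t \<omega> - Z s \<omega> = integral {s..t} (\<lambda>s. JSQ_push \<mu> (N s \<omega>))"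
    if "\<forall>t\<ge>0. (\<lambda>s. JSQ_push \<mu> (N s \<omega>)) integrable_on {0..t} \<and> Z t \<omega> = integral {0..t} (\<lambda>s. JSQ_push \<mu> (N s \<omega>))"
      "0 \<le> s" "s \<le> t" for s t \<omega>
    using Henstock_Kurzweil_Integration.integral_combine[of 0 s t "\<lambda>s. JSQ_push \<mu> (N s \<omega>)"] that by auto
  have reg: "regulated_diffusion P F B N \<mu> \<alpha> \<pi>"
  proof
    show "AE \<omega> in P. continuous_on {0..} (\<lambda>t. N t \<omega>)" using sde by eventually_elim blast
    show "AE \<omega> in P. \<forall>t\<ge>0. 1 \<le> N t \<omega>" using sde by eventually_elim (blast intro: less_imp_le)
    show "AE \<omega> in P. mono_on {0..} (\<lambda>t. N t \<omega> - N 0 \<omega> + \<alpha> * \<mu> * t - sqrt (2 * \<mu>) * B t \<omega>)"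
      unfolding Z_def[symmetric] using Z sde
    proof eventually_elim
      case (elim \<omega>)
      show ?case
      proof (rule mono_onI)
        fix s t :: real assume st: "s \<in> {0..}" "t \<in> {0..}" "s \<le> t"
        have "0 \<le> integral {s..t} (\<lambda>s. JSQ_push \<mu> (N s \<omega>))"
        proof (rule Henstock_Kurzweil_Integration.integral_nonneg)
          show "(\<lambda>s. JSQ_push \<mu> (N s \<omega>)) integrable_on {s..t}"
          proof (rule integrable_subinterval_real)
            show "(\<lambda>s. JSQ_push \<mu> (N s \<omega>)) integrable_on {0..t}"
              using elim(1) st(2) by (metis atLeast_iff)
          qed (use st in auto)
          show "0 \<le> JSQ_push \<mu> (N u \<omega>)" if "u \<in> {s..t}" for u
          proof (rule JSQ_push_nonneg[OF assms(1)])
            have "0 \<le> u" using st that by auto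
            then show "1 < N u \<omega>" using elim(2) by blast
          qed
        qed
        then show "Z s \<omega> \<le> Z t \<omega>" using Zd[OF elim(1), of s t] st by simp
      qed
    qed
    show "AE \<omega> in P. \<forall>s t. 0 \<le> s \<and> s \<le> t \<and> (\<forall>u\<in>{s..t}. 2 < N u \<omega>) \<longrightarrow>
          N t \<omega> - N s \<omega> = sqrt (2 * \<mu>) * (B t \<omega> - B s \<omega>) - \<alpha> * \<mu> * (t - s)"
      using Z
    proof (eventually_elim, intro allI impI)
      fix \<omega> and s t :: real
      assume \<omega>: "\<forall>t\<ge>0. (\<lambda>s. JSQ_push \<mu> (N s \<omega>)) integrable_on {0..t} \<and>
          Z t \<omega> = integral {0..t} (\<lambda>s. JSQ_push \<mu> (N s \<omega>))"
        and st: "0 \<le> s \<and> s \<le> t \<and> (\<forall>u\<in>{s..t}. 2 < N u \<omega>)"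
      have "integral {s..t} (\<lambda>s. JSQ_push \<mu> (N s \<omega>)) = integral {s..t} (\<lambda>_. 0)"
        by (rule Henstock_Kurzweil_Integration.integral_cong) (use st in \<open>auto simp: JSQ_push_def\<close>)
      then have "Z t \<omega> = Z s \<omega>" using Zd[OF \<omega>, of s t] st by simp
      then show "N t \<omega> - N s \<omega> = sqrt (2 * \<mu>) * (B t \<omega> - B s \<omega>) - \<alpha> * \<mu> * (t - s)"
        by (simp add: Z_def algebra_simps)
    qed
  qed (use bm ad law assms in auto)
  interpret regulated_diffusion P F B N \<mu> \<alpha> \<pi> by (rule reg)
  show ?thesis
  proof
    show "AE \<omega> in P. \<forall>t\<ge>0. 1 < N t \<omega>" using sde by eventually_elim blast
    show "AE \<omega> in P. \<forall>t\<ge>0. regulator t \<omega> = integral {0..t} (\<lambda>s. JSQ_push \<mu> (N s \<omega>))"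
      using Z brownian_motionD(7)[OF bm]
      by eventually_elim (simp add: regulator_def Z_def)
  qed
qed

text \<open>The equation identifies the regulator with \<open>L\<close>, which transfers its
  properties. Flatness is first derived above 1, in terms of \<open>N\<close> and \<open>B\<close>;
  flatness above 2 is a special case.\<close>

lemma CQ_diffusion_reflected:
  assumes "0 < \<mu>" "0 < \<alpha>" and d: "CQ_diffusion \<mu> \<alpha> P F B L N"
    and law: "\<forall>t\<ge>0. distr P borel (N t) = \<pi>"
  shows "CQ_reflected P F B N \<mu> \<alpha> \<pi>"
proof -
  have bm: "brownian_motion P F B" and ad: "\<forall>t\<ge>0. N t \<in> borel_measurable (F t)"
    and sde: "AE \<omega> in P. continuous_on {0..} (\<lambda>t. N t \<omega>) \<and>
        (\<forall>t\<ge>0. 1 \<le> N t \<omega> \<and>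
           N t \<omega> = N 0 \<omega> - \<alpha> * \<mu> * t + sqrt (2 * \<mu>) * B t \<omega> + L t \<omega>) \<and>
        L 0 \<omega> = 0 \<and>
        continuous_on {0..} (\<lambda>t. L t \<omega>) \<and>
        mono_on {0..} (\<lambda>t. L t \<omega>) \<and>
        (\<forall>s t. 0 \<le> s \<and> s \<le> t \<and> (\<forall>u\<in>{s..t}. 1 < N u \<omega>) \<longrightarrow> L t \<omega> = L s \<omega>)"
    using d unfolding CQ_diffusion_def by blast+
  have flat: "AE \<omega> in P. \<forall>s t. 0 \<le> s \<and> s \<le> t \<and> (\<forall>u\<in>{s..t}. 1 < N u \<omega>) \<longrightarrow>
      N t \<omega> - N s \<omega> = sqrt (2 * \<mu>) * (B t \<omega> - B s \<omega>) - \<alpha> * \<mu> * (t - s)"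
    using sde
  proof (eventually_elim, intro allI impI)
    fix \<omega> and s t :: real
    assume \<omega>: "continuous_on {0..} (\<lambda>t. N t \<omega>) \<and>
        (\<forall>t\<ge>0. 1 \<le> N t \<omega> \<and>
           N t \<omega> = N 0 \<omega> - \<alpha> * \<mu> * t + sqrt (2 * \<mu>) * B t \<omega> + L t \<omega>) \<and>
        L 0 \<omega> = 0 \<and>
        continuous_on {0..} (\<lambda>t. L t \<omega>) \<and>
        mono_on {0..} (\<lambda>t. L t \<omega>) \<and>
        (\<forall>s t. 0 \<le> s \<and> s \<le> t \<and> (\<forall>u\<in>{s..t}. 1 < N u \<omega>) \<longrightarrow> L t \<omega> = L s \<omega>)"
      and st: "0 \<le> s \<and> s \<le> t \<and> (\<forall>u\<in>{s..t}. 1 < N u \<omega>)"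
    have eq: "N r \<omega> = N 0 \<omega> - \<alpha> * \<mu> * r + sqrt (2 * \<mu>) * B r \<omega> + L r \<omega>" if "0 \<le> r" for r
      using \<omega> that by blast
    have "L t \<omega> = L s \<omega>" using \<omega> st by blast
    then show "N t \<omega> - N s \<omega> = sqrt (2 * \<mu>) * (B t \<omega> - B s \<omega>) - \<alpha> * \<mu> * (t - s)"
      using eq[of s] eq[of t] st by (simp add: algebra_simps)
  qed
  have reg: "regulated_diffusion P F B N \<mu> \<alpha> \<pi>"
  proof
    show "AE \<omega> in P. continuous_on {0..} (\<lambda>t. N t \<omega>)" using sde by eventually_elim blast
    show "AE \<omega> in P. \<forall>t\<ge>0. 1 \<le> N t \<omega>" using sde by eventually_elim blast
    show "AE \<omega> in P. mono_on {0..} (\<lambda>t. N t \<omega> - N 0 \<omega> + \<alpha> * \<mu> * t - sqrt (2 * \<mu>) * B t \<omega>)"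
      using sde
    proof eventually_elim
      case (elim \<omega>)
      have eq: "N r \<omega> - N 0 \<omega> + \<alpha> * \<mu> * r - sqrt (2 * \<mu>) * B r \<omega> = L r \<omega>" if "0 \<le> r" for r
      proof -
        have "N r \<omega> = N 0 \<omega> - \<alpha> * \<mu> * r + sqrt (2 * \<mu>) * B r \<omega> + L r \<omega>" using elim that by blast
        then show ?thesis by linarith
      qed
      have "mono_on {0..} (\<lambda>t. L t \<omega>)" using elim by blast
      then show ?case by (simp add: mono_on_def eq)
    qed
    show "AE \<omega> in P. \<forall>s t. 0 \<le> s \<and> s \<le> t \<and> (\<forall>u\<in>{s..t}. 2 < N u \<omega>) \<longrightarrow>
          N t \<omega> - N s \<omega> = sqrt (2 * \<mu>) * (B t \<omega> - B s \<omega>) - \<alpha> * \<mu> * (t - s)"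
      using flat
    proof (eventually_elim, intro allI impI)
      fix \<omega> and s t :: real
      assume \<omega>: "\<forall>s t. 0 \<le> s \<and> s \<le> t \<and> (\<forall>u\<in>{s..t}. 1 < N u \<omega>) \<longrightarrow>
          N t \<omega> - N s \<omega> = sqrt (2 * \<mu>) * (B t \<omega> - B s \<omega>) - \<alpha> * \<mu> * (t - s)"
        and st: "0 \<le> s \<and> s \<le> t \<and> (\<forall>u\<in>{s..t}. 2 < N u \<omega>)"
      have "\<forall>u\<in>{s..t}. 1 < N u \<omega>" using st by force
      then show "N t \<omega> - N s \<omega> = sqrt (2 * \<mu>) * (B t \<omega> - B s \<omega>) - \<alpha> * \<mu> * (t - s)"
        using \<omega> st by blast
    qed
  qed (use bm ad law assms in auto)
  interpret regulated_diffusion P F B N \<mu> \<alpha> \<pi> by (rule reg)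
  show ?thesis
  proof
    show "AE \<omega> in P. \<forall>s t. 0 \<le> s \<and> s \<le> t \<and> (\<forall>u\<in>{s..t}. 1 < N u \<omega>) \<longrightarrow> regulator t \<omega> = regulator s \<omega>"
      using flat by eventually_elim (simp add: regulator_def algebra_simps)
  qed
qed

text \<open>Integrability accompanies the bound because a Bochner integral of a non-integrable
  function is 0 and would not be a mean. The supremum is taken in the complete lattice
  \<open>ereal\<close>, where it is a genuine least upper bound.\<close>

theorem mainTheorem2:
  fixes \<mu> :: real and \<pi>\<^sub>J \<pi>\<^sub>C :: "real \<Rightarrow> real measure"
  assumes "\<mu> > 0"
    and "\<And>\<alpha>. \<alpha> > 0 \<Longrightarrow> JSQ_stationary_distribution TYPE('w) \<mu> \<alpha> (\<pi>\<^sub>J \<alpha>)"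
    and "\<And>\<alpha>. \<alpha> > 0 \<Longrightarrow> CQ_stationary_distribution TYPE('v) \<mu> \<alpha> (\<pi>\<^sub>C \<alpha>)"
  shows "(\<forall>\<alpha>>0. integrable (\<pi>\<^sub>J \<alpha>) (\<lambda>n. n) \<and> integrable (\<pi>\<^sub>C \<alpha>) (\<lambda>n. n)) \<and>
    (SUP \<alpha>\<in>{0<..}. ereal ((\<integral>n. n \<partial>\<pi>\<^sub>J \<alpha>) / (\<integral>n. n \<partial>\<pi>\<^sub>C \<alpha>))) \<le> ereal 1.14"
proof -
  have J: "integrable (\<pi>\<^sub>J \<alpha>) (\<lambda>n. n) \<and> (\<integral>n. n \<partial>\<pi>\<^sub>J \<alpha>) \<le> 1.14 * (1 + 1 / \<alpha>)" if \<alpha>: "0 < \<alpha>" for \<alpha>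
  proof -
    obtain P :: "'w measure" and F B N where "JSQ_diffusion \<mu> \<alpha> P F B N" "\<forall>t\<ge>0. distr P borel (N t) = \<pi>\<^sub>J \<alpha>"
      using assms(2)[OF \<alpha>] unfolding JSQ_stationary_distribution_def by blast
    then interpret JSQ_regulated P F B N \<mu> \<alpha> "\<pi>\<^sub>J \<alpha>"
      by (rule JSQ_diffusion_regulated[OF assms(1) \<alpha>])
    show ?thesis using JSQ_mean JSQ_mean_le by blast
  qed
  have C: "integrable (\<pi>\<^sub>C \<alpha>) (\<lambda>n. n) \<and> (\<integral>n. n \<partial>\<pi>\<^sub>C \<alpha>) = 1 + 1 / \<alpha>" if \<alpha>: "0 < \<alpha>" for \<alpha>
  proof -
    obtain P :: "'v measure" and F B L N where "CQ_diffusion \<mu> \<alpha> P F B L N" "\<forall>t\<ge>0. distr P borel (N t) = \<pi>\<^sub>C \<alpha>"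
      using assms(3)[OF \<alpha>] unfolding CQ_stationary_distribution_def by blast
    then interpret CQ_reflected P F B N \<mu> \<alpha> "\<pi>\<^sub>C \<alpha>"
      by (rule CQ_diffusion_reflected[OF assms(1) \<alpha>])
    show ?thesis using CQ_mean by blast
  qed
  have "(SUP \<alpha>\<in>{0<..}. ereal ((\<integral>n. n \<partial>\<pi>\<^sub>J \<alpha>) / (\<integral>n. n \<partial>\<pi>\<^sub>C \<alpha>))) \<le> ereal 1.14"
  proof (rule SUP_least)
    fix \<alpha> :: real assume "\<alpha> \<in> {0<..}"
    then have \<alpha>: "0 < \<alpha>" by simp
    then have "0 < 1 + 1 / \<alpha>" by (simp add: add_pos_pos)
    then show "ereal ((\<integral>n. n \<partial>\<pi>\<^sub>J \<alpha>) / (\<integral>n. n \<partial>\<pi>\<^sub>C \<alpha>)) \<le> ereal 1.14"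
      using J[OF \<alpha>] C[OF \<alpha>] by (simp add: divide_le_eq)
  qed
  then show ?thesis using J C by blast
qed

end
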